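(* Suppose $D\equiv5\bmod8$ is a (positive) fundamental discriminant with narrow class number $h_D^+=1$, and let $\pi\in\mathcal{O}_D$ be a totally positive prime element. Then there is exactly one twisted Teichmüller curve of determinant $\pi$, i.e. all matrices in $\mathrm{GL}_2^+(K)\cap\mathrm{Mat}^{2\times2}(\mathcal{O}_D)$ of determinant $\pi$ with relatively prime entries define the same twisted Teichmüller curve.
   Context: $K=\mathbb{Q}(\sqrt D)$, $\sigma$ its nontrivial Galois automorphism (applied entrywise to matrices), $w=\frac{1+\sqrt D}{2}$ and $\mathcal{O}_D=\mathbb{Z}\oplus\mathbb{Z}w$ the ring of integers. $\mathrm{GL}_2^+(K)$: matrices in $\mathrm{GL}_2(K)$ with totally positive determinant. $\mathbb{H},\mathbb{H}^-$: upper/lower half planes; $X_D=\mathbb{H}\times\mathbb{H}^-/\mathrm{SL}_2(\mathcal{O}_D)$ with action $(z_1,z_2)\mapsto(Az_1,A^\sigma z_2)$. Veech group: for $a,b>1$ let $P(a,b)$ be the L-shaped polygon with vertices $(0,0),(b,0),(b,a),(b-1,a),(b-1,1),(0,1)$; gluing opposite parallel sides by translations gives a genus 2 translation surface. Its Veech group is the group of derivatives in $\mathrm{SL}_2(\mathbb{R})$ of its orientation-preserving affine homeomorphisms. For $D\equiv5\bmod8$, $\mathrm{SL}(L_D)$ is the Veech group of $P(w,w)$; it is a lattice in $\mathrm{SL}_2(\mathbb{R})$ contained in $\mathrm{SL}_2(\mathcal{O}_D)$, and $C=\mathbb{H}/\mathrm{SL}(L_D)$ is the corresponding Teichmüller curve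 in $\mathcal{M}_2$. Graph (McMullen): sending a Riemann surface on $C$ to its Jacobian with real multiplication by $\mathcal{O}_D$ embeds $C$ into $X_D$; this map lifts to $z\mapsto(z,\varphi(z))\in\mathbb{H}\times\mathbb{H}^-$, with $\varphi$ holomorphic and not Möbius, and $\mathrm{SL}(L_D)=\{A\in\mathrm{SL}_2(\mathcal{O}_D): \varphi(Az)=A^\sigma\varphi(z)\ \forall z\in\mathbb{H}\}$. Twists: for $M\in\mathrm{GL}_2^+(K)$ the twisted Teichmüller curve $C_M$ is the image in $X_D$ of $z\mapsto(Mz,M^\sigma\varphi(z))$. Two matrices $M,N$ define the same twisted Teichmüller curve iff there is $J\in\mathrm{SL}_2(\mathcal{O}_D)$ with $\{(Mz,M^\sigma\varphi(z)):z\in\mathbb{H}\}=\{(JNz,J^\sigma N^\sigma\varphi(z)):z\in\mathbb{H}\}$. A twisted Teichmüller curve of determinant $k$ is one defined by a matrix in $\mathrm{GL}_2^+(K)\cap\mathrm{Mat}^{2\times2}(\mathcal{O}_D)$ with relatively prime entries and determinant $k$. *)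

theory Defs
  imports
    "HOL-Analysis.Analysis"
    "HOL-Computational_Algebra.Squarefree"
    "HOL-Algebra.Ring_Divisibility"
begin

section \<open>The real quadratic field\<close>

definition fundamental_discriminant :: "int \<Rightarrow> bool" where
  "fundamental_discriminant D \<longleftrightarrow>
     (D mod 4 = 1 \<and> squarefree D \<and> D \<noteq> 1) \<or>
     (\<exists>m. D = 4 * m \<and> (m mod 4 = 2 \<or> m mod 4 = 3) \<and> squarefree m)"

text \<open>
  The field \<open>K = Q(sqrt D)\<close> is realised as a subfield of the reals through its first
  embedding; the second embedding is the Galois conjugation.
\<close>

definition quad_field :: "int \<Rightarrow> real set" where
  "quad_field D = {of_rat p + of_rat q * sqrt (of_int D) | p q. True}"

definition galois :: "int \<Rightarrow> real \<Rightarrow> real" where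
  "galois D x = (THE y. \<exists>p q. x = of_rat p + of_rat q * sqrt (of_int D) \<and>
                               y = of_rat p - of_rat q * sqrt (of_int D))"

definition quad_w :: "int \<Rightarrow> real" where
  "quad_w D = (1 + sqrt (of_int D)) / 2"

text \<open>For \<open>D mod 4 = 1\<close> (the only case used here) this is the ring of integers of \<open>K\<close>.\<close>

definition quad_order :: "int \<Rightarrow> real ring" where
  "quad_order D =
     \<lparr>carrier = {of_int m + of_int n * quad_w D | m n. True},
      mult = (*), one = 1, zero = 0, add = (+)\<rparr>"

definition totally_positive :: "int \<Rightarrow> real \<Rightarrow> bool" where
  "totally_positive D x \<longleftrightarrow> x \<in> quad_field D \<and> x > 0 \<and> galois D x > 0"

definition narrow_class_rel :: "int \<Rightarrow> (real set \<times> real set) set" where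
  "narrow_class_rel D =
     {(I, J). ideal I (quad_order D) \<and> I \<noteq> {0} \<and> ideal J (quad_order D) \<and> J \<noteq> {0} \<and>
              (\<exists>x. totally_positive D x \<and> J = (\<lambda>y. x * y) ` I)}"

text \<open>
  Every narrow class of fractional ideals contains an integral ideal, so it suffices to
  count classes of nonzero integral ideals.
\<close>

definition narrow_class_number :: "int \<Rightarrow> nat" where
  "narrow_class_number D =
     card ({I. ideal I (quad_order D) \<and> I \<noteq> {0}} // narrow_class_rel D)"

section \<open>Matrix groups and the Hilbert modular surface\<close>

definition galois_mat :: "int \<Rightarrow> real^2^2 \<Rightarrow> real^2^2" where
  "galois_mat D A = (\<chi> i j. galois D (A $ i $ j))"

definition SL2_order :: "int \<Rightarrow> (real^2^2) set" where
  "SL2_order D = {A. (\<forall>i j. A $ i $ j \<in> carrier (quad_order D)) \<and> det A = 1}"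

definition GL2_plus :: "int \<Rightarrow> (real^2^2) set" where
  "GL2_plus D = {A. (\<forall>i j. A $ i $ j \<in> quad_field D) \<and> totally_positive D (det A)}"

definition upper_half :: "complex set" where
  "upper_half = {z. Im z > 0}"

definition lower_half :: "complex set" where
  "lower_half = {z. Im z < 0}"

definition moebius_mat :: "real^2^2 \<Rightarrow> complex \<Rightarrow> complex" where
  "moebius_mat A = moebius (of_real (A $ 1 $ 1)) (of_real (A $ 1 $ 2))
                           (of_real (A $ 2 $ 1)) (of_real (A $ 2 $ 2))"

definition hilbert_act :: "int \<Rightarrow> real^2^2 \<Rightarrow> complex \<times> complex \<Rightarrow> complex \<times> complex" where
  "hilbert_act D A = (\<lambda>(z1, z2). (moebius_mat A z1, moebius_mat (galois_mat D A) z2))"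

definition hilbert_orbit :: "int \<Rightarrow> complex \<times> complex \<Rightarrow> (complex \<times> complex) set" where
  "hilbert_orbit D p = (\<lambda>J. hilbert_act D J p) ` SL2_order D"

definition hilbert_surface :: "int \<Rightarrow> (complex \<times> complex) set set" where
  "hilbert_surface D = hilbert_orbit D ` (upper_half \<times> lower_half)"

section \<open>The L-shaped translation surface and its Veech group\<close>

definition L_polygon :: "real \<Rightarrow> real \<Rightarrow> complex set" where
  "L_polygon a b = {p. 0 \<le> Re p \<and> Re p \<le> b \<and> 0 \<le> Im p \<and> Im p \<le> 1} \<union>
                   {p. b - 1 \<le> Re p \<and> Re p \<le> b \<and> 0 \<le> Im p \<and> Im p \<le> a}"

text \<open>
  Side pairings. The right side of length \<open>a\<close> and the bottom side of length \<open>b\<close> are each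
  subdivided so as to match the two parallel sides opposite to them; a pair consists of a
  point on a left or bottom side and its partner on the right or top side.
\<close>

definition L_glue :: "real \<Rightarrow> real \<Rightarrow> (complex \<times> complex) set" where
  "L_glue a b =
     {(Complex 0 y, Complex b y) | y. 0 \<le> y \<and> y \<le> 1} \<union>
     {(Complex (b - 1) y, Complex b y) | y. 1 \<le> y \<and> y \<le> a} \<union>
     {(Complex x 0, Complex x 1) | x. 0 \<le> x \<and> x \<le> b - 1} \<union>
     {(Complex x 0, Complex x a) | x. b - 1 \<le> x \<and> x \<le> b}"

definition L_proj :: "real \<Rightarrow> real \<Rightarrow> complex \<Rightarrow> complex set" where
  "L_proj a b p = (L_glue a b \<union> (L_glue a b)\<inverse>)\<^sup>* `` {p}"

definition L_surface :: "real \<Rightarrow> real \<Rightarrow> complex set topology" where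
  "L_surface a b = topology (\<lambda>U. U \<subseteq> L_proj a b ` L_polygon a b \<and>
     openin (top_of_set (L_polygon a b)) {p \<in> L_polygon a b. L_proj a b p \<in> U})"

lemma openin_L_surface:
  "openin (L_surface a b) U \<longleftrightarrow> U \<subseteq> L_proj a b ` L_polygon a b \<and>
     openin (top_of_set (L_polygon a b)) {p \<in> L_polygon a b. L_proj a b p \<in> U}"
proof -
  let ?P = "L_polygon a b" and ?f = "L_proj a b"
  have *: "{p \<in> ?P. ?f p \<in> S \<inter> T} = {p \<in> ?P. ?f p \<in> S} \<inter> {p \<in> ?P. ?f p \<in> T}" for S T
    by auto
  have **: "{p \<in> ?P. ?f p \<in> \<Union>\<K>} = (\<Union>K\<in>\<K>. {p \<in> ?P. ?f p \<in> K})" for \<K>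
    by auto
  have "istopology (\<lambda>U. U \<subseteq> ?f ` ?P \<and> openin (top_of_set ?P) {p \<in> ?P. ?f p \<in> U})"
    unfolding istopology_def * ** by (auto intro!: openin_Int openin_Union)
  then show ?thesis
    unfolding L_surface_def by (simp add: topology_inverse')
qed

lemma topspace_L_surface: "topspace (L_surface a b) = L_proj a b ` L_polygon a b"
proof -
  have "{p \<in> L_polygon a b. L_proj a b p \<in> L_proj a b ` L_polygon a b} = L_polygon a b"
    by auto
  then have "openin (L_surface a b) (L_proj a b ` L_polygon a b)"
    by (simp add: openin_L_surface)
  then show ?thesis
    by (meson openin_L_surface openin_subset openin_topspace subset_antisym)
qed

lemma quotient_map_L_proj:
  "quotient_map (top_of_set (L_polygon a b)) (L_surface a b) (L_proj a b)"
  by (auto simp: quotient_map_def topspace_L_surface openin_L_surface)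

text \<open>
  All vertices, and also the two subdivision points \<open>(b - 1, 0)\<close> and \<open>(b, 1)\<close>, are identified
  to one point, which is the only cone point.
\<close>

definition L_cone_point :: "real \<Rightarrow> real \<Rightarrow> complex set" where
  "L_cone_point a b = L_proj a b 0"

text \<open>
  Charts of the translation atlas away from the cone point: a chart composed with the
  projection from the polygon is locally a translation, at boundary points of the polygon too.
\<close>

definition translation_chart ::
    "real \<Rightarrow> real \<Rightarrow> complex set set \<Rightarrow> (complex set \<Rightarrow> complex) \<Rightarrow> bool" where
  "translation_chart a b U \<psi> \<longleftrightarrow>
     openin (L_surface a b) U \<and> L_cone_point a b \<notin> U \<and>
     open (\<psi> ` U) \<and> homeomorphic_map (subtopology (L_surface a b) U) (top_of_set (\<psi> ` U)) \<psi> \<and>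
     (\<forall>p \<in> L_polygon a b. L_proj a b p \<in> U \<longrightarrow>
        (\<forall>\<^sub>F q in at p within L_polygon a b.
            \<psi> (L_proj a b q) = \<psi> (L_proj a b p) + (q - p)))"

definition real_linear :: "real^2^2 \<Rightarrow> complex \<Rightarrow> complex" where
  "real_linear A v = Complex (A $ 1 $ 1 * Re v + A $ 1 $ 2 * Im v)
                             (A $ 2 $ 1 * Re v + A $ 2 $ 2 * Im v)"

definition affine_homeomorphism ::
    "real \<Rightarrow> real \<Rightarrow> real^2^2 \<Rightarrow> (complex set \<Rightarrow> complex set) \<Rightarrow> bool" where
  "affine_homeomorphism a b A f \<longleftrightarrow>
     homeomorphic_map (L_surface a b) (L_surface a b) f \<and>
     f (L_cone_point a b) = L_cone_point a b \<and>
     (\<forall>U \<psi> V \<eta>. translation_chart a b U \<psi> \<longrightarrow> translation_chart a b V \<eta> \<longrightarrow>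
        (\<forall>x\<in>U. f x \<in> V \<longrightarrow>
           (\<exists>W. openin (L_surface a b) W \<and> x \<in> W \<and> W \<subseteq> U \<and> f ` W \<subseteq> V \<and>
              (\<forall>y\<in>W. \<eta> (f y) - \<eta> (f x) = real_linear A (\<psi> y - \<psi> x)))))"

definition veech_group :: "real \<Rightarrow> real \<Rightarrow> (real^2^2) set" where
  "veech_group a b = {A. det A = 1 \<and> (\<exists>f. affine_homeomorphism a b A f)}"

definition SL_L :: "int \<Rightarrow> (real^2^2) set" where
  "SL_L D = veech_group (quad_w D) (quad_w D)"

section \<open>The lift of the Jacobian map\<close>

text \<open>
  \<open>deform \<tau>\<close> is the real-linear map with \<open>1 \<mapsto> 1\<close> and \<open>\<i> \<mapsto> \<tau>\<close>. For \<open>z\<close> in the upper half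
  plane, the Riemann surface over \<open>z\<close> on the Teichmueller curve of \<open>P(a, b)\<close> is the polygon
  \<open>deform z ` L_polygon a b\<close> with its sides glued as before.
\<close>

definition deform :: "complex \<Rightarrow> complex \<Rightarrow> complex" where
  "deform \<tau> p = of_real (Re p) + of_real (Im p) * \<tau>"

definition galois_vec :: "int \<Rightarrow> complex \<Rightarrow> complex" where
  "galois_vec D v = Complex (galois D (Re v)) (galois D (Im v))"

text \<open>
  Let \<open>a = b = w\<close> and let \<open>X\<close> be the surface over \<open>z\<close>. The loops closed up by the four side
  pairings form a basis of the first homology of \<open>X\<close>. The translations \<open>q - p\<close> of the pairings
  are \<open>w, 1, \<i>, w * \<i>\<close>; this identifies the homology with \<open>O\<^sub>D \<oplus> O\<^sub>D\<close>, a class \<open>(x, y)\<close> having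
  period \<open>x + y * z\<close> for the form induced by \<open>d\<zeta>\<close> on the polygon. The intersection form
  becomes the trace of \<open>(x * y' - x' * y) / sqrt D\<close>, real multiplication is scalar
  multiplication, and the forms on \<open>X\<close> are spanned by \<open>d\<zeta>\<close> and a second eigenform, with
  conjugate periods \<open>galois x + galois y * \<tau>\<close> after normalisation. Thus the Jacobian is
  \<open>\<complex> \<times> \<complex>\<close> modulo all vectors \<open>(x + y * z, galois x + galois y * \<tau>)\<close>, which is the point
  \<open>(z, \<tau>)\<close> of the Hilbert modular surface. A holomorphic one-form on \<open>X\<close> is written as \<open>dF\<close>
  with a primitive \<open>F\<close> on the (simply connected) polygon.
\<close>

definition jacobian_lift :: "int \<Rightarrow> (complex \<Rightarrow> complex) \<Rightarrow> bool" where
  "jacobian_lift D \<phi> \<longleftrightarrow>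
     (let w = quad_w D; P = L_polygon w w in
      \<forall>z\<in>upper_half. \<phi> z \<in> lower_half \<and>
        (\<exists>F. continuous_on (deform z ` P) F \<and> F holomorphic_on interior (deform z ` P) \<and>
             (\<forall>(p, q) \<in> L_glue w w.
                F (deform z q) - F (deform z p) = deform (\<phi> z) (galois_vec D (q - p)))))"

section \<open>Twisted Teichmueller curves\<close>

definition twist_graph ::
    "int \<Rightarrow> (complex \<Rightarrow> complex) \<Rightarrow> real^2^2 \<Rightarrow> (complex \<times> complex) set" where
  "twist_graph D \<phi> M = (\<lambda>z. hilbert_act D M (z, \<phi> z)) ` upper_half"

text \<open>
  The image of the twisted graph in the Hilbert modular surface. For \<open>M\<close> in \<open>GL2_plus D\<close> and
  \<open>\<phi>\<close> mapping \<open>upper_half\<close> to \<open>lower_half\<close> it is a subset of \<open>hilbert_surface D\<close>.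
\<close>

definition twisted_curve ::
    "int \<Rightarrow> (complex \<Rightarrow> complex) \<Rightarrow> real^2^2 \<Rightarrow> (complex \<times> complex) set set" where
  "twisted_curve D \<phi> M = hilbert_orbit D ` twist_graph D \<phi> M"

definition same_twisted_curve ::
    "int \<Rightarrow> (complex \<Rightarrow> complex) \<Rightarrow> real^2^2 \<Rightarrow> real^2^2 \<Rightarrow> bool" where
  "same_twisted_curve D \<phi> M N \<longleftrightarrow>
     (\<exists>J\<in>SL2_order D. twist_graph D \<phi> M = hilbert_act D J ` twist_graph D \<phi> N)"

definition coprime_entries :: "int \<Rightarrow> real^2^2 \<Rightarrow> bool" where
  "coprime_entries D M \<longleftrightarrow>
     (\<forall>d \<in> carrier (quad_order D).
        (\<forall>i j. d divides\<^bsub>quad_order D\<^esub> (M $ i $ j)) \<longrightarrow> d \<in> Units (quad_order D))"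

definition twist_matrices :: "int \<Rightarrow> real \<Rightarrow> (real^2^2) set" where
  "twist_matrices D k =
     {M \<in> GL2_plus D. (\<forall>i j. M $ i $ j \<in> carrier (quad_order D)) \<and>
                      coprime_entries D M \<and> det M = k}"

end

theory Submission
  imports Defs
begin

text \<open>
  A matrix of determinant \<open>\<pi>\<close> with coprime entries has rank one modulo \<open>\<pi>\<close>, and its row space,
  a point of the projective line over \<open>O\<^sub>D / \<pi>\<close>, determines it up to left multiplication by
  \<open>SL\<^sub>2(O\<^sub>D)\<close>. By the equivariance of \<open>\<phi>\<close>, right multiplication by an element of \<open>SL(L\<^sub>D)\<close> does not
  change the twisted curve. So it suffices that \<open>SL(L\<^sub>D)\<close> acts transitively on this projective line,
  and for that it suffices to know a few elements, each realised by an affine homeomorphism of the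
  L-shaped surface. The horizontal twist \<open>(1, w; 0, 1)\<close> and the quarter turn \<open>(0, -1; 1, 0)\<close> are
  enough if \<open>\<pi>\<close> does not divide \<open>w\<close>: the twist changes \<open>(1 : \<alpha> + \<beta> w)\<close>, with integers \<open>\<alpha>\<close> and
  \<open>\<beta>\<close>, into \<open>(1 : \<alpha> (1 - w))\<close>, and since \<open>w (w - 1) = (D - 1) / 4\<close> is an integer, a quarter turn
  and another twist finish. If \<open>\<pi>\<close> divides \<open>w\<close>, the twist is trivial modulo \<open>\<pi>\<close>. Then \<open>w > 2\<close>, and
  the multitwist along the two cylinders in direction \<open>(w, 2)\<close> is congruent to \<open>(1, 0; 4, 1)\<close>
  modulo \<open>w\<close>, where 4 is invertible modulo \<open>\<pi>\<close>, because \<open>(D - 1) / 4\<close> is odd. All residues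
  modulo \<open>\<pi>\<close> are integers in this case.
\<close>

section \<open>Preliminaries\<close>

text \<open>If \<open>\<pi>\<close> divides \<open>w\<close>, twist and quarter turn generate modulo
  \<open>\<pi>\<close> only the powers of the quarter turn, so a parabolic element in a new
  direction is needed. Here \<open>D mod 8 = 5\<close> enters: with \<open>D = 8 * r + 5\<close>,
  \<open>w * (w - 1) = 2 * r + 1\<close> is odd, and the drift w (w - 1) / 2 across the upper
  rectangle is one half modulo its circumference 1, so the flow in direction (w, 2) closes up. Its
  cylinders have horizontal widths w / 2 - 1 and 1 / 2 and flow times 2 and 2 (w + 1). The quotients
  of time by width are 4 / (w - 2) and 4 (w + 1), and their ratio (w + 1) (w - 2) = 2 r - 1 is an
  integer. Hence sliding by 4 (w + 1) times the transverse coordinate twists both cylinders at once,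
  and this factor is 4 modulo w. On the geometric side, affinity is demanded in all translation
  charts of a quotient space. No chart is ever constructed: maps are given by formulas on unrolled
  cylinders, and the chart condition is deduced once and for all from displacements inside the
  polygon.\<close>

definition mat2 :: "real \<Rightarrow> real \<Rightarrow> real \<Rightarrow> real \<Rightarrow> real^2^2" where
  "mat2 a b c d = vector [vector [a, b], vector [c, d]]"

lemma mat2_simps [simp]:
  "mat2 a b c d $ 1 $ 1 = a" "mat2 a b c d $ 1 $ 2 = b"
  "mat2 a b c d $ 2 $ 1 = c" "mat2 a b c d $ 2 $ 2 = d"
  by (simp_all add: mat2_def)

lemma det_mat2 [simp]: "det (mat2 a b c d) = a * d - b * c"
  by (simp add: det_2)

lemma real_linear_mat2: "real_linear (mat2 a b c d) v = Complex (a * Re v + b * Im v) (c * Re v + d * Im v)"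
  by (simp add: real_linear_def)

lemma bounded_linear_real_linear: "bounded_linear (real_linear A)"
  unfolding linear_conv_bounded_linear[symmetric]
  by (rule linearI) (auto simp: real_linear_def complex_eq_iff algebra_simps)

lemma matrix_mult_nth_2:
  fixes A B :: "real^2^2"
  shows "(A ** B) $ i $ j = A $ i $ 1 * B $ 1 $ j + A $ i $ 2 * B $ 2 $ j"
  by (simp add: matrix_matrix_mult_def sum_2)

lemma matrix_eq_2: "A = (B :: real^2^2) \<longleftrightarrow>
    A $ 1 $ 1 = B $ 1 $ 1 \<and> A $ 1 $ 2 = B $ 1 $ 2 \<and> A $ 2 $ 1 = B $ 2 $ 1 \<and> A $ 2 $ 2 = B $ 2 $ 2"
  by (auto simp: vec_eq_iff forall_2)

text \<open>Applied to fibres of the projection, which are finite: a nearby point of the surface may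
  be close to any representative, so one radius has to serve all of them.\<close>

lemma uniform_finite:
  assumes "finite Q" "\<And>q. q \<in> Q \<Longrightarrow> \<exists>e>0. \<Phi> q e" "\<And>q e e'. \<Phi> q e \<Longrightarrow> e' \<le> e \<Longrightarrow> \<Phi> q e'"
  shows "\<exists>e>0::real. \<forall>q\<in>Q. \<Phi> q e"
  using assms(1,2)
proof (induction rule: finite_induct)
  case empty
  show ?case by (intro exI[of _ 1]) auto
next
  case (insert q Q)
  obtain e1 where "e1 > 0" "\<forall>q\<in>Q. \<Phi> q e1" using insert by auto
  moreover obtain e2 where "e2 > 0" "\<Phi> q e2" using insert.prems by blast
  ultimately show ?case using assms(3) by (intro exI[of _ "min e1 e2"]) auto
qed

lemma continuous_Complex [continuous_intros]:
  "continuous F f \<Longrightarrow> continuous F g \<Longrightarrow> continuous F (\<lambda>x. Complex (f x) (g x))"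
  unfolding continuous_def by (rule tendsto_Complex)

lemma Complex_add_of_real: "Complex x y + of_real r = Complex (x + r) y"
  by (simp add: complex_eq_iff)
lemma Complex_diff_of_real: "Complex x y - of_real r = Complex (x - r) y"
  by (simp add: complex_eq_iff)
lemma Complex_add_one: "Complex x y + 1 = Complex (x + 1) y"
  by (simp add: complex_eq_iff)

lemma mod_reduce: "p > 0 \<Longrightarrow> \<exists>k. 0 \<le> x - of_int k * p \<and> x - of_int k * p < (p :: real)"
  using floor_divide_lower[of p x] floor_divide_upper[of p x] by (intro exI[of _ "\<lfloor>x / p\<rfloor>"]) (auto simp: algebra_simps)

text \<open>Unrolls a map on a strip of width \<open>p\<close>, so that twists can be written
  without reduction modulo the circumference. \<open>G\<close> is evaluated only for real parts in
  [0, p); at the right edge its value is recovered from the left edge, whence the edge hypothesis in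
  \<open>periodic_ext_eq\<close>.\<close>

definition periodic_ext :: "real \<Rightarrow> (complex \<Rightarrow> 'c) \<Rightarrow> complex \<Rightarrow> 'c" where
  "periodic_ext p G z = G (Complex (Re z - p * of_int \<lfloor>Re z / p\<rfloor>) (Im z))"

lemma periodic_ext_add: "p > 0 \<Longrightarrow> periodic_ext p G (z + of_int k * of_real p) = periodic_ext p G z"
proof -
  assume "p > 0"
  then have "(Re z + of_int k * p) / p = Re z / p + of_int k" by (simp add: field_simps)
  then show ?thesis unfolding periodic_ext_def by (simp add: algebra_simps)
qed

lemma periodic_ext_eq:
  assumes "p > 0" "0 \<le> Re z" "Re z \<le> p" "G (Complex 0 (Im z)) = G (Complex p (Im z))"
  shows "periodic_ext p G z = G z"
proof (cases "Re z = p")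
  case True
  then show ?thesis using assms unfolding periodic_ext_def by (metis complex_surj diff_self div_self floor_one less_irrefl mult.right_neutral of_int_1)
next
  case False
  then have "\<lfloor>Re z / p\<rfloor> = 0" using assms by (simp add: floor_eq_iff)
  then show ?thesis unfolding periodic_ext_def by simp
qed

lemma periodic_shift_eq:
  assumes "p > 0" "0 \<le> Re z - of_int k * p" "Re z - of_int k * p \<le> p" "G (Complex 0 (Im z)) = G (Complex p (Im z))"
  shows "periodic_ext p G z = G (z - of_int k * of_real p)"
  using periodic_ext_add[of p G z "-k"] periodic_ext_eq[of p "z - of_int k * of_real p" G] assms by simp

lemma periodic_Complex_add:
  "p > 0 \<Longrightarrow> periodic_ext p G (Complex (x + of_int k * p) y) = periodic_ext p G (Complex x y)"
  using periodic_ext_add[of p G "Complex x y" k] by (simp add: complex_eq_iff Complex_eq algebra_simps)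

section \<open>Affine maps of the L-shaped surface\<close>

locale L_shape =
  fixes a b :: real
  assumes a_gt_1: "1 < a" and b_gt_1: "1 < b"
begin

abbreviation "P \<equiv> L_polygon a b"
abbreviation "pr \<equiv> L_proj a b"
abbreviation "X \<equiv> L_surface a b"
abbreviation "glue \<equiv> L_glue a b"

text \<open>The six corners and the two subdivision points: exactly the points at which several side
  pairings can meet.\<close>

definition vertices :: "complex set" where
  "vertices = {0, Complex (b-1) 0, Complex b 0, Complex 0 1, Complex (b-1) 1, Complex b 1,
               Complex (b-1) a, Complex b a}"

lemma glue_subset: "glue \<subseteq> P \<times> P"
  using a_gt_1 b_gt_1 unfolding L_glue_def L_polygon_def by auto

lemma pr_eq_iff: "pr p = pr q \<longleftrightarrow> (p, q) \<in> (glue \<union> glue\<inverse>)\<^sup>*"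
proof
  assume "pr p = pr q"
  moreover have "q \<in> pr q" unfolding L_proj_def by auto
  ultimately show "(p, q) \<in> (glue \<union> glue\<inverse>)\<^sup>*" unfolding L_proj_def by auto
next
  assume pq: "(p, q) \<in> (glue \<union> glue\<inverse>)\<^sup>*"
  have "sym (glue \<union> glue\<inverse>)" by (auto simp: sym_def)
  then have "(q, p) \<in> (glue \<union> glue\<inverse>)\<^sup>*" using pq by (meson sym_rtrancl symD)
  with pq show "pr p = pr q" unfolding L_proj_def by (auto intro: rtrancl_trans)
qed

lemma pr_glue: "(p, q) \<in> glue \<Longrightarrow> pr p = pr q"
  unfolding pr_eq_iff by auto

lemma pr_left_right: "0 \<le> y \<Longrightarrow> y \<le> 1 \<Longrightarrow> pr (Complex 0 y) = pr (Complex b y)"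
  by (rule pr_glue) (auto simp: L_glue_def)
lemma pr_left_right_upper: "1 \<le> y \<Longrightarrow> y \<le> a \<Longrightarrow> pr (Complex (b-1) y) = pr (Complex b y)"
  by (rule pr_glue) (auto simp: L_glue_def)
lemma pr_bottom_top: "0 \<le> x \<Longrightarrow> x \<le> b-1 \<Longrightarrow> pr (Complex x 0) = pr (Complex x 1)"
  by (rule pr_glue) (auto simp: L_glue_def)
lemma pr_bottom_top_upper: "b-1 \<le> x \<Longrightarrow> x \<le> b \<Longrightarrow> pr (Complex x 0) = pr (Complex x a)"
  by (rule pr_glue) (auto simp: L_glue_def)

lemma pr_vertices: "p \<in> vertices \<Longrightarrow> pr p = L_cone_point a b"
proof -
  have h: "0 = Complex 0 0" by (simp add: zero_complex.code)
  have 1: "pr (Complex 0 0) = pr (Complex b 0)" "pr (Complex 0 1) = pr (Complex b 1)"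
    using pr_left_right[of 0] pr_left_right[of 1] by auto
  have 2: "pr (Complex (b-1) 1) = pr (Complex b 1)" "pr (Complex (b-1) a) = pr (Complex b a)"
    using pr_left_right_upper[of 1] pr_left_right_upper[of a] a_gt_1 by auto
  have 3: "pr (Complex 0 0) = pr (Complex 0 1)" "pr (Complex (b-1) 0) = pr (Complex (b-1) 1)"
    using pr_bottom_top[of 0] pr_bottom_top[of "b-1"] b_gt_1 by auto
  have 4: "pr (Complex (b-1) 0) = pr (Complex (b-1) a)" "pr (Complex b 0) = pr (Complex b a)"
    using pr_bottom_top_upper[of "b-1"] pr_bottom_top_upper[of b] by auto
  show "p \<in> vertices \<Longrightarrow> pr p = L_cone_point a b"
    unfolding vertices_def L_cone_point_def h using 1 2 3 4 by auto
qed

section \<open>Fibres of the projection\<close>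

lemma glue_iff:
  "(p, q) \<in> glue \<longleftrightarrow>
     Re p = 0 \<and> Re q = b \<and> Im q = Im p \<and> 0 \<le> Im p \<and> Im p \<le> 1 \<or>
     Re p = b - 1 \<and> Re q = b \<and> Im q = Im p \<and> 1 \<le> Im p \<and> Im p \<le> a \<or>
     Im p = 0 \<and> Im q = 1 \<and> Re q = Re p \<and> 0 \<le> Re p \<and> Re p \<le> b - 1 \<or>
     Im p = 0 \<and> Im q = a \<and> Re q = Re p \<and> b - 1 \<le> Re p \<and> Re p \<le> b"
  unfolding L_glue_def by (cases p; cases q) auto

lemma vertices_iff:
  "p \<in> vertices \<longleftrightarrow>
     Im p = 0 \<and> Re p \<in> {0, b - 1, b} \<or> Im p = 1 \<and> Re p \<in> {0, b - 1, b} \<or>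
     Im p = a \<and> Re p \<in> {b - 1, b}"
  unfolding vertices_def by (auto simp: complex_eq_iff)

lemma glue_vertices_aux: "(p, q) \<in> glue \<Longrightarrow> p \<in> vertices \<longleftrightarrow> q \<in> vertices"
  using a_gt_1 b_gt_1 unfolding glue_iff vertices_iff by (elim disjE conjE) auto

lemma glue_vertices:
  assumes "(p, q) \<in> glue \<union> glue\<inverse>" shows "p \<in> vertices \<longleftrightarrow> q \<in> vertices"
  using assms glue_vertices_aux by blast

text \<open>Away from \<open>vertices\<close> a boundary point takes part in just one pairing, so
  crossing a side twice leads back to the start.\<close>

lemma glue_unique:
  assumes "(p, q) \<in> glue \<union> glue\<inverse>" "(q, r) \<in> glue \<union> glue\<inverse>" "q \<notin> vertices"
  shows "r = p"
proof -
  have 1: "r = p" if "(p, q) \<in> glue" "(q, r) \<in> glue" "q \<notin> vertices" for p q r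
    using that a_gt_1 b_gt_1 unfolding glue_iff vertices_iff by (elim disjE conjE) auto
  have 2: "r = p" if "(q, p) \<in> glue" "(q, r) \<in> glue" "q \<notin> vertices" for p q r
    using that a_gt_1 b_gt_1 unfolding glue_iff vertices_iff
    by (elim disjE conjE; (intro complex_eqI)?) auto
  have 3: "r = p" if "(p, q) \<in> glue" "(r, q) \<in> glue" "q \<notin> vertices" for p q r
    using that a_gt_1 b_gt_1 unfolding glue_iff vertices_iff
    by (elim disjE conjE; (intro complex_eqI)?) auto
  show ?thesis using assms 1 2 3 by blast
qed

text \<open>A chain of gluings either stays among the vertices or folds back at every second step,
  so it never becomes longer than one step.\<close>

lemma pr_eqD:
  assumes "pr p = pr q"
  shows "p = q \<or> (p, q) \<in> glue \<union> glue\<inverse> \<or> (p \<in> vertices \<and> q \<in> vertices)"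
  using assms[unfolded pr_eq_iff]
proof (induction rule: rtrancl_induct)
  case (step q r)
  then show ?case using glue_vertices glue_unique by (metis (no_types, lifting))
qed auto

lemma pr_eq_cases:
  "pr p = pr q \<longleftrightarrow> p = q \<or> (p, q) \<in> glue \<union> glue\<inverse> \<or> (p \<in> vertices \<and> q \<in> vertices)"
  using pr_eqD pr_vertices pr_glue by (metis Un_iff converse_iff)

lemma vertices_subset: "vertices \<subseteq> P"
  using a_gt_1 b_gt_1 unfolding vertices_def L_polygon_def by auto

lemma finite_vertices: "finite vertices" unfolding vertices_def by auto

lemma finite_fibre: "finite {q. pr q = pr p}"
proof -
  have "{q. pr q = pr p} \<subseteq> insert p (vertices \<union> {q. (p,q) \<in> glue \<union> glue\<inverse> \<and> p \<notin> vertices})"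
  proof
    fix q assume "q \<in> {q. pr q = pr p}"
    then show "q \<in> insert p (vertices \<union> {q. (p,q) \<in> glue \<union> glue\<inverse> \<and> p \<notin> vertices})"
      using pr_eqD[of p q] glue_vertices[of p q] by auto
  qed
  moreover have "finite {q. (p,q) \<in> glue \<union> glue\<inverse> \<and> p \<notin> vertices}"
  proof -
    have "q = r" if "(p,q) \<in> glue \<union> glue\<inverse>" "(p,r) \<in> glue \<union> glue\<inverse>" "p \<notin> vertices" for q r
      using glue_unique[of q p r] that by auto
    then have "{q. (p,q) \<in> glue \<union> glue\<inverse> \<and> p \<notin> vertices} \<subseteq>
      {SOME q. (p,q) \<in> glue \<union> glue\<inverse> \<and> p \<notin> vertices}"
      by (smt (verit, ccfv_threshold) mem_Collect_eq singletonI someI_ex subsetI)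
    then show ?thesis using finite_subset by blast
  qed
  ultimately show ?thesis using finite_vertices by (meson finite.insertI finite_UnI finite_subset)
qed

section \<open>Compactness and small neighbourhoods on the surface\<close>

lemma closed_polygon: "closed P"
  unfolding L_polygon_def by (intro closed_Un closed_Collect_conj closed_Collect_le continuous_intros)

lemma compact_polygon: "compact P"
proof -
  have "P \<subseteq> cbox 0 (Complex b a)" 
    using a_gt_1 b_gt_1 unfolding L_polygon_def by (auto simp: in_cbox_complex_iff)
  then show ?thesis using closed_polygon by (meson bounded_cbox bounded_subset compact_eq_bounded_closed)
qed

lemma compact_glue: "compact glue"
proof -
  have "compact ((\<lambda>t. (Complex (f t) (g t), Complex (f' t) (g' t))) ` {l..u})"
    if "continuous_on UNIV f" "continuous_on UNIV g" "continuous_on UNIV f'" "continuous_on UNIV g'" 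
    for f g f' g' :: "real \<Rightarrow> real" and l u
    unfolding Complex_eq
    by (intro compact_continuous_image continuous_intros continuous_on_subset[OF that(1)] 
      continuous_on_subset[OF that(2)] continuous_on_subset[OF that(3)] continuous_on_subset[OF that(4)]) auto
  note * = this
  have "glue = (\<lambda>t. (Complex 0 t, Complex b t)) ` {0..1} \<union> (\<lambda>t. (Complex (b-1) t, Complex b t)) ` {1..a}
     \<union> (\<lambda>t. (Complex t 0, Complex t 1)) ` {0..b-1} \<union> (\<lambda>t. (Complex t 0, Complex t a)) ` {b-1..b}"
    unfolding L_glue_def by (auto simp: image_iff)
  then show ?thesis by (auto intro!: compact_Un * continuous_intros)
qed

text \<open>The relation is a finite union of compact pieces: the diagonal, the pairings in both
  directions, and the pairs of vertices. Compactness makes saturations of compact sets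
  closed.\<close>

lemma compact_equivalence: "compact {(p, q). p \<in> P \<and> q \<in> P \<and> pr p = pr q}"
proof -
  have eq: "{(p, q). p \<in> P \<and> q \<in> P \<and> pr p = pr q} =
     (\<lambda>p. (p, p)) ` P \<union> glue \<union> (\<lambda>z. (snd z, fst z)) ` glue \<union> vertices \<times> vertices"
  proof (rule Set.set_eqI)
    fix z :: "complex \<times> complex"
    obtain p q where z: "z = (p, q)" by force
    have "(p, q) \<in> (\<lambda>z. (snd z, fst z)) ` glue \<longleftrightarrow> (q, p) \<in> glue" by (force simp: image_iff)
    moreover have "p \<in> P \<and> q \<in> P" if "(p, q) \<in> glue \<or> (q, p) \<in> glue" using that glue_subset by blast
    moreover have "p \<in> P" if "p \<in> vertices" for p using that vertices_subset by blast
    moreover have "(p, q) \<in> (\<lambda>p. (p, p)) ` P \<longleftrightarrow> p \<in> P \<and> p = q" by blast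
    ultimately show "z \<in> {(p, q). p \<in> P \<and> q \<in> P \<and> pr p = pr q} \<longleftrightarrow> z \<in>
      (\<lambda>p. (p, p)) ` P \<union> glue \<union> (\<lambda>z. (snd z, fst z)) ` glue \<union> vertices \<times> vertices"
      unfolding z Un_iff mem_Times_iff using pr_eq_cases[of p q] by auto
  qed
  show ?thesis unfolding eq
    using finite_imp_compact[OF finite_vertices]
    by (intro compact_Un compact_Times compact_polygon compact_glue)
       (rule compact_continuous_image, intro continuous_intros, rule compact_polygon compact_glue)+
qed

text \<open>Let \<open>K\<close> be the part of the polygon outside the \<open>e\<close>-balls
  around the fibre of \<open>p\<close>. The saturation of the compact set \<open>K\<close> is a
  projection of a compact set, hence closed, so removing the image of \<open>K\<close> from the
  surface leaves an open set.\<close>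

lemma small_neighbourhood:
  assumes "p \<in> P" "0 < e"
  obtains W where "openin X W" "pr p \<in> W"
    "\<And>q. q \<in> P \<Longrightarrow> pr q \<in> W \<Longrightarrow> \<exists>r\<in>P. pr r = pr p \<and> dist q r < e"
proof -
  define K where "K = P - (\<Union>r\<in>{r\<in>P. pr r = pr p}. ball r e)"
  define R where "R = {(p, q). p \<in> P \<and> q \<in> P \<and> pr p = pr q}"
  define W where "W = pr ` P - pr ` K"
  have "closed (- (\<Union>r\<in>{r\<in>P. pr r = pr p}. ball r e))" by (intro closed_Compl open_UN) auto
  then have "compact K" unfolding K_def Diff_eq by (rule compact_Int_closed[OF compact_polygon])
  then have "compact (snd ` (R \<inter> (K \<times> P)))"
    using compact_equivalence compact_polygon unfolding R_def
    by (intro compact_continuous_image continuous_intros compact_Int compact_Times)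
  then have cl: "closed (snd ` (R \<inter> (K \<times> P)))" by (rule compact_imp_closed)
  have "{q \<in> P. pr q \<in> W} = P \<inter> - snd ` (R \<inter> (K \<times> P))"
  proof -
    have "K \<subseteq> P" unfolding K_def by blast
    have "q \<in> snd ` (R \<inter> (K \<times> P)) \<longleftrightarrow> (\<exists>p\<in>K. pr q = pr p)" if "q \<in> P" for q
    proof
      assume "\<exists>p\<in>K. pr q = pr p"
      then obtain p where "p \<in> K" "pr q = pr p" by blast
      then have "(p, q) \<in> R \<inter> (K \<times> P)" using that \<open>K \<subseteq> P\<close> unfolding R_def by auto
      then show "q \<in> snd ` (R \<inter> (K \<times> P))" by (metis image_eqI snd_conv)
    next
      assume "q \<in> snd ` (R \<inter> (K \<times> P))"
      then obtain p where "p \<in> K" "(p, q) \<in> R" by auto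
      then show "\<exists>p\<in>K. pr q = pr p" unfolding R_def by (intro bexI[of _ p]) auto
    qed
    then show ?thesis unfolding W_def by blast
  qed
  then have "openin (top_of_set P) {q \<in> P. pr q \<in> W}"
    using cl by (metis openin_open open_Compl)
  then have "openin X W" unfolding openin_L_surface W_def by auto
  moreover have "pr p \<in> W" 
  proof -
    have "pr p \<noteq> pr r" if "r \<in> K" for r
      using that assms unfolding K_def by auto
    then show ?thesis unfolding W_def using assms by blast
  qed
  moreover have "\<exists>r\<in>P. pr r = pr p \<and> dist q r < e" if "q \<in> P" "pr q \<in> W" for q
  proof -
    have "q \<notin> K" using that unfolding W_def by blast
    then show ?thesis using that(1) unfolding K_def by (auto simp: dist_commute)
  qed
  ultimately show thesis using that by blast
qed

text \<open>
  A map \<open>c\<close> to the surface is locally affine at \<open>s\<close> with linear part \<open>L\<close> if, for \<open>s'\<close> near \<open>s\<close>,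
  the point \<open>c s'\<close> is reached from a point of the polygon representing \<open>c s\<close> by moving through
  \<open>L (s' - s)\<close> inside the polygon. The representative may depend on \<open>s'\<close>; this covers points on the
  sides, and also the cone point, where no translation chart exists.
\<close>
definition displ :: "complex set \<Rightarrow> complex \<Rightarrow> complex set \<Rightarrow> bool" where
  "displ x v y \<longleftrightarrow> (\<exists>p\<in>P. pr p = x \<and> p + v \<in> P \<and> pr (p + v) = y)"

definition loc_affine :: "(complex \<Rightarrow> complex) \<Rightarrow> (complex \<Rightarrow> complex set) \<Rightarrow> complex set \<Rightarrow> complex \<Rightarrow> bool" where
  "loc_affine L c S s \<longleftrightarrow> (\<exists>e>0. \<forall>s'\<in>S. dist s' s < e \<longrightarrow> displ (c s) (L (s' - s)) (c s'))"

section \<open>Calculus of locally affine maps\<close>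

lemma loc_affine_mono: "loc_affine L c S s \<Longrightarrow> T \<subseteq> S \<Longrightarrow> loc_affine L c T s"
  unfolding loc_affine_def by blast

lemma loc_affine_Un: 
  assumes "loc_affine L c S s" "loc_affine L c T s" shows "loc_affine L c (S \<union> T) s"
proof -
  obtain e1 e2 where e: "0 < e1" "0 < e2" and
    "\<forall>s'\<in>S. dist s' s < e1 \<longrightarrow> displ (c s) (L (s' - s)) (c s')" 
    "\<forall>s'\<in>T. dist s' s < e2 \<longrightarrow> displ (c s) (L (s' - s)) (c s')"
    using assms unfolding loc_affine_def by blast
  then show ?thesis unfolding loc_affine_def by (intro exI[of _ "min e1 e2"]) auto
qed

lemma loc_affine_closed: "closed S \<Longrightarrow> s \<notin> S \<Longrightarrow> loc_affine L c S s"
proof -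
  assume "closed S" "s \<notin> S"
  then obtain e where "0 < e" "ball s e \<subseteq> - S" by (metis ComplI open_Compl open_contains_ball)
  then have "\<forall>s'\<in>S. \<not> dist s' s < e" by (auto simp: dist_commute subset_iff)
  with \<open>0 < e\<close> show ?thesis unfolding loc_affine_def by blast
qed

text \<open>The tool for maps defined by cases: a closed piece that misses \<open>s\<close> keeps a
  positive distance from it and imposes no condition, so only the pieces through \<open>s\<close>
  have to be checked.\<close>

lemma loc_affine_Un_closed:
  assumes "closed S" "closed T" "s \<in> S \<Longrightarrow> loc_affine L c S s" "s \<in> T \<Longrightarrow> loc_affine L c T s"
  shows "loc_affine L c (S \<union> T) s"
  using assms loc_affine_Un loc_affine_closed by metis

lemma loc_affine_local:
  assumes "loc_affine L c T s" "open U" "s \<in> U" "S \<inter> U \<subseteq> T" shows "loc_affine L c S s"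
proof -
  obtain e1 where e1: "0 < e1" "ball s e1 \<subseteq> U" using assms by (meson open_contains_ball)
  obtain e2 where e2: "0 < e2" "\<forall>s'\<in>T. dist s' s < e2 \<longrightarrow> displ (c s) (L (s' - s)) (c s')"
    using assms unfolding loc_affine_def by blast
  show ?thesis unfolding loc_affine_def
    using e1 e2 assms(4) by (intro exI[of _ "min e1 e2"]) (auto simp: subset_iff dist_commute)
qed

lemma loc_affine_cong:
  assumes "loc_affine L c S s" "s \<in> S" "\<And>z. z \<in> S \<Longrightarrow> c' z = c z" "\<And>z. L' z = L z"
  shows "loc_affine L' c' S s"
  using assms unfolding loc_affine_def by metis

lemma loc_affine_pr: "s \<in> P \<Longrightarrow> loc_affine (\<lambda>z. z) pr P s"
  unfolding loc_affine_def displ_def by (intro exI[of _ 1]) auto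

text \<open>A chain rule for an affine inner map; with it the explicit formulas inherit local
  affinity from the unrolled projections.\<close>

lemma loc_affine_compose:
  assumes "loc_affine L c S (g s)" "\<And>s'. s' \<in> T \<Longrightarrow> g s' \<in> S" "continuous (at s) g"
    "\<And>s'. s' \<in> T \<Longrightarrow> L (g s' - g s) = L' (s' - s)" 
  shows "loc_affine L' (\<lambda>z. c (g z)) T s"
proof -
  obtain e where e: "0 < e" "\<forall>s'\<in>S. dist s' (g s) < e \<longrightarrow> displ (c (g s)) (L (s' - g s)) (c s')"
    using assms unfolding loc_affine_def by blast
  obtain d where "0 < d" "\<And>s'. dist s' s < d \<Longrightarrow> dist (g s') (g s) < e" 
    using assms(3) e(1) unfolding continuous_at_eps_delta by blast
  then show ?thesis using e assms(2,4) unfolding loc_affine_def by (metis (no_types, lifting))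
qed

text \<open>The representative of \<open>F p\<close> from which \<open>F r\<close> is reached may
  vary with \<open>r\<close>. The radius is therefore chosen uniformly over the finite fibre, and
  boundedness of \<open>L\<close> keeps the displacement below it.\<close>

lemma continuous_map_loc_affine:
  assumes F: "\<And>p. p \<in> P \<Longrightarrow> loc_affine L F P p" and L: "bounded_linear L"
  shows "continuous_map (top_of_set P) X F"
  unfolding continuous_map
proof (intro conjI allI impI)
  show "F ` topspace (top_of_set P) \<subseteq> topspace X"
  proof -
    have "F p \<in> topspace X" if "p \<in> P" for p
    proof -
      have "displ (F p) (L (p - p)) (F p)" using F[OF that] that unfolding loc_affine_def by force
      then show ?thesis unfolding displ_def topspace_L_surface by auto
    qed
    then show ?thesis by auto
  qed
next
  fix U assume U: "openin X U"
  obtain K where K: "0 < K" "\<And>v. norm (L v) \<le> norm v * K" using bounded_linear.pos_bounded[OF L] by blast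
  have "\<exists>e>0. \<forall>r\<in>P. dist r p < e \<longrightarrow> F r \<in> U" if p: "p \<in> P" "F p \<in> U" for p
  proof -
    let ?Q = "{q\<in>P. pr q = F p}"
    have "finite ?Q"
    proof (cases "?Q = {}")
      case False
      then obtain q where "q \<in> ?Q" by blast
      then show ?thesis using finite_fibre[of q] by (auto elim: rev_finite_subset)
    qed (simp only: finite.emptyI)
    moreover have "\<exists>e>0. \<forall>r\<in>P. dist r q < e \<longrightarrow> pr r \<in> U" if "q \<in> ?Q" for q
    proof -
      have "q \<in> {r\<in>P. pr r \<in> U}" using that p by simp
      moreover have "openin (top_of_set P) {r\<in>P. pr r \<in> U}" using U unfolding openin_L_surface by blast
      ultimately have "\<exists>e>0. \<forall>r\<in>P. dist r q < e \<longrightarrow> r \<in> {r\<in>P. pr r \<in> U}"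
        unfolding openin_euclidean_subtopology_iff by blast
      then show ?thesis by blast
    qed
    ultimately obtain e where e: "e > 0" "\<forall>q\<in>?Q. \<forall>r\<in>P. dist r q < e \<longrightarrow> pr r \<in> U"
      using uniform_finite[of ?Q "\<lambda>q e. \<forall>r\<in>P. dist r q < e \<longrightarrow> pr r \<in> U"] by force
    obtain d where d: "d > 0" "\<And>r. r \<in> P \<Longrightarrow> dist r p < d \<Longrightarrow> displ (F p) (L (r - p)) (F r)"
      using F[OF p(1)] unfolding loc_affine_def by blast
    have "F r \<in> U" if r: "r \<in> P" "dist r p < min d (e / K)" for r
    proof -
      obtain q where q: "q \<in> P" "pr q = F p" "q + L (r - p) \<in> P" "pr (q + L (r - p)) = F r"
        using d(2)[of r] r unfolding displ_def by auto
      have "norm (L (r - p)) \<le> dist r p * K" using K(2) by (simp add: dist_norm)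
      also have "\<dots> < e" using r K(1) by (simp add: field_simps)
      finally have "dist (q + L (r - p)) q < e" by (simp add: dist_norm)
      then show ?thesis using e(2) q by force
    qed
    then show ?thesis using d(1) e(1) K(1) by (intro exI[of _ "min d (e / K)"]) auto
  qed
  then show "openin (top_of_set P) {x \<in> topspace (top_of_set P). F x \<in> U}"
    unfolding openin_euclidean_subtopology_iff by auto
qed

section \<open>Descent from the polygon to the surface\<close>

definition induced :: "(complex \<Rightarrow> complex set) \<Rightarrow> complex set \<Rightarrow> complex set" where
  "induced F x = F (SOME p. p \<in> P \<and> pr p = x)"

definition glue_invariant :: "(complex \<Rightarrow> complex set) \<Rightarrow> bool" where
  "glue_invariant F \<longleftrightarrow> (\<forall>(p, q) \<in> glue. F p = F q)"

lemma glue_invariantD: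
  assumes "glue_invariant F" "pr p = pr q" shows "F p = F q"
  using assms(2)[unfolded pr_eq_iff]
proof (induction rule: rtrancl_induct)
  case (step r s)
  then show ?case using assms(1) unfolding glue_invariant_def by auto
qed simp

lemma induced_pr:
  assumes "glue_invariant F" "p \<in> P" shows "induced F (pr p) = F p"
proof -
  have "\<exists>q. q \<in> P \<and> pr q = pr p" using assms(2) by blast
  then have "(SOME q. q \<in> P \<and> pr q = pr p) \<in> P \<and> pr (SOME q. q \<in> P \<and> pr q = pr p) = pr p"
    by (rule someI_ex)
  then show ?thesis unfolding induced_def using glue_invariantD[OF assms(1)] by blast
qed

lemma continuous_map_induced:
  assumes "\<And>p. p \<in> P \<Longrightarrow> loc_affine L F P p" "bounded_linear L" "glue_invariant F"
  shows "continuous_map X X (induced F)"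
proof (rule continuous_compose_quotient_map[OF quotient_map_L_proj])
  have "continuous_map (top_of_set P) X F" using continuous_map_loc_affine assms by blast
  then show "continuous_map (top_of_set P) X (induced F \<circ> pr)"
    by (rule continuous_map_eq) (simp add: induced_pr[OF assms(3)])
qed

lemma chart_at:
  assumes "translation_chart a b U \<psi>" "q \<in> P" "pr q \<in> U"
  shows "\<exists>e>0. \<forall>r\<in>P. dist r q < e \<longrightarrow> \<psi> (pr r) = \<psi> (pr q) + (r - q)"
proof -
  have "\<forall>\<^sub>F r in at q within P. \<psi> (pr r) = \<psi> (pr q) + (r - q)"
    using assms unfolding translation_chart_def by blast
  then obtain e where "e > 0" "\<forall>r\<in>P. r \<noteq> q \<and> dist r q < e \<longrightarrow> \<psi> (pr r) = \<psi> (pr q) + (r - q)"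
    unfolding eventually_at by blast
  then show ?thesis by (intro exI[of _ e]) auto
qed

text \<open>Both \<open>F\<close> and \<open>F'\<close> descend to continuous maps, mutually inverse
  by \<open>inv\<close>. For the chart condition, displacements and both charts are controlled at
  all representatives of \<open>x\<close> and of its image at once; then both charts read off the
  displacement between representatives, which is \<open>r - q\<close> before and its image under
  \<open>A\<close> after applying the map.\<close>

lemma affine_homeomorphism_induced:
  assumes F: "\<And>p. p \<in> P \<Longrightarrow> loc_affine (real_linear A) F P p" "glue_invariant F"
    and F': "\<And>p. p \<in> P \<Longrightarrow> loc_affine (real_linear A') F' P p" "glue_invariant F'"
    and inv: "\<And>p. p \<in> P \<Longrightarrow> induced F' (F p) = pr p" "\<And>p. p \<in> P \<Longrightarrow> induced F (F' p) = pr p"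
    and cone: "F 0 = L_cone_point a b"
  shows "affine_homeomorphism a b A (induced F)"
  unfolding affine_homeomorphism_def
proof (intro conjI allI impI ballI)
  have "homeomorphic_maps X X (induced F) (induced F')"
    unfolding homeomorphic_maps_def
    using continuous_map_induced[OF F(1) bounded_linear_real_linear F(2)]
      continuous_map_induced[OF F'(1) bounded_linear_real_linear F'(2)]
      inv induced_pr[OF F(2)] induced_pr[OF F'(2)] by (auto simp: topspace_L_surface)
  then show hom: "homeomorphic_map X X (induced F)" using homeomorphic_map_maps by blast
  have "0 \<in> P" using vertices_subset unfolding vertices_def by auto
  then show "induced F (L_cone_point a b) = L_cone_point a b"
    using induced_pr[OF F(2)] cone unfolding L_cone_point_def by metis
  let ?f = "induced F" and ?L = "real_linear A"
  fix U \<psi> V \<eta> x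
  assume U: "translation_chart a b U \<psi>" and V: "translation_chart a b V \<eta>" and x: "x \<in> U" "?f x \<in> V"
  have oU: "openin X U" "openin X V" using U V unfolding translation_chart_def by auto
  have "x \<in> topspace X" using oU x openin_subset by blast
  then obtain p where p: "p \<in> P" "x = pr p" unfolding topspace_L_surface by blast
  have "?f x \<in> topspace X" using oU x openin_subset by blast
  then obtain p' where p': "p' \<in> P" "?f x = pr p'" unfolding topspace_L_surface by blast
  let ?Q = "{q\<in>P. pr q = x}" and ?Q' = "{q\<in>P. pr q = ?f x}"
  have fin: "finite ?Q" "finite ?Q'"
    using finite_fibre[of p] finite_fibre[of p'] p p' by (auto elim: rev_finite_subset)
  have "\<exists>e>0. \<forall>q\<in>?Q'. \<forall>r\<in>P. dist r q < e \<longrightarrow> \<eta> (pr r) = \<eta> (pr q) + (r - q)"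
    by (rule uniform_finite[OF fin(2)]) (use chart_at[OF V] x(2) in \<open>metis (mono_tags, lifting) mem_Collect_eq\<close>, force)
  then obtain e0 where e0: "e0 > 0" "\<And>q r. q\<in>?Q' \<Longrightarrow> r\<in>P \<Longrightarrow> dist r q < e0 \<Longrightarrow> \<eta> (pr r) = \<eta> (pr q) + (r - q)"
    by blast
  have "\<exists>e>0. \<forall>q\<in>?Q. \<forall>r\<in>P. dist r q < e \<longrightarrow> \<psi> (pr r) = \<psi> (pr q) + (r - q)"
    by (rule uniform_finite[OF fin(1)]) (use chart_at[OF U] x in auto)
  then obtain e1 where e1: "e1 > 0" "\<And>q r. q\<in>?Q \<Longrightarrow> r\<in>P \<Longrightarrow> dist r q < e1 \<Longrightarrow> \<psi> (pr r) = \<psi> (pr q) + (r - q)"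
    by blast
  have "\<exists>e>0. \<forall>q\<in>?Q. \<forall>r\<in>P. dist r q < e \<longrightarrow> displ (F q) (?L (r - q)) (F r)"
    by (rule uniform_finite[OF fin(1)]) (use F(1) in \<open>auto simp: loc_affine_def\<close>)
  then obtain e2 where e2: "e2 > 0" "\<And>q r. q\<in>?Q \<Longrightarrow> r\<in>P \<Longrightarrow> dist r q < e2 \<Longrightarrow> displ (F q) (?L (r - q)) (F r)"
    by blast
  obtain K where K: "0 < K" "\<And>v. norm (?L v) \<le> norm v * K"
    using bounded_linear.pos_bounded[OF bounded_linear_real_linear] by blast
  \<comment> \<open>Dividing by the norm bound \<open>K\<close> ensures that the displaced
    representative stays within \<open>e0\<close>, where \<eta> is a translation.\<close>
  define e where "e = min (min e1 e2) (e0 / K)"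
  have "e > 0" unfolding e_def using e0(1) e1(1) e2(1) K(1) by simp
  then obtain W where W: "openin X W" "pr p \<in> W"
    "\<And>q. q \<in> P \<Longrightarrow> pr q \<in> W \<Longrightarrow> \<exists>r\<in>P. pr r = pr p \<and> dist q r < e"
    using small_neighbourhood p(1) by metis
  let ?W = "W \<inter> U \<inter> {y \<in> topspace X. ?f y \<in> V}"
  have "openin X {y \<in> topspace X. ?f y \<in> V}"
    using homeomorphic_imp_continuous_map[OF hom] oU(2) openin_continuous_map_preimage by blast
  then have "openin X ?W" using W(1) oU(1) by (intro openin_Int)
  moreover have "x \<in> ?W" using W(2) p x \<open>x \<in> topspace X\<close> by simp
  moreover have "\<eta> (?f y) - \<eta> (?f x) = ?L (\<psi> y - \<psi> x)" if y: "y \<in> ?W" for y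
  proof -
    obtain r where r: "r \<in> P" "y = pr r" using y unfolding topspace_L_surface by blast
    \<comment> \<open>Being close to \<open>x\<close> in the surface only provides some
      representative of \<open>x\<close> near \<open>r\<close>; it need not be
      \<open>p\<close>.\<close>
    obtain q where q: "q \<in> P" "pr q = x" "dist r q < e" using W(3)[of r] r y p by auto
    have fx: "?f x = F q" "?f y = F r" using induced_pr[OF F(2)] q r by auto
    have "displ (F q) (?L (r - q)) (F r)" using e2(2) q r unfolding e_def by auto
    then obtain q' where q': "q' \<in> P" "pr q' = ?f x" "q' + ?L (r - q) \<in> P" "pr (q' + ?L (r - q)) = ?f y"
      unfolding displ_def fx by blast
    have "norm (?L (r - q)) \<le> dist r q * K" using K(2) by (simp add: dist_norm)
    also have "\<dots> < e0" using q(3) K(1) unfolding e_def by (simp add: field_simps)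
    finally have "\<eta> (?f y) = \<eta> (?f x) + ?L (r - q)"
      using e0(2)[of q' "q' + ?L (r - q)"] q' by (simp add: dist_norm)
    moreover have "\<psi> y = \<psi> x + (r - q)" using e1(2)[of q r] q r unfolding e_def by auto
    ultimately show ?thesis by simp
  qed
  ultimately show "\<exists>W. openin X W \<and> x \<in> W \<and> W \<subseteq> U \<and> ?f ` W \<subseteq> V \<and>
              (\<forall>y\<in>W. \<eta> (?f y) - \<eta> (?f x) = ?L (\<psi> y - \<psi> x))"
    by (intro exI[of _ ?W]) blast
qed

lemma glue_invariantI:
  assumes "\<And>y. 0 \<le> y \<Longrightarrow> y \<le> 1 \<Longrightarrow> F (Complex 0 y) = F (Complex b y)"
    and "\<And>y. 1 \<le> y \<Longrightarrow> y \<le> a \<Longrightarrow> F (Complex (b-1) y) = F (Complex b y)"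
    and "\<And>x. 0 \<le> x \<Longrightarrow> x \<le> b-1 \<Longrightarrow> F (Complex x 0) = F (Complex x 1)"
    and "\<And>x. b-1 \<le> x \<Longrightarrow> x \<le> b \<Longrightarrow> F (Complex x 0) = F (Complex x a)"
  shows "glue_invariant F"
  using assms unfolding glue_invariant_def L_glue_def by auto

text \<open>The strip is cut into the closed translates \<open>T k\<close> of its fundamental piece,
  on each of which the extension is a shifted copy of \<open>G\<close>; \<open>per\<close> makes
  neighbouring copies agree on the common edge.\<close>

lemma loc_affine_periodic_ext:
  assumes p: "p > 0" and s: "Im s \<in> J"
    and per: "\<And>y. y \<in> J \<Longrightarrow> G (Complex 0 y) = G (Complex p y)"
    and G: "\<And>z. 0 \<le> Re z \<Longrightarrow> Re z \<le> p \<Longrightarrow> Im z \<in> J \<Longrightarrow>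
              loc_affine L G {z. 0 \<le> Re z \<and> Re z \<le> p \<and> Im z \<in> J} z"
  shows "loc_affine L (periodic_ext p G) {z. Im z \<in> J} s"
proof -
  define T where "T k = {z. of_int k * p \<le> Re z \<and> Re z \<le> of_int (k+1) * p \<and> Im z \<in> J}" for k :: int
  have piece: "loc_affine L (periodic_ext p G) (T k) s" if "s \<in> T k" for k
  proof -
    let ?g = "\<lambda>z. z - of_int k * of_real p"
    have "loc_affine L (\<lambda>z. G (?g z)) (T k) s"
    proof (rule loc_affine_compose[where g = ?g])
      show "loc_affine L G {z. 0 \<le> Re z \<and> Re z \<le> p \<and> Im z \<in> J} (?g s)"
        using that s by (intro G) (auto simp: T_def algebra_simps)
    qed (auto simp: T_def algebra_simps)
    then show ?thesis
      by (rule loc_affine_cong) (use that periodic_shift_eq[OF p] per in \<open>auto simp: T_def algebra_simps\<close>)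
  qed
  define k where "k = \<lfloor>Re s / p\<rfloor>"
  have k: "of_int k * p \<le> Re s" "Re s < of_int (k+1) * p"
    using p floor_divide_lower[OF p, of "Re s"] floor_divide_upper[OF p, of "Re s"]
    unfolding k_def by simp_all
  have sk: "s \<in> T k" using k s unfolding T_def by auto
  show ?thesis
  \<comment> \<open>On a seam every neighbourhood meets two translates, so both are used.\<close>
  proof (cases "Re s = of_int k * p")
    case True
    then have "s \<in> T (k - 1)" using s p unfolding T_def by auto
    then have "loc_affine L (periodic_ext p G) (T k \<union> T (k - 1)) s" using piece sk by (intro loc_affine_Un) auto
    then show ?thesis
      by (rule loc_affine_local[where U = "{z. of_int (k-1) * p < Re z} \<inter> {z. Re z < of_int (k+1) * p}"])
         (use k True p in \<open>auto simp: T_def algebra_simps intro!: open_Int open_Collect_less continuous_intros\<close>)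
  next
    case False
    then show ?thesis
      by (intro loc_affine_local[OF piece[OF sk], where U = "{z. of_int k * p < Re z} \<inter> {z. Re z < of_int (k+1) * p}"])
         (use k in \<open>auto simp: T_def algebra_simps intro!: open_Int open_Collect_less continuous_intros\<close>)
  qed
qed

end

section \<open>Horizontal twists and the quarter turn\<close>

context L_shape
begin

definition lower_part :: "complex set" where
  "lower_part = {z. 0 \<le> Re z \<and> Re z \<le> b \<and> 0 \<le> Im z \<and> Im z \<le> 1}"
definition upper_part :: "complex set" where
  "upper_part = {z. b - 1 \<le> Re z \<and> Re z \<le> b \<and> 1 \<le> Im z \<and> Im z \<le> a}"

lemma polygon_parts: "P = lower_part \<union> upper_part"
  using a_gt_1 b_gt_1 unfolding L_polygon_def lower_part_def upper_part_def by auto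

lemma closed_parts: "closed lower_part" "closed upper_part"
  unfolding lower_part_def upper_part_def
  by (intro closed_Collect_conj closed_Collect_le continuous_intros)+

lemma loc_affine_parts:
  assumes "s \<in> P" "\<And>z. z \<in> lower_part \<Longrightarrow> F z = F0 z" "\<And>z. z \<in> upper_part \<Longrightarrow> F z = F1 z"
    "s \<in> lower_part \<Longrightarrow> loc_affine L F0 lower_part s" "s \<in> upper_part \<Longrightarrow> loc_affine L F1 upper_part s"
  shows "loc_affine L F P s"
  unfolding polygon_parts
  by (intro loc_affine_Un_closed closed_parts loc_affine_cong[OF assms(4)] loc_affine_cong[OF assms(5)])
     (use assms in auto)

text \<open>
  The two horizontal cylinders, unrolled. The first coordinate of the upper one is counted from
  its left side \<open>Re z = b - 1\<close>.
\<close>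
definition pr_lower :: "complex \<Rightarrow> complex set" where
  "pr_lower = periodic_ext b pr"
definition pr_upper :: "complex \<Rightarrow> complex set" where
  "pr_upper = periodic_ext 1 (\<lambda>z. pr (z + of_real (b - 1)))"

lemma pr_lower_add [simp]: "pr_lower (z + of_int k * of_real b) = pr_lower z"
  unfolding pr_lower_def by (rule periodic_ext_add) (use b_gt_1 in simp)
lemma pr_upper_add [simp]: "pr_upper (z + of_int k) = pr_upper z"
  unfolding pr_upper_def using periodic_ext_add[of 1] by simp
lemma pr_lower_Complex_add: "pr_lower (Complex (x + of_int k * b) y) = pr_lower (Complex x y)"
  unfolding pr_lower_def by (rule periodic_Complex_add) (use b_gt_1 in simp)
lemma pr_upper_Complex_add: "pr_upper (Complex (x + of_int k) y) = pr_upper (Complex x y)"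
  unfolding pr_upper_def using periodic_Complex_add[of 1] by simp

lemma pr_lower_eq:
  assumes "z \<in> lower_part" shows "pr_lower z = pr z"
  unfolding pr_lower_def
  by (rule periodic_ext_eq) (use assms b_gt_1 pr_left_right in \<open>auto simp: lower_part_def\<close>)

lemma pr_upper_eq:
  assumes "z \<in> upper_part" shows "pr_upper (z - of_real (b - 1)) = pr z"
proof -
  have "pr_upper (z - of_real (b - 1)) = pr (z - of_real (b - 1) + of_real (b - 1))"
    unfolding pr_upper_def
    by (rule periodic_ext_eq) (use assms pr_left_right_upper in \<open>simp_all add: upper_part_def Complex_add_of_real del: of_real_diff\<close>)
  then show ?thesis by simp
qed

lemma loc_affine_pr_lower:
  assumes "Im s \<in> {0..1}" shows "loc_affine (\<lambda>z. z) pr_lower {z. Im z \<in> {0..1}} s"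
  unfolding pr_lower_def
proof (rule loc_affine_periodic_ext)
  fix z assume "0 \<le> Re z" "Re z \<le> b" "Im z \<in> {0..1}"
  then show "loc_affine (\<lambda>z. z) pr {z. 0 \<le> Re z \<and> Re z \<le> b \<and> Im z \<in> {0..1}} z"
    by (intro loc_affine_mono[OF loc_affine_pr]) (auto simp: polygon_parts lower_part_def)
qed (use b_gt_1 assms pr_left_right in auto)

lemma loc_affine_pr_upper:
  assumes "Im s \<in> {1..a}" shows "loc_affine (\<lambda>z. z) pr_upper {z. Im z \<in> {1..a}} s"
  unfolding pr_upper_def
proof (rule loc_affine_periodic_ext)
  fix z assume "0 \<le> Re z" "Re z \<le> 1" "Im z \<in> {1..a}"
  then show "loc_affine (\<lambda>z. z) (\<lambda>z. pr (z + of_real (b - 1))) {z. 0 \<le> Re z \<and> Re z \<le> 1 \<and> Im z \<in> {1..a}} z"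
    by (intro loc_affine_compose[OF loc_affine_pr])
       (auto simp: polygon_parts upper_part_def)
qed (use assms pr_left_right_upper in \<open>simp_all add: Complex_add_of_real del: of_real_diff\<close>)

text \<open>The part of the boundary of the lower cylinder that is glued to itself. Over the
  remaining segment [b - 1, b] the upper cylinder is inserted, as the next two lemmas
  record.\<close>

lemma pr_lower_seam: "0 \<le> x \<Longrightarrow> x \<le> b - 1 \<Longrightarrow> pr_lower (Complex x 1) = pr_lower (Complex x 0)"
  by (subst (1 2) pr_lower_eq) (auto simp: lower_part_def pr_bottom_top)

lemma pr_upper_bottom:
  assumes "0 \<le> t" "t \<le> 1" shows "pr_upper (Complex t 1) = pr_lower (Complex (t + b - 1) 1)"
  using pr_upper_eq[of "Complex (t + b - 1) 1"] pr_lower_eq[of "Complex (t + b - 1) 1"] assms a_gt_1 b_gt_1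
  by (simp add: lower_part_def upper_part_def Complex_diff_of_real del: of_real_diff)

lemma pr_upper_top:
  assumes "0 \<le> t" "t \<le> 1" shows "pr_upper (Complex t a) = pr_lower (Complex (t + b - 1) 0)"
  using pr_upper_eq[of "Complex (t + b - 1) a"] pr_lower_eq[of "Complex (t + b - 1) 0"] assms a_gt_1 b_gt_1
    pr_bottom_top_upper[of "t + b - 1"]
  by (simp add: lower_part_def upper_part_def Complex_diff_of_real del: of_real_diff)

text \<open>Evaluates an induced map in unrolled coordinates: periodicity of \<open>H\<close>
  carries the formula from the rectangle to the whole strip.\<close>

lemma induced_pr_lower:
  assumes "glue_invariant F" "\<And>z. z \<in> lower_part \<Longrightarrow> F z = H z"
    "\<And>z k. H (z + of_int k * of_real b) = H z" "0 \<le> Im z" "Im z \<le> 1"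
  shows "induced F (pr_lower z) = H z"
proof -
  let ?k = "\<lfloor>Re z / b\<rfloor>"
  define z' where "z' = Complex (Re z - b * of_int ?k) (Im z)"
  have "z' \<in> lower_part"
    using assms(4,5) b_gt_1 floor_divide_lower[of b "Re z"] floor_divide_upper[of b "Re z"]
    unfolding z'_def lower_part_def by (auto simp: algebra_simps)
  moreover have "z = z' + of_int ?k * of_real b" unfolding z'_def by (simp add: complex_eq_iff algebra_simps)
  then have "H z = H z'" using assms(3)[of z' ?k] by simp
  moreover have "pr_lower z = pr z'" unfolding pr_lower_def periodic_ext_def z'_def ..
  ultimately show ?thesis using induced_pr[OF assms(1)] assms(2) polygon_parts by auto
qed

lemma induced_pr_upper:
  assumes "glue_invariant F" "\<And>z. z \<in> upper_part \<Longrightarrow> F z = H (z - of_real (b - 1))"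
    "\<And>z k. H (z + of_int k) = H z" "1 \<le> Im z" "Im z \<le> a"
  shows "induced F (pr_upper z) = H z"
proof -
  let ?k = "\<lfloor>Re z\<rfloor>"
  define z' where "z' = Complex (Re z - of_int ?k) (Im z) + of_real (b - 1)"
  have "z' \<in> upper_part"
    using assms(4,5) unfolding z'_def upper_part_def by (auto simp: algebra_simps) linarith+
  moreover have "z = z' - of_real (b - 1) + of_int ?k" unfolding z'_def by (simp add: complex_eq_iff algebra_simps)
  then have "H z = H (z' - of_real (b - 1))" using assms(3)[of "z' - of_real (b - 1)" ?k] by simp
  moreover have "pr_upper z = pr z'" unfolding pr_upper_def periodic_ext_def z'_def by simp
  ultimately show ?thesis using induced_pr[OF assms(1)] assms(2) polygon_parts by auto
qed

text \<open>The inverse of the member \<open>n\<close> of the family is the member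
  \<open>- n\<close>, so the one-sided identity, read for \<open>n\<close> and for
  \<open>- n\<close>, gives a two-sided inverse.\<close>

lemma veech_groupI:
  assumes "\<And>n p. p \<in> P \<Longrightarrow> loc_affine (real_linear (A n)) (F n) P p" "\<And>n. glue_invariant (F n)"
    "\<And>n p. p \<in> P \<Longrightarrow> induced (F (- n)) (F n p) = pr p" "F n 0 = L_cone_point a b" "det (A n) = 1"
  shows "A (n :: int) \<in> veech_group a b"
  using affine_homeomorphism_induced[of "A n" "F n" "A (- n)" "F (- n)"] assms(1,2,4,5) assms(3)[of _ n]
    assms(3)[of _ "- n"] unfolding veech_group_def by auto

lemma zero_in_lower: "0 \<in> lower_part" using b_gt_1 unfolding lower_part_def by simp

section \<open>The horizontal multitwist\<close>

definition shear :: "int \<Rightarrow> complex \<Rightarrow> complex" where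
  "shear n z = z + of_real (of_int n * b * Im z)"

text \<open>At height 1 the shear has moved by \<open>n * b\<close>, a period of the lower cylinder
  but in general not of the upper one. Subtracting it makes the upper shear start from the identity;
  subtracting \<open>b - 1\<close> passes to the coordinate of \<open>pr_upper\<close>.\<close>

definition twist :: "int \<Rightarrow> complex \<Rightarrow> complex set" where
  "twist n z = (if Im z \<le> 1 then pr_lower (shear n z)
     else pr_upper (shear n z - of_int n * of_real b - of_real (b - 1)))"

lemma twist_lower: "z \<in> lower_part \<Longrightarrow> twist n z = pr_lower (shear n z)"
  unfolding twist_def lower_part_def by simp

text \<open>Also valid on the common edge, where the lower formula shifts by the period
  \<open>n * b\<close> and the upper one does not shift.\<close>

lemma twist_upper:
  assumes "z \<in> upper_part"
  shows "twist n z = pr_upper (shear n (z - of_real (b - 1)) - of_int n * of_real b)"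
proof (cases "Im z = 1")
  case True
  define t where "t = Re z - (b - 1)"
  have z: "z = Complex (t + b - 1) 1" and t: "0 \<le> t" "t \<le> 1"
    using True assms unfolding t_def upper_part_def by (auto simp: complex_eq_iff)
  have "twist n z = pr_lower (z + of_int n * of_real b)" unfolding twist_def shear_def using True by simp
  also have "\<dots> = pr_upper (Complex t 1)" using pr_upper_bottom[OF t] unfolding pr_lower_add z by simp
  also have "Complex t 1 = shear n (z - of_real (b - 1)) - of_int n * of_real b"
    unfolding shear_def z by (simp add: complex_eq_iff)
  finally show ?thesis .
next
  case False
  then show ?thesis using assms unfolding twist_def upper_part_def shear_def by (simp add: algebra_simps)
qed

lemma shear_lower_add: "pr_lower (shear n (z + of_int k * of_real b)) = pr_lower (shear n z)"
  using pr_lower_add[of "shear n z" k] unfolding shear_def by (simp add: algebra_simps)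
lemma shear_upper_add: "pr_upper (shear n (z + of_int k) - c) = pr_upper (shear n z - c)"
  using pr_upper_add[of "shear n z - c" k] unfolding shear_def by (simp add: algebra_simps)

text \<open>Between height 1 and height \<open>a\<close> the shear moves by
  \<open>n * b * (a - 1) = n * N\<close>, a multiple of the circumference 1 of the upper cylinder.
  So the twist is the identity on the top edge, as it is on the bottom edge.\<close>

lemma glue_invariant_twist:
  assumes N: "b * (a - 1) = of_int N" shows "glue_invariant (twist n)"
proof (rule glue_invariantI)
  fix y :: real assume "0 \<le> y" "y \<le> 1"
  then show "twist n (Complex 0 y) = twist n (Complex b y)"
    using shear_lower_add[of n "Complex 0 y" 1] b_gt_1
    by (simp add: twist_lower lower_part_def Complex_add_of_real)
next
  fix y :: real assume "1 \<le> y" "y \<le> a"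
  then show "twist n (Complex (b - 1) y) = twist n (Complex b y)"
    using shear_upper_add[of n "Complex 0 y" 1] b_gt_1
    by (simp add: twist_upper upper_part_def Complex_diff_of_real Complex_add_one del: of_real_diff)
next
  fix x :: real assume x: "0 \<le> x" "x \<le> b - 1"
  have "twist n (Complex x 1) = pr_lower (Complex x 1 + of_int n * of_real b)"
    using x by (simp add: twist_lower lower_part_def shear_def)
  then show "twist n (Complex x 0) = twist n (Complex x 1)"
    using x unfolding pr_lower_add by (simp add: twist_lower lower_part_def shear_def pr_lower_seam)
next
  fix x :: real assume x: "b - 1 \<le> x" "x \<le> b"
  have "twist n (Complex x a) = pr_upper (shear n (Complex x a - of_real (b - 1)) - of_int n * of_real b)"
    using x a_gt_1 by (simp add: twist_upper upper_part_def)
  also have "shear n (Complex x a - of_real (b - 1)) - of_int n * of_real b =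
      Complex (x - (b - 1)) a + of_int (n * N)"
    using N unfolding shear_def by (simp add: complex_eq_iff algebra_simps)
  also have "pr_upper \<dots> = pr_lower (Complex x 0)"
    using pr_upper_top[of "x - (b - 1)"] x unfolding pr_upper_add by simp
  finally show "twist n (Complex x 0) = twist n (Complex x a)"
    using x b_gt_1 by (simp add: twist_lower lower_part_def shear_def)
qed

lemma loc_affine_twist:
  assumes "s \<in> P" shows "loc_affine (real_linear (mat2 1 (of_int n * b) 0 1)) (twist n) P s"
proof (rule loc_affine_parts[OF assms twist_lower twist_upper])
  assume "s \<in> lower_part"
  then show "loc_affine (real_linear (mat2 1 (of_int n * b) 0 1)) (\<lambda>z. pr_lower (shear n z)) lower_part s"
    by (intro loc_affine_compose[OF loc_affine_pr_lower])
       (auto simp: lower_part_def shear_def real_linear_mat2 complex_eq_iff algebra_simps intro!: continuous_intros)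
next
  assume "s \<in> upper_part"
  then show "loc_affine (real_linear (mat2 1 (of_int n * b) 0 1))
     (\<lambda>z. pr_upper (shear n (z - of_real (b - 1)) - of_int n * of_real b)) upper_part s"
    by (intro loc_affine_compose[OF loc_affine_pr_upper])
       (auto simp: upper_part_def shear_def real_linear_mat2 complex_eq_iff algebra_simps intro!: continuous_intros)
qed

lemma shear_veech:
  assumes N: "b * (a - 1) = of_int N"
  shows "mat2 1 (of_int n * b) 0 1 \<in> veech_group a b"
proof (rule veech_groupI[where A = "\<lambda>n. mat2 1 (of_int n * b) 0 1" and F = twist])
  show "glue_invariant (twist n)" for n using glue_invariant_twist[OF N] .
  show "induced (twist (- n)) (twist n p) = pr p" if "p \<in> P" for n p
  proof (cases "p \<in> lower_part")
    case True
    have "induced (twist (- n)) (pr_lower (shear n p)) = pr_lower (shear (- n) (shear n p))"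
      by (rule induced_pr_lower[OF glue_invariant_twist[OF N] twist_lower shear_lower_add])
         (use True in \<open>auto simp: shear_def lower_part_def\<close>)
    then show ?thesis using True by (simp add: twist_lower pr_lower_eq shear_def)
  next
    case False
    let ?q = "shear n (p - of_real (b - 1)) - of_int n * of_real b"
    have p: "p \<in> upper_part" using that False polygon_parts by auto
    have "induced (twist (- n)) (pr_upper ?q) = pr_upper (shear (- n) ?q - of_int (- n) * of_real b)"
      by (rule induced_pr_upper[OF glue_invariant_twist[OF N] twist_upper shear_upper_add])
         (use p in \<open>auto simp: shear_def upper_part_def\<close>)
    moreover have "shear (- n) ?q - of_int (- n) * of_real b = p - of_real (b - 1)"
      by (simp add: shear_def algebra_simps)
    ultimately show ?thesis using p pr_upper_eq[OF p] twist_upper[OF p] by metis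
  qed
  show "twist n 0 = L_cone_point a b"
    using zero_in_lower by (simp add: twist_lower shear_def pr_lower_eq L_cone_point_def)
qed (use loc_affine_twist in auto)

end

section \<open>The quarter turn\<close>

locale symmetric_L_shape = L_shape a a for a
begin

text \<open>The rotated L is cut and reassembled: the rectangle left of \<open>Re z = a - 1\<close>
  turns onto the upper rectangle, the column to its right onto the lower one. On the cut the two
  formulas give points paired by the gluing of the bottom segment [a - 1, a] with the top
  side.\<close>

definition quarter_turn :: "complex \<Rightarrow> complex set" where
  "quarter_turn z = pr (\<i> * z + (if Re z < a - 1 \<and> Im z \<le> 1 then Complex a 1 else Complex a (1 - a)))"

lemma quarter_turn_left:
  assumes "z \<in> lower_part" "Re z \<le> a - 1" shows "quarter_turn z = pr (\<i> * z + Complex a 1)"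
proof (cases "Re z < a - 1")
  case False
  then have "Re z = a - 1" using assms by simp
  then have "\<i> * z + Complex a 1 = Complex (a - Im z) a" "\<i> * z + Complex a (1 - a) = Complex (a - Im z) 0"
    by (auto simp: complex_eq_iff)
  then show ?thesis using False assms pr_bottom_top_upper[of "a - Im z"]
    unfolding quarter_turn_def lower_part_def by simp
qed (use assms in \<open>auto simp: quarter_turn_def lower_part_def\<close>)

lemma quarter_turn_right:
  "z \<in> P \<Longrightarrow> a - 1 \<le> Re z \<Longrightarrow> quarter_turn z = pr (\<i> * z + Complex a (1 - a))"
  unfolding quarter_turn_def by auto

lemma loc_affine_quarter_turn:
  assumes "s \<in> P" shows "loc_affine (\<lambda>v. \<i> * v) quarter_turn P s"
proof -
  let ?A = "lower_part \<inter> {z. Re z \<le> a - 1}" and ?B = "P \<inter> {z. a - 1 \<le> Re z}"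
  have "P = ?A \<union> ?B" unfolding polygon_parts by (auto simp: upper_part_def)
  moreover have "loc_affine (\<lambda>v. \<i> * v) quarter_turn (?A \<union> ?B) s"
  proof (rule loc_affine_Un_closed)
    show "closed ?A" "closed ?B"
      by (intro closed_Int closed_parts closed_polygon closed_Collect_le continuous_intros)+
    have "loc_affine (\<lambda>v. \<i> * v) (\<lambda>z. pr (\<i> * z + Complex a 1)) ?A s" if "s \<in> ?A"
      by (rule loc_affine_compose[OF loc_affine_pr])
         (use that a_gt_1 in \<open>auto simp: polygon_parts lower_part_def upper_part_def algebra_simps intro!: continuous_intros\<close>)
    then show "loc_affine (\<lambda>v. \<i> * v) quarter_turn ?A s" if "s \<in> ?A"
      by (rule loc_affine_cong) (use that quarter_turn_left in auto)
    have "loc_affine (\<lambda>v. \<i> * v) (\<lambda>z. pr (\<i> * z + Complex a (1 - a))) ?B s" if "s \<in> ?B"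
      by (rule loc_affine_compose[OF loc_affine_pr])
         (use that a_gt_1 in \<open>auto simp: polygon_parts lower_part_def upper_part_def algebra_simps intro!: continuous_intros\<close>)
    then show "loc_affine (\<lambda>v. \<i> * v) quarter_turn ?B s" if "s \<in> ?B"
      by (rule loc_affine_cong) (use that quarter_turn_right in auto)
  qed
  ultimately show ?thesis by simp
qed

lemma glue_invariant_quarter_turn: "glue_invariant quarter_turn"
proof (rule glue_invariantI)
  fix y :: real assume y: "0 \<le> y" "y \<le> 1"
  have "\<i> * Complex 0 y + Complex a 1 = Complex (a - y) 1" "\<i> * Complex a y + Complex a (1 - a) = Complex (a - y) 1"
    by (auto simp: complex_eq_iff)
  then show "quarter_turn (Complex 0 y) = quarter_turn (Complex a y)"
    using y a_gt_1 by (simp add: quarter_turn_def)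
next
  fix y :: real assume y: "1 \<le> y" "y \<le> a"
  have "\<i> * Complex (a - 1) y + Complex a (1 - a) = Complex (a - y) 0" "\<i> * Complex a y + Complex a (1 - a) = Complex (a - y) 1"
    by (auto simp: complex_eq_iff)
  then show "quarter_turn (Complex (a - 1) y) = quarter_turn (Complex a y)"
    using y pr_bottom_top[of "a - y"] by (simp add: quarter_turn_def)
next
  fix x :: real assume x: "0 \<le> x" "x \<le> a - 1"
  have "\<i> * Complex x 0 + Complex a 1 = Complex a (x + 1)" "\<i> * Complex x 1 + Complex a 1 = Complex (a - 1) (x + 1)"
    by (auto simp: complex_eq_iff)
  then show "quarter_turn (Complex x 0) = quarter_turn (Complex x 1)"
    using x pr_left_right_upper[of "x + 1"] by (simp add: quarter_turn_left lower_part_def)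
next
  fix x :: real assume x: "a - 1 \<le> x" "x \<le> a"
  have "\<i> * Complex x 0 + Complex a (1 - a) = Complex a (x + 1 - a)" "\<i> * Complex x a + Complex a (1 - a) = Complex 0 (x + 1 - a)"
    by (auto simp: complex_eq_iff)
  then show "quarter_turn (Complex x 0) = quarter_turn (Complex x a)"
    using x a_gt_1 pr_left_right[of "x + 1 - a"] by (simp add: quarter_turn_def)
qed

text \<open>The inverse cuts along the image of the former cut, the edge between lower and upper
  rectangle.\<close>

definition quarter_turn_back :: "complex \<Rightarrow> complex set" where
  "quarter_turn_back z = pr (- \<i> * (z - (if 1 < Im z then Complex a 1 else Complex a (1 - a))))"

lemma quarter_turn_back_lower:
  "z \<in> lower_part \<Longrightarrow> quarter_turn_back z = pr (- \<i> * (z - Complex a (1 - a)))"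
  unfolding quarter_turn_back_def lower_part_def by auto

lemma quarter_turn_back_upper:
  assumes "z \<in> upper_part" shows "quarter_turn_back z = pr (- \<i> * (z - Complex a 1))"
proof (cases "1 < Im z")
  case False
  then have "Im z = 1" using assms unfolding upper_part_def by auto
  then have "- \<i> * (z - Complex a 1) = Complex 0 (a - Re z)"
    "- \<i> * (z - Complex a (1 - a)) = Complex a (a - Re z)"
    by (auto simp: complex_eq_iff)
  then show ?thesis using False assms pr_left_right[of "a - Re z"]
    unfolding quarter_turn_back_def upper_part_def by simp
qed (simp add: quarter_turn_back_def)

lemma loc_affine_quarter_turn_back:
  assumes "s \<in> P" shows "loc_affine (\<lambda>v. - \<i> * v) quarter_turn_back P s"
  by (rule loc_affine_parts[OF assms quarter_turn_back_lower quarter_turn_back_upper];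
      assumption?; intro loc_affine_compose[OF loc_affine_pr])
     (use a_gt_1 in \<open>auto simp: polygon_parts lower_part_def upper_part_def algebra_simps intro!: continuous_intros\<close>)

lemma glue_invariant_quarter_turn_back: "glue_invariant quarter_turn_back"
proof (rule glue_invariantI)
  fix y :: real assume y: "0 \<le> y" "y \<le> 1"
  have "- \<i> * (Complex 0 y - Complex a (1 - a)) = Complex (y + a - 1) a"
    "- \<i> * (Complex a y - Complex a (1 - a)) = Complex (y + a - 1) 0"
    by (auto simp: complex_eq_iff)
  then show "quarter_turn_back (Complex 0 y) = quarter_turn_back (Complex a y)"
    using y a_gt_1 pr_bottom_top_upper[of "y + a - 1"] by (simp add: quarter_turn_back_lower lower_part_def)
next
  fix y :: real assume y: "1 \<le> y" "y \<le> a"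
  have "- \<i> * (Complex (a - 1) y - Complex a 1) = Complex (y - 1) 1"
    "- \<i> * (Complex a y - Complex a 1) = Complex (y - 1) 0"
    by (auto simp: complex_eq_iff)
  then show "quarter_turn_back (Complex (a - 1) y) = quarter_turn_back (Complex a y)"
    using y pr_bottom_top[of "y - 1"] by (simp add: quarter_turn_back_upper upper_part_def)
next
  fix x :: real assume x: "0 \<le> x" "x \<le> a - 1"
  have "- \<i> * (Complex x 0 - Complex a (1 - a)) = Complex (a - 1) (a - x)"
    "- \<i> * (Complex x 1 - Complex a (1 - a)) = Complex a (a - x)"
    by (auto simp: complex_eq_iff)
  then show "quarter_turn_back (Complex x 0) = quarter_turn_back (Complex x 1)"
    using x pr_left_right_upper[of "a - x"] by (simp add: quarter_turn_back_lower lower_part_def)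
next
  fix x :: real assume x: "a - 1 \<le> x" "x \<le> a"
  have "- \<i> * (Complex x 0 - Complex a (1 - a)) = Complex (a - 1) (a - x)"
    "- \<i> * (Complex x a - Complex a 1) = Complex (a - 1) (a - x)"
    by (auto simp: complex_eq_iff)
  then show "quarter_turn_back (Complex x 0) = quarter_turn_back (Complex x a)"
    using x a_gt_1 by (simp add: quarter_turn_back_lower quarter_turn_back_upper lower_part_def upper_part_def)
qed

lemma quarter_turn_back_left_inverse:
  assumes "z \<in> P" shows "induced quarter_turn_back (quarter_turn z) = pr z"
proof (cases "Re z < a - 1")
  case True
  then have z: "z \<in> lower_part" "Re z \<le> a - 1"
    using assms unfolding polygon_parts lower_part_def upper_part_def by auto
  then have "\<i> * z + Complex a 1 \<in> upper_part" unfolding lower_part_def upper_part_def by auto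
  then have "induced quarter_turn_back (pr (\<i> * z + Complex a 1)) = pr z"
    using polygon_parts by (simp add: induced_pr[OF glue_invariant_quarter_turn_back] quarter_turn_back_upper)
  then show ?thesis using quarter_turn_left[OF z] by simp
next
  case False
  have "\<i> * z + Complex a (1 - a) \<in> lower_part"
    using False assms a_gt_1 unfolding polygon_parts lower_part_def upper_part_def by auto
  then have "induced quarter_turn_back (pr (\<i> * z + Complex a (1 - a))) = pr z"
    using polygon_parts by (simp add: induced_pr[OF glue_invariant_quarter_turn_back] quarter_turn_back_lower)
  then show ?thesis using quarter_turn_right[OF assms] False by simp
qed

lemma quarter_turn_back_right_inverse:
  assumes "z \<in> P" shows "induced quarter_turn (quarter_turn_back z) = pr z"
proof (cases "z \<in> lower_part")
  case True
  let ?y = "- \<i> * (z - Complex a (1 - a))"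
  have "?y \<in> P" "a - 1 \<le> Re ?y"
    using True a_gt_1 unfolding polygon_parts lower_part_def upper_part_def by auto
  then have "induced quarter_turn (pr ?y) = pr (\<i> * ?y + Complex a (1 - a))"
    using quarter_turn_right by (simp add: induced_pr[OF glue_invariant_quarter_turn])
  moreover have "\<i> * ?y + Complex a (1 - a) = z" by (simp add: complex_eq_iff)
  ultimately show ?thesis using True by (simp add: quarter_turn_back_lower)
next
  case False
  let ?y = "- \<i> * (z - Complex a 1)"
  have z: "z \<in> upper_part" using assms False polygon_parts by auto
  then have "?y \<in> lower_part" "Re ?y \<le> a - 1" unfolding lower_part_def upper_part_def by auto
  then have "induced quarter_turn (pr ?y) = pr (\<i> * ?y + Complex a 1)"
    using quarter_turn_left polygon_parts by (simp add: induced_pr[OF glue_invariant_quarter_turn])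
  moreover have "\<i> * ?y + Complex a 1 = z" by (simp add: complex_eq_iff)
  ultimately show ?thesis using z by (simp add: quarter_turn_back_upper)
qed

lemma quarter_turn_veech: "mat2 0 (-1) 1 0 \<in> veech_group a a"
proof -
  have "affine_homeomorphism a a (mat2 0 (-1) 1 0) (induced quarter_turn)"
  proof (rule affine_homeomorphism_induced)
    fix p assume "p \<in> P"
    then show "loc_affine (real_linear (mat2 0 (-1) 1 0)) quarter_turn P p"
      by (intro loc_affine_cong[OF loc_affine_quarter_turn]) (auto simp: real_linear_mat2 complex_eq_iff)
    show "loc_affine (real_linear (mat2 0 1 (-1) 0)) quarter_turn_back P p"
      using \<open>p \<in> P\<close>
      by (intro loc_affine_cong[OF loc_affine_quarter_turn_back]) (auto simp: real_linear_mat2 complex_eq_iff)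
  next
    show "quarter_turn 0 = L_cone_point a a"
      using a_gt_1 pr_vertices[of "Complex a 1"] by (simp add: quarter_turn_def vertices_def)
  qed (auto simp: glue_invariant_quarter_turn glue_invariant_quarter_turn_back
        quarter_turn_back_left_inverse quarter_turn_back_right_inverse)
  then show ?thesis unfolding veech_group_def by auto
qed

end

section \<open>The twist along the cylinders of direction (w, 2)\<close>

context L_shape begin

text \<open>The halves appear as arbitrary \<open>T\<close> so that, in nested cuts, each can be
  enlarged to a rectangle of the form required for the next cut.\<close>

lemma loc_affine_split:
  assumes "closed J" "\<And>z. z \<in> S \<Longrightarrow> Re z \<le> m \<Longrightarrow> c z = c1 z" "\<And>z. z \<in> S \<Longrightarrow> m \<le> Re z \<Longrightarrow> c z = c2 z"
    and S: "S = {z. l \<le> Re z \<and> Re z \<le> u \<and> Im z \<in> J}"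
    and "s \<in> S"
    and 1: "\<And>T. l \<le> Re s \<Longrightarrow> Re s \<le> m \<Longrightarrow> T \<subseteq> S \<Longrightarrow> T \<subseteq> {z. Re z \<le> m} \<Longrightarrow> loc_affine L c1 T s" 
    and 2: "\<And>T. m \<le> Re s \<Longrightarrow> Re s \<le> u \<Longrightarrow> T \<subseteq> S \<Longrightarrow> T \<subseteq> {z. m \<le> Re z} \<Longrightarrow> loc_affine L c2 T s" 
  shows "loc_affine L c S s"
proof -
  have J: "closed {z. Im z \<in> J}"
    using continuous_closed_vimage[OF assms(1), of Im] by (simp add: vimage_def)
  have cl: "closed S" unfolding S Collect_conj_eq
    by (intro closed_Int J closed_Collect_le continuous_intros)
  let ?A = "S \<inter> {z. Re z \<le> m}" and ?B = "S \<inter> {z. m \<le> Re z}"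
  have "loc_affine L c (?A \<union> ?B) s"
  proof (rule loc_affine_Un_closed)
    show "closed ?A" "closed ?B" by (intro closed_Int cl closed_Collect_le continuous_intros)+
    show "loc_affine L c ?A s" if "s \<in> ?A"
      by (rule loc_affine_cong[OF 1[of ?A]]) (use that assms in auto)
    show "loc_affine L c ?B s" if "s \<in> ?B"
      by (rule loc_affine_cong[OF 2[of ?B]]) (use that assms in auto)
  qed
  moreover have "?A \<union> ?B = S" by auto
  ultimately show ?thesis by simp
qed

end

locale skew_L_shape = symmetric_L_shape w for w +
  fixes r :: int
  assumes w_gt_2: "2 < w" and w_square: "w * w = w + (2 * of_int r + 1)"
begin

text \<open>
  In direction \<open>(w, 2)\<close> the surface decomposes into a cylinder of horizontal width \<open>w / 2 - 1\<close>,
  which crosses the lower rectangle twice, and one of width \<open>1 / 2\<close>. On the strips covering them,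
  \<open>Complex s t\<close> is the point at horizontal distance \<open>t\<close> from the left boundary, after flowing for time
  \<open>s\<close> with velocity \<open>(w / 2, 1)\<close>. \<open>loop\<close> describes the flow on the segment \<open>[w - 1, w]\<close> of the
  bottom side until it returns there, at time \<open>w + 1\<close>; since \<open>w (w - 1)\<close> is an odd integer, the
  first return is the rotation by one half. So the left half of the segment sweeps out the second
  cylinder in time \<open>2 * (w + 1)\<close>.
\<close>
definition narrow_strip :: "complex \<Rightarrow> complex set" where
  "narrow_strip z = pr_lower (Complex (Im z + w / 2 * Re z) (if Re z \<le> 1 then Re z else Re z - 1))"
definition narrow :: "complex \<Rightarrow> complex set" where
  "narrow = periodic_ext 2 narrow_strip"

definition loop :: "complex \<Rightarrow> complex set" where
  "loop z = (if Re z \<le> 1 then pr_lower (Complex (Im z + w - 1 + w / 2 * Re z) (Re z))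
    else if Re z \<le> 2 then pr_lower (Complex (Im z + w - 1 + w / 2 * Re z) (Re z - 1))
    else pr_upper (Complex (Im z + w / 2 * (Re z - 2)) (Re z - 1)))"

definition wide_strip :: "complex \<Rightarrow> complex set" where
  "wide_strip z = (if Re z \<le> w + 1 then loop z else loop (Complex (Re z - (w + 1)) (Im z + 1 / 2)))"
definition wide :: "complex \<Rightarrow> complex set" where
  "wide = periodic_ext (2 * (w + 1)) wide_strip"

text \<open>The linear part common to both strip parametrisations: time moves along (w / 2, 1), the
  transverse coordinate horizontally.\<close>

definition slant :: "complex \<Rightarrow> complex" where
  "slant v = Complex (Im v + w / 2 * Re v) (Re v)"

text \<open>The drift of the flow while it crosses the upper rectangle of height w - 1. Modulo the
  circumference 1 it is the rotation by one half.\<close>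

lemma half_w_upper: "w / 2 * (w - 1) = of_int r + 1 / 2"
  using w_square by (simp add: algebra_simps)

section \<open>The two cylinders of direction (w, 2)\<close>

lemma lower_wrap: "pr_lower (Complex (x + w) y) = pr_lower (Complex x y)"
  using pr_lower_Complex_add[of x 1 y] by simp
lemma upper_wrap: "pr_upper (Complex (x + 1) y) = pr_upper (Complex x y)"
  using pr_upper_Complex_add[of x 1 y] by simp

lemma lower_cong: "x - x' = of_int k * w \<Longrightarrow> pr_lower (Complex x y) = pr_lower (Complex x' y)"
  using pr_lower_Complex_add[of x' k y] by (simp add: algebra_simps)
lemma upper_cong: "x - x' = of_int k \<Longrightarrow> pr_upper (Complex x y) = pr_upper (Complex x' y)"
  using pr_upper_Complex_add[of x' k y] by (simp add: algebra_simps)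

text \<open>At time 1 the strip meets the top edge over [w / 2, w - 1], inside the segment glued to
  the bottom of the same rectangle, so both formulas hold there.\<close>

lemma narrow_strip_2:
  assumes "0 \<le> Im z" "Im z \<le> w / 2 - 1" "1 \<le> Re z"
  shows "narrow_strip z = pr_lower (Complex (Im z + w / 2 * Re z) (Re z - 1))"
proof (cases "Re z = 1")
  case True
  then show ?thesis using assms pr_lower_seam[of "Im z + w / 2"] unfolding narrow_strip_def by simp
qed (use assms in \<open>simp add: narrow_strip_def\<close>)

lemma narrow_strip_periodic:
  assumes "0 \<le> t" "t \<le> w / 2 - 1" shows "narrow_strip (Complex 0 t) = narrow_strip (Complex 2 t)"
  using assms pr_lower_seam[of t] lower_wrap[of t 1] by (simp add: narrow_strip_def)

lemma narrow_add: "narrow (z + of_int k * 2) = narrow z"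
  using periodic_ext_add[of 2 narrow_strip z k] unfolding narrow_def by simp

lemma narrow_eq:
  "0 \<le> Im z \<Longrightarrow> Im z \<le> w / 2 - 1 \<Longrightarrow> 0 \<le> Re z \<Longrightarrow> Re z \<le> 2 \<Longrightarrow> narrow z = narrow_strip z"
  unfolding narrow_def by (rule periodic_ext_eq) (use narrow_strip_periodic in auto)

lemma loc_affine_narrow:
  assumes "Im s \<in> {0..w / 2 - 1}"
  shows "loc_affine slant narrow {z. Im z \<in> {0..w / 2 - 1}} s"
  unfolding narrow_def
proof (rule loc_affine_periodic_ext)
  fix z assume z: "0 \<le> Re z" "Re z \<le> 2" "Im z \<in> {0..w / 2 - 1}"
  show "loc_affine slant narrow_strip {z. 0 \<le> Re z \<and> Re z \<le> 2 \<and> Im z \<in> {0..w / 2 - 1}} z"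
  proof (rule loc_affine_split[where m = 1 and J = "{0..w / 2 - 1}"])
    show "narrow_strip y = pr_lower (Complex (Im y + w / 2 * Re y) (Re y))" if "Re y \<le> 1" for y
      using that by (simp add: narrow_strip_def)
    show "narrow_strip y = pr_lower (Complex (Im y + w / 2 * Re y) (Re y - 1))"
      if "y \<in> {z. 0 \<le> Re z \<and> Re z \<le> 2 \<and> Im z \<in> {0..w / 2 - 1}}" "1 \<le> Re y" for y
      using that by (intro narrow_strip_2) auto
    show "loc_affine slant (\<lambda>z. pr_lower (Complex (Im z + w / 2 * Re z) (Re z))) T z"
      if "Re z \<le> 1" "T \<subseteq> {z. 0 \<le> Re z \<and> Re z \<le> 2 \<and> Im z \<in> {0..w / 2 - 1}}" "T \<subseteq> {z. Re z \<le> 1}" for T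
      by (rule loc_affine_compose[OF loc_affine_pr_lower])
         (use z that in \<open>auto simp: slant_def complex_eq_iff algebra_simps add_divide_distrib diff_divide_distrib intro!: continuous_intros\<close>)
    show "loc_affine slant (\<lambda>z. pr_lower (Complex (Im z + w / 2 * Re z) (Re z - 1))) T z"
      if "1 \<le> Re z" "T \<subseteq> {z. 0 \<le> Re z \<and> Re z \<le> 2 \<and> Im z \<in> {0..w / 2 - 1}}" "T \<subseteq> {z. 1 \<le> Re z}" for T
      by (rule loc_affine_compose[OF loc_affine_pr_lower])
         (use z that in \<open>auto simp: slant_def complex_eq_iff algebra_simps add_divide_distrib diff_divide_distrib intro!: continuous_intros\<close>)
  qed (use z in auto)
qed (use assms narrow_strip_periodic in auto)

lemma loop_1: "Re z \<le> 1 \<Longrightarrow> loop z = pr_lower (Complex (Im z + w - 1 + w / 2 * Re z) (Re z))"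
  unfolding loop_def by simp

text \<open>At time 1 the segment lies, modulo w, over [w / 2 - 1, w / 2], which is glued to the
  bottom side because \<open>w > 2\<close>. At time 2 it is back over [w - 1, w], now below the
  upper rectangle; this is \<open>loop_3\<close>.\<close>

lemma loop_2:
  assumes "0 \<le> Im z" "Im z \<le> 1" "1 \<le> Re z" "Re z \<le> 2"
  shows "loop z = pr_lower (Complex (Im z + w - 1 + w / 2 * Re z) (Re z - 1))"
proof (cases "Re z = 1")
  case True
  then show ?thesis
    using assms w_gt_2 pr_lower_seam[of "Im z - 1 + w / 2"] lower_wrap[of "Im z - 1 + w / 2"]
    by (simp add: loop_def algebra_simps)
qed (use assms in \<open>simp add: loop_def\<close>)

lemma loop_3:
  assumes "0 \<le> Im z" "Im z \<le> 1" "2 \<le> Re z"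
  shows "loop z = pr_upper (Complex (Im z + w / 2 * (Re z - 2)) (Re z - 1))"
proof (cases "Re z = 2")
  case True
  then show ?thesis
    using assms pr_upper_bottom[of "Im z"] lower_wrap[of "Im z + w - 1" 1]
    by (simp add: loop_def algebra_simps)
qed (use assms in \<open>simp add: loop_def\<close>)

lemma loop_top:
  assumes "0 \<le> t" "t \<le> 1" shows "loop (Complex (w + 1) t) = pr_upper (Complex (t + 1 / 2) w)"
proof -
  have "loop (Complex (w + 1) t) = pr_upper (Complex (t + w / 2 * (w - 1)) w)"
    using assms w_gt_2 by (simp add: loop_3 algebra_simps)
  also have "\<dots> = pr_upper (Complex (t + 1 / 2) w)"
    by (rule upper_cong[where k = r]) (use half_w_upper in linarith)
  finally show ?thesis .
qed

lemma loop_bottom: "0 \<le> t \<Longrightarrow> t \<le> 1 \<Longrightarrow> loop (Complex 0 t) = pr_upper (Complex t w)"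
  using pr_upper_top[of t] by (simp add: loop_1)

lemma loop_match:
  assumes "0 \<le> t" "t \<le> 1 / 2"
  shows "loop (Complex (w + 1) t) = loop (Complex 0 (t + 1 / 2))"
    "loop (Complex (w + 1) (t + 1 / 2)) = loop (Complex 0 t)"
proof -
  show "loop (Complex (w + 1) t) = loop (Complex 0 (t + 1 / 2))"
    using assms by (subst loop_top; simp add: loop_bottom)
  have "loop (Complex (w + 1) (t + 1 / 2)) = pr_upper (Complex (t + 1 / 2 + 1 / 2) w)"
    using assms by (intro loop_top) auto
  also have "\<dots> = pr_upper (Complex t w)" by (rule upper_cong[where k = 1]) simp
  finally show "loop (Complex (w + 1) (t + 1 / 2)) = loop (Complex 0 t)" using assms by (simp add: loop_bottom)
qed

lemma loc_affine_loop:
  assumes "S = {z. 0 \<le> Re z \<and> Re z \<le> w + 1 \<and> Im z \<in> {0..1}}" "s \<in> S"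
  shows "loc_affine slant loop S s"
proof (rule loc_affine_split[where m = 2, OF _ _ _ assms])
  define S' where "S' = {z. 0 \<le> Re z \<and> Re z \<le> 2 \<and> Im z \<in> {0..1}}"
  show "loop z = pr_upper (Complex (Im z + w / 2 * (Re z - 2)) (Re z - 1))" if "z \<in> S" "2 \<le> Re z" for z
    using that assms by (intro loop_3) auto
  show "loc_affine slant (\<lambda>z. pr_upper (Complex (Im z + w / 2 * (Re z - 2)) (Re z - 1))) T s"
    if "2 \<le> Re s" "T \<subseteq> S" "T \<subseteq> {z. 2 \<le> Re z}" for T
    by (rule loc_affine_compose[OF loc_affine_pr_upper])
       (use assms that in \<open>auto simp: slant_def complex_eq_iff algebra_simps add_divide_distrib diff_divide_distrib intro!: continuous_intros\<close>)
  show "loc_affine slant loop T s" if s: "Re s \<le> 2" and T: "T \<subseteq> S" "T \<subseteq> {z. Re z \<le> 2}" for T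
  proof (rule loc_affine_mono[of _ _ S'])
    show "loc_affine slant loop S' s"
    proof (rule loc_affine_split[where m = 1, OF _ _ _ S'_def])
      show "loop z = pr_lower (Complex (Im z + w - 1 + w / 2 * Re z) (Re z))" if "Re z \<le> 1" for z
        using that by (rule loop_1)
      show "loop z = pr_lower (Complex (Im z + w - 1 + w / 2 * Re z) (Re z - 1))" if "z \<in> S'" "1 \<le> Re z" for z
        using that by (intro loop_2) (auto simp: S'_def)
      show "loc_affine slant (\<lambda>z. pr_lower (Complex (Im z + w - 1 + w / 2 * Re z) (Re z))) T s"
        if "Re s \<le> 1" "T \<subseteq> S'" "T \<subseteq> {z. Re z \<le> 1}" for T
        by (rule loc_affine_compose[OF loc_affine_pr_lower])
           (use assms that in \<open>auto simp: S'_def slant_def complex_eq_iff algebra_simps add_divide_distrib diff_divide_distrib intro!: continuous_intros\<close>)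
      show "loc_affine slant (\<lambda>z. pr_lower (Complex (Im z + w - 1 + w / 2 * Re z) (Re z - 1))) T s"
        if "1 \<le> Re s" "Re s \<le> 2" "T \<subseteq> S'" "T \<subseteq> {z. 1 \<le> Re z}" for T
        by (rule loc_affine_compose[OF loc_affine_pr_lower])
           (use assms that in \<open>auto simp: S'_def slant_def complex_eq_iff algebra_simps add_divide_distrib diff_divide_distrib intro!: continuous_intros\<close>)
    qed (use assms s in \<open>auto simp: S'_def\<close>)
    show "T \<subseteq> S'" using T assms by (auto simp: S'_def)
  qed
qed auto

lemma wide_strip_hi:
  assumes "0 \<le> Im z" "Im z \<le> 1 / 2" "w + 1 \<le> Re z"
  shows "wide_strip z = loop (Complex (Re z - (w + 1)) (Im z + 1 / 2))"
proof (cases "Re z = w + 1")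
  case True
  then show ?thesis using assms loop_match(1)[of "Im z"] unfolding wide_strip_def by (metis complex_surj diff_self order_refl)
qed (use assms in \<open>simp add: wide_strip_def\<close>)

lemma wide_strip_periodic:
  assumes "0 \<le> t" "t \<le> 1 / 2" shows "wide_strip (Complex 0 t) = wide_strip (Complex (2 * (w + 1)) t)"
  using assms w_gt_2 loop_match(2)[of t] by (simp add: wide_strip_def)

lemma wide_add: "wide (z + of_int k * of_real (2 * (w + 1))) = wide z"
  using periodic_ext_add[of "2 * (w + 1)" wide_strip z k] w_gt_2 unfolding wide_def by simp

lemma wide_eq:
  "0 \<le> Im z \<Longrightarrow> Im z \<le> 1 / 2 \<Longrightarrow> 0 \<le> Re z \<Longrightarrow> Re z \<le> 2 * (w + 1) \<Longrightarrow> wide z = wide_strip z"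
  unfolding wide_def by (rule periodic_ext_eq) (use w_gt_2 wide_strip_periodic in auto)

lemma wide_lo:
  "0 \<le> Im z \<Longrightarrow> Im z \<le> 1 / 2 \<Longrightarrow> 0 \<le> Re z \<Longrightarrow> Re z \<le> w + 1 \<Longrightarrow> wide z = loop z"
  using wide_eq w_gt_2 by (simp add: wide_strip_def)

lemma wide_hi:
  "0 \<le> Im z \<Longrightarrow> Im z \<le> 1 / 2 \<Longrightarrow> w + 1 \<le> Re z \<Longrightarrow> Re z \<le> 2 * (w + 1) \<Longrightarrow>
   wide z = loop (Complex (Re z - (w + 1)) (Im z + 1 / 2))"
  using wide_eq w_gt_2 by (simp add: wide_strip_hi)

lemma loc_affine_wide:
  assumes "Im s \<in> {0..1 / 2}"
  shows "loc_affine slant wide {z. Im z \<in> {0..1 / 2}} s"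
  unfolding wide_def
proof (rule loc_affine_periodic_ext)
  fix z assume z: "0 \<le> Re z" "Re z \<le> 2 * (w + 1)" "Im z \<in> {0..1 / 2}"
  let ?S = "{z. 0 \<le> Re z \<and> Re z \<le> 2 * (w + 1) \<and> Im z \<in> {0..1 / 2}}"
  show "loc_affine slant wide_strip ?S z"
  proof (rule loc_affine_split[where m = "w + 1" and J = "{0..1 / 2}"])
    show "wide_strip y = loop y" if "Re y \<le> w + 1" for y
      using that by (simp add: wide_strip_def)
    show "wide_strip y = loop (Complex (Re y - (w + 1)) (Im y + 1 / 2))" if "y \<in> ?S" "w + 1 \<le> Re y" for y
      using that by (intro wide_strip_hi) auto
    show "loc_affine slant loop T z" if "Re z \<le> w + 1" "T \<subseteq> ?S" "T \<subseteq> {z. Re z \<le> w + 1}" for T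
      by (rule loc_affine_mono[OF loc_affine_loop[OF refl]]) (use z that in auto)
    show "loc_affine slant (\<lambda>z. loop (Complex (Re z - (w + 1)) (Im z + 1 / 2))) T z"
      if "w + 1 \<le> Re z" "T \<subseteq> ?S" "T \<subseteq> {z. w + 1 \<le> Re z}" for T
      by (rule loc_affine_compose[OF loc_affine_loop[OF refl]])
         (use z that in \<open>auto simp: slant_def complex_eq_iff algebra_simps add_divide_distrib diff_divide_distrib intro!: continuous_intros\<close>)
  qed (use z in auto)
qed (use assms wide_strip_periodic w_gt_2 in auto)

text \<open>
  The factor \<open>4 * (w + 1)\<close> makes the slide a multiple of the period on the right boundary of both
  strips, namely \<open>2 * (2 * r - 1)\<close> for the narrow and \<open>2 * (w + 1)\<close> for the wide one.
\<close>
definition slide :: "int \<Rightarrow> complex \<Rightarrow> complex" where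
  "slide n z = z + of_real (of_int n * (4 * (w + 1)) * Im z)"

section \<open>Slides of the two cylinders\<close>

lemma Im_slide [simp]: "Im (slide n z) = Im z" by (simp add: slide_def)
lemma Re_slide [simp]: "Re (slide n z) = Re z + of_int n * (4 * (w + 1)) * Im z" by (simp add: slide_def)
lemma slide_slide [simp]: "slide (- n) (slide n z) = z" by (simp add: slide_def)
lemma slide_0 [simp]: "slide 0 z = z" by (simp add: slide_def)
lemma slide_real [simp]: "slide n (Complex s 0) = Complex s 0" by (simp add: slide_def complex_eq_iff)

lemma narrow_slide_edge: "narrow (slide n (Complex s (w / 2 - 1))) = narrow (Complex s (w / 2 - 1))"
proof -
  have "4 * (w + 1) * (w / 2 - 1) = (2 * of_int r - 1) * 2"
    using w_square by (simp add: algebra_simps)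
  then have "slide n (Complex s (w / 2 - 1)) = Complex s (w / 2 - 1) + of_int (n * (2 * r - 1)) * 2"
    by (simp add: slide_def complex_eq_iff mult.assoc)
  then show ?thesis using narrow_add by metis
qed

lemma wide_slide_edge: "wide (slide n (Complex s (1 / 2))) = wide (Complex s (1 / 2))"
proof -
  have "slide n (Complex s (1 / 2)) = Complex s (1 / 2) + of_int n * of_real (2 * (w + 1))"
    by (simp add: slide_def complex_eq_iff)
  then show ?thesis using wide_add by metis
qed

text \<open>The wide slide in the coordinates of \<open>loop\<close>: a point in the right half of
  the segment belongs to the second turn of the wide cylinder, at time larger by w + 1 and
  transverse coordinate smaller by 1 / 2.\<close>

definition loop_slide :: "int \<Rightarrow> complex \<Rightarrow> complex set" where
  "loop_slide n z = (if Im z \<le> 1 / 2 then wide (slide n z)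
     else wide (slide n (Complex (Re z + (w + 1)) (Im z - 1 / 2))))"

text \<open>The line \<open>Im z = 1 / 2\<close> is the right boundary of the wide cylinder in its
  first turn and the left boundary in its second. The slide is a multiple of the period on one and
  zero on the other, so both descriptions give \<open>loop z\<close>.\<close>

lemma loop_slide_hi:
  assumes "0 \<le> Re z" "Re z \<le> w + 1" "1 / 2 \<le> Im z"
  shows "loop_slide n z = wide (slide n (Complex (Re z + (w + 1)) (Im z - 1 / 2)))"
proof (cases "Im z = 1 / 2")
  case True
  then have z: "z = Complex (Re z) (1 / 2)" by (simp add: complex_eq_iff)
  have "loop_slide n z = wide (Complex (Re z) (1 / 2))"
    unfolding loop_slide_def using True wide_slide_edge[of n "Re z"] z by simp
  also have "\<dots> = loop (Complex (Re z) (1 / 2))" using assms by (intro wide_lo) auto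
  also have "\<dots> = wide (Complex (Re z + (w + 1)) 0)" using assms w_gt_2 by (subst wide_hi) auto
  also have "Complex (Re z + (w + 1)) 0 = slide n (Complex (Re z + (w + 1)) (Im z - 1 / 2))"
    using True by (simp add: slide_def complex_eq_iff)
  finally show ?thesis .
qed (use assms in \<open>simp add: loop_slide_def\<close>)

lemma loop_slide_0:
  assumes "0 \<le> Re z" "Re z \<le> w + 1" "0 \<le> Im z" "Im z \<le> 1"
  shows "loop_slide 0 z = loop z"
  using assms wide_lo[of z] wide_hi[of "Complex (Re z + (w + 1)) (Im z - 1 / 2)"]
  unfolding loop_slide_def by auto

lemma loop_slide_edges:
  assumes "0 \<le> s" "s \<le> w + 1"
  shows "loop_slide n (Complex s 0) = loop (Complex s 0)" "loop_slide n (Complex s 1) = loop (Complex s 1)"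
proof -
  show "loop_slide n (Complex s 0) = loop (Complex s 0)"
    using wide_lo[of "Complex s 0"] assms by (simp add: loop_slide_def)
  show "loop_slide n (Complex s 1) = loop (Complex s 1)"
    using wide_hi[of "Complex (s + (w + 1)) (1 / 2)"] assms wide_slide_edge by (simp add: loop_slide_def)
qed

text \<open>Here \<open>Re v\<close> is the transverse coordinate and \<open>Im v\<close> the flow
  time, opposite to the strip convention; hence the swap.\<close>

definition skew_shift :: "int \<Rightarrow> complex \<Rightarrow> complex" where
  "skew_shift n v = slant (slide n (Complex (Im v) (Re v)))"

lemma loc_affine_slide_narrow:
  assumes "Im s \<in> {0..w / 2 - 1}"
  shows "loc_affine (\<lambda>v. slant (slide n v)) (\<lambda>z. narrow (slide n z)) {z. Im z \<in> {0..w / 2 - 1}} s"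
  by (rule loc_affine_compose[OF loc_affine_narrow])
     (use assms in \<open>auto simp: slant_def slide_def complex_eq_iff algebra_simps add_divide_distrib diff_divide_distrib intro!: continuous_intros\<close>)

lemma loc_affine_slide_wide:
  assumes "Im s \<in> {0..1 / 2}"
  shows "loc_affine (\<lambda>v. slant (slide n v)) (\<lambda>z. wide (slide n z)) {z. Im z \<in> {0..1 / 2}} s"
  by (rule loc_affine_compose[OF loc_affine_wide])
     (use assms in \<open>auto simp: slant_def slide_def complex_eq_iff algebra_simps add_divide_distrib diff_divide_distrib intro!: continuous_intros\<close>)

lemma loc_affine_loop_slide:
  assumes S: "S = {z. 0 \<le> Re z \<and> Re z \<le> 1 \<and> Im z \<in> {0..w + 1}}" and "s \<in> S"
  shows "loc_affine (skew_shift n) (\<lambda>z. loop_slide n (Complex (Im z) (Re z))) S s"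
proof (rule loc_affine_split[where m = "1 / 2", OF _ _ _ S])
  show "loop_slide n (Complex (Im z) (Re z)) = wide (slide n (Complex (Im z) (Re z)))" if "Re z \<le> 1 / 2" for z
    using that by (simp add: loop_slide_def)
  show "loop_slide n (Complex (Im z) (Re z)) = wide (slide n (Complex (Im z + (w + 1)) (Re z - 1 / 2)))"
    if "z \<in> S" "1 / 2 \<le> Re z" for z
    using that S by (subst loop_slide_hi) auto
  show "loc_affine (skew_shift n) (\<lambda>z. wide (slide n (Complex (Im z) (Re z)))) T s"
    if "Re s \<le> 1 / 2" "T \<subseteq> S" "T \<subseteq> {z. Re z \<le> 1 / 2}" for T
    by (rule loc_affine_compose[OF loc_affine_slide_wide])
       (use assms that in \<open>auto simp: skew_shift_def slant_def slide_def complex_eq_iff algebra_simps add_divide_distrib diff_divide_distrib intro!: continuous_intros\<close>)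
  show "loc_affine (skew_shift n) (\<lambda>z. wide (slide n (Complex (Im z + (w + 1)) (Re z - 1 / 2)))) T s"
    if "1 / 2 \<le> Re s" "T \<subseteq> S" "T \<subseteq> {z. 1 / 2 \<le> Re z}" for T
    by (rule loc_affine_compose[OF loc_affine_slide_wide])
       (use assms that in \<open>auto simp: skew_shift_def slant_def slide_def complex_eq_iff algebra_simps add_divide_distrib diff_divide_distrib intro!: continuous_intros\<close>)
qed (use assms in auto)

text \<open>
  The multitwist on the lower rectangle, in coordinates in which the flow is vertical: \<open>Re z\<close> is the
  point where the flow line through \<open>z\<close> meets the bottom side.
\<close>
definition lower_strip :: "int \<Rightarrow> complex \<Rightarrow> complex set" where
  "lower_strip n z =
     (if Re z \<le> w / 2 - 1 then narrow (slide n (Complex (Im z) (Re z)))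
      else if Re z \<le> w / 2 then loop_slide n (Complex (Im z + 1) (Re z - (w / 2 - 1)))
      else if Re z \<le> w - 1 then narrow (slide n (Complex (Im z + 1) (Re z - w / 2)))
      else loop_slide n (Complex (Im z) (Re z - (w - 1))))"

lemma lower_strip_1:
  "Re z \<le> w / 2 - 1 \<Longrightarrow> lower_strip n z = narrow (slide n (Complex (Im z) (Re z)))"
  by (simp add: lower_strip_def)

text \<open>The segments of the bottom side cut at w / 2 - 1, w / 2 and w - 1 carry, in this order,
  the first crossing of the narrow strip, the second of \<open>loop\<close>, the second of the
  narrow strip and the first of \<open>loop\<close>. A second crossing has time
  \<open>Im z + 1\<close>. Adjacent formulas agree at the cuts because slides are trivial on
  cylinder boundaries.\<close>

lemma lower_strip_2:
  assumes "0 \<le> Im z" "Im z \<le> 1" "w / 2 - 1 \<le> Re z" "Re z \<le> w / 2"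
  shows "lower_strip n z = loop_slide n (Complex (Im z + 1) (Re z - (w / 2 - 1)))"
proof (cases "Re z = w / 2 - 1")
  case True
  have "lower_strip n z = narrow (Complex (Im z) (w / 2 - 1))"
    unfolding lower_strip_def using True narrow_slide_edge by simp
  also have "\<dots> = pr_lower (Complex (w / 2 - 1 + w / 2 * Im z) (Im z))"
    using assms w_gt_2 by (simp add: narrow_eq narrow_strip_def)
  also have "\<dots> = loop (Complex (Im z + 1) 0)"
    using assms by (subst loop_2, simp_all) (rule lower_cong[where k = "-1"], simp add: field_simps)
  also have "\<dots> = loop_slide n (Complex (Im z + 1) 0)"
    using assms w_gt_2 by (simp add: loop_slide_edges)
  finally show ?thesis using True by simp
qed (use assms in \<open>simp add: lower_strip_def\<close>)

lemma lower_strip_3: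
  assumes "0 \<le> Im z" "Im z \<le> 1" "w / 2 \<le> Re z" "Re z \<le> w - 1"
  shows "lower_strip n z = narrow (slide n (Complex (Im z + 1) (Re z - w / 2)))"
proof (cases "Re z = w / 2")
  case True
  have e: "Re z - (w / 2 - 1) = 1" using True by simp
  have "lower_strip n z = loop_slide n (Complex (Im z + 1) 1)"
    unfolding lower_strip_def e using True w_gt_2 by simp
  also have "\<dots> = loop (Complex (Im z + 1) 1)" using assms w_gt_2 by (simp add: loop_slide_edges)
  also have "\<dots> = pr_lower (Complex (w / 2 * (Im z + 1)) (Im z))"
    using assms lower_wrap[of "w / 2 * (Im z + 1)" "Im z"] by (simp add: loop_2 algebra_simps)
  also have "\<dots> = narrow (Complex (Im z + 1) 0)"
    using assms w_gt_2 by (simp add: narrow_eq narrow_strip_2)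
  also have "Complex (Im z + 1) 0 = slide n (Complex (Im z + 1) (Re z - w / 2))"
    using True by (simp add: slide_def complex_eq_iff)
  finally show ?thesis .
qed (use assms in \<open>simp add: lower_strip_def\<close>)

lemma lower_strip_4:
  assumes "0 \<le> Im z" "Im z \<le> 1" "w - 1 \<le> Re z" "Re z \<le> w"
  shows "lower_strip n z = loop_slide n (Complex (Im z) (Re z - (w - 1)))"
proof (cases "Re z = w - 1")
  case True
  have "lower_strip n z = narrow (Complex (Im z + 1) (w / 2 - 1))"
    using True assms w_gt_2 narrow_slide_edge[of n "Im z + 1"] by (simp add: lower_strip_def)
  also have "\<dots> = pr_lower (Complex (w - 1 + w / 2 * Im z) (Im z))"
    using assms w_gt_2 by (simp add: narrow_eq narrow_strip_2 algebra_simps add_divide_distrib)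
  also have "\<dots> = loop_slide n (Complex (Im z) 0)"
    using assms w_gt_2 by (simp add: loop_slide_edges loop_1)
  finally show ?thesis using True by simp
qed (use assms w_gt_2 in \<open>simp add: lower_strip_def\<close>)

lemma lower_strip_periodic:
  assumes "0 \<le> y" "y \<le> 1" shows "lower_strip n (Complex 0 y) = lower_strip n (Complex w y)"
proof -
  have "lower_strip n (Complex 0 y) = pr_lower (Complex (w / 2 * y) y)"
    using assms w_gt_2 by (simp add: lower_strip_1 narrow_eq narrow_strip_def)
  also have "\<dots> = lower_strip n (Complex w y)"
    using assms w_gt_2 lower_wrap[of "w / 2 * y" y]
    by (simp add: lower_strip_4 loop_slide_edges loop_1 algebra_simps)
  finally show ?thesis .
qed

lemma loc_affine_lower_strip:
  assumes S: "S = {z. 0 \<le> Re z \<and> Re z \<le> w \<and> Im z \<in> {0..1}}" and "s \<in> S"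
  shows "loc_affine (skew_shift n) (lower_strip n) S s"
proof (rule loc_affine_split[where m = "w / 2", OF _ _ _ S])
  fix T assume s: "Re s \<le> w / 2" and T: "T \<subseteq> S" "T \<subseteq> {z. Re z \<le> w / 2}"
  define S' where "S' = {z. 0 \<le> Re z \<and> Re z \<le> w / 2 \<and> Im z \<in> {0..1}}"
  have "loc_affine (skew_shift n) (lower_strip n) S' s"
  proof (rule loc_affine_split[where m = "w / 2 - 1", OF _ _ _ S'_def])
    show "lower_strip n z = narrow (slide n (Complex (Im z) (Re z)))" if "Re z \<le> w / 2 - 1" for z
      using that by (rule lower_strip_1)
    show "lower_strip n z = loop_slide n (Complex (Im z + 1) (Re z - (w / 2 - 1)))"
      if "z \<in> S'" "w / 2 - 1 \<le> Re z" for z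
      using that by (intro lower_strip_2) (auto simp: S'_def)
    show "loc_affine (skew_shift n) (\<lambda>z. narrow (slide n (Complex (Im z) (Re z)))) T s"
      if "Re s \<le> w / 2 - 1" "T \<subseteq> S'" "T \<subseteq> {z. Re z \<le> w / 2 - 1}" for T
      by (rule loc_affine_compose[OF loc_affine_slide_narrow])
         (use assms that in \<open>auto simp: S'_def skew_shift_def slant_def slide_def complex_eq_iff algebra_simps add_divide_distrib diff_divide_distrib intro!: continuous_intros\<close>)
    show "loc_affine (skew_shift n) (\<lambda>z. loop_slide n (Complex (Im z + 1) (Re z - (w / 2 - 1)))) T s"
      if "w / 2 - 1 \<le> Re s" "Re s \<le> w / 2" "T \<subseteq> S'" "T \<subseteq> {z. w / 2 - 1 \<le> Re z}" for T
    proof -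
      note that' = that
      \<comment> \<open>Factoring through \<open>?g\<close> exposes the swapped coordinates for
        which \<open>loc_affine_loop_slide\<close> is stated.\<close>
      let ?g = "\<lambda>z. Complex (Re z - (w / 2 - 1)) (Im z + 1)"
      have "loc_affine (skew_shift n) (\<lambda>z. loop_slide n (Complex (Im (?g z)) (Re (?g z)))) T s"
      proof (rule loc_affine_compose[OF loc_affine_loop_slide[OF refl], where g = ?g])
        have T: "0 \<le> Re (?g x) \<and> Re (?g x) \<le> 1 \<and> Im (?g x) \<in> {0..w + 1}" if "x \<in> T \<or> x = s" for x
          using that w_gt_2 assms that'
          by (auto simp: S'_def subset_iff)
        show "?g s \<in> {z. 0 \<le> Re z \<and> Re z \<le> 1 \<and> Im z \<in> {0..w + 1}}" using T by blast
        show "?g x \<in> {z. 0 \<le> Re z \<and> Re z \<le> 1 \<and> Im z \<in> {0..w + 1}}" if "x \<in> T" for x using T that by blast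
        show "skew_shift n (?g x - ?g s) = skew_shift n (x - s)" for x by (simp add: skew_shift_def)
        show "continuous (at s) ?g" by (auto intro!: continuous_intros)
      qed
      then show ?thesis by simp
    qed
  qed (use assms s in \<open>auto simp: S'_def\<close>)
  then show "loc_affine (skew_shift n) (lower_strip n) T s"
    by (rule loc_affine_mono) (use S T in \<open>auto simp: S'_def\<close>)
next
  fix T assume s: "w / 2 \<le> Re s" and T: "T \<subseteq> S" "T \<subseteq> {z. w / 2 \<le> Re z}"
  define S' where "S' = {z. w / 2 \<le> Re z \<and> Re z \<le> w \<and> Im z \<in> {0..1}}"
  have "loc_affine (skew_shift n) (lower_strip n) S' s"
  proof (rule loc_affine_split[where m = "w - 1", OF _ _ _ S'_def])
    show "lower_strip n z = narrow (slide n (Complex (Im z + 1) (Re z - w / 2)))" if "z \<in> S'" "Re z \<le> w - 1" for z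
      using that by (intro lower_strip_3) (auto simp: S'_def)
    show "lower_strip n z = loop_slide n (Complex (Im z) (Re z - (w - 1)))"
      if "z \<in> S'" "w - 1 \<le> Re z" for z
      using that by (intro lower_strip_4) (auto simp: S'_def)
    show "loc_affine (skew_shift n) (\<lambda>z. narrow (slide n (Complex (Im z + 1) (Re z - w / 2)))) T s"
      if "Re s \<le> w - 1" "T \<subseteq> S'" "T \<subseteq> {z. Re z \<le> w - 1}" for T
      by (rule loc_affine_compose[OF loc_affine_slide_narrow])
         (use assms s that in \<open>auto simp: S'_def skew_shift_def slant_def slide_def complex_eq_iff algebra_simps add_divide_distrib diff_divide_distrib intro!: continuous_intros\<close>)
    show "loc_affine (skew_shift n) (\<lambda>z. loop_slide n (Complex (Im z) (Re z - (w - 1)))) T s"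
      if "w - 1 \<le> Re s" "Re s \<le> w" "T \<subseteq> S'" "T \<subseteq> {z. w - 1 \<le> Re z}" for T
    proof -
      note that' = that
      let ?g = "\<lambda>z. Complex (Re z - (w - 1)) (Im z)"
      have "loc_affine (skew_shift n) (\<lambda>z. loop_slide n (Complex (Im (?g z)) (Re (?g z)))) T s"
      proof (rule loc_affine_compose[OF loc_affine_loop_slide[OF refl], where g = ?g])
        have T: "0 \<le> Re (?g x) \<and> Re (?g x) \<le> 1 \<and> Im (?g x) \<in> {0..w + 1}" if "x \<in> T \<or> x = s" for x
          using that w_gt_2 assms that'
          by (auto simp: S'_def subset_iff)
        show "?g s \<in> {z. 0 \<le> Re z \<and> Re z \<le> 1 \<and> Im z \<in> {0..w + 1}}" using T by blast
        show "?g x \<in> {z. 0 \<le> Re z \<and> Re z \<le> 1 \<and> Im z \<in> {0..w + 1}}" if "x \<in> T" for x using T that by blast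
        show "skew_shift n (?g x - ?g s) = skew_shift n (x - s)" for x by (simp add: skew_shift_def)
        show "continuous (at s) ?g" by (auto intro!: continuous_intros)
      qed
      then show ?thesis by simp
    qed
  qed (use assms s in \<open>auto simp: S'_def\<close>)
  then show "loc_affine (skew_shift n) (lower_strip n) T s"
    by (rule loc_affine_mono) (use S T in \<open>auto simp: S'_def\<close>)
qed (use assms in auto)

section \<open>The multitwist on the polygon\<close>

definition skew_lower :: "int \<Rightarrow> complex \<Rightarrow> complex set" where
  "skew_lower n z = periodic_ext w (lower_strip n) (Complex (Re z - w / 2 * Im z) (Im z))"
text \<open>A flow line of \<open>loop\<close> enters the upper rectangle at time 2 and height 1, so
  its time is \<open>Im z + 1\<close>; the real part is the transverse position traced back to
  height 1.\<close>

definition skew_upper :: "int \<Rightarrow> complex \<Rightarrow> complex set" where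
  "skew_upper n z = periodic_ext 1 (\<lambda>v. loop_slide n (Complex (Im v) (Re v)))
     (Complex (Re z - w / 2 * (Im z - 1)) (Im z + 1))"

lemma skew_lower_add: "skew_lower n (z + of_int k * of_real w) = skew_lower n z"
  using periodic_Complex_add[of w "lower_strip n" "Re z - w / 2 * Im z" k "Im z"] w_gt_2
  unfolding skew_lower_def by (simp add: algebra_simps)
lemma skew_upper_add: "skew_upper n (z + of_int k) = skew_upper n z"
  using periodic_Complex_add[of 1 _ "Re z - w / 2 * (Im z - 1)" k "Im z + 1"]
  unfolding skew_upper_def by (simp add: algebra_simps)

lemma skew_lower_eq:
  assumes "0 \<le> Im z" "Im z \<le> 1" "0 \<le> Re z - w / 2 * Im z" "Re z - w / 2 * Im z \<le> w"
  shows "skew_lower n z = lower_strip n (Complex (Re z - w / 2 * Im z) (Im z))"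
  unfolding skew_lower_def by (rule periodic_ext_eq) (use assms lower_strip_periodic w_gt_2 in auto)

lemma skew_lower_at:
  assumes "0 \<le> y" "y \<le> 1" "0 \<le> v" "v \<le> w" "x = v + w / 2 * y"
  shows "skew_lower n (Complex x y) = lower_strip n (Complex v y)"
  using skew_lower_eq[of "Complex x y" n] assms by simp

lemma skew_upper_eq:
  assumes "1 \<le> Im z" "Im z \<le> w" "0 \<le> Re z - w / 2 * (Im z - 1)" "Re z - w / 2 * (Im z - 1) \<le> 1"
  shows "skew_upper n z = loop_slide n (Complex (Im z + 1) (Re z - w / 2 * (Im z - 1)))"
proof -
  have "loop (Complex (Im z + 1) 0) = loop (Complex (Im z + 1) 1)"
    using assms upper_wrap[of "w / 2 * (Im z - 1)" "Im z"] by (simp add: loop_3 algebra_simps)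
  then show ?thesis unfolding skew_upper_def
    by (subst periodic_ext_eq) (use assms in \<open>simp_all add: loop_slide_edges\<close>)
qed

definition skew :: "int \<Rightarrow> complex \<Rightarrow> complex set" where
  "skew n z = (if Im z \<le> 1 then skew_lower n z else skew_upper n (z - of_real (w - 1)))"

lemma skew_on_lower: "z \<in> lower_part \<Longrightarrow> skew n z = skew_lower n z"
  unfolding skew_def lower_part_def by simp

text \<open>At height 1 the lower formula ends the second crossing of \<open>loop\<close>, that is
  at loop time 2, where the upper formula starts.\<close>

lemma skew_on_upper:
  assumes "z \<in> upper_part" shows "skew n z = skew_upper n (z - of_real (w - 1))"
proof (cases "Im z = 1")
  case True
  have z: "w - 1 \<le> Re z" "Re z \<le> w" using assms unfolding upper_part_def by auto
  have "skew n z = loop_slide n (Complex (1 + 1) (Re z - w / 2 * 1 - (w / 2 - 1)))"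
    using z True w_gt_2 by (simp add: skew_def skew_lower_eq lower_strip_2)
  also have "\<dots> = loop_slide n (Complex (1 + 1) (Re z - (w - 1)))"
    by (rule arg_cong[of _ _ "loop_slide n"]) (simp add: complex_eq_iff)
  also have "\<dots> = skew_upper n (z - of_real (w - 1))"
    using z True w_gt_2 by (subst skew_upper_eq) (auto simp: field_simps)
  finally show ?thesis .
next
  case False
  then show ?thesis using assms unfolding skew_def upper_part_def by simp
qed

lemma loc_affine_skew:
  assumes "s \<in> P"
  shows "loc_affine (\<lambda>v. skew_shift n (Complex (Re v - w / 2 * Im v) (Im v))) (skew n) P s"
proof (rule loc_affine_parts[OF assms skew_on_lower skew_on_upper])
  let ?L = "\<lambda>v. skew_shift n (Complex (Re v - w / 2 * Im v) (Im v))"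
  assume s: "s \<in> lower_part"
  show "loc_affine ?L (skew_lower n) lower_part s" unfolding skew_lower_def
  proof (rule loc_affine_compose)
    let ?g = "\<lambda>z. Complex (Re z - w / 2 * Im z) (Im z)"
    show "loc_affine (skew_shift n) (periodic_ext w (lower_strip n)) {z. Im z \<in> {0..1}} (?g s)"
      by (rule loc_affine_periodic_ext)
         (use s w_gt_2 lower_strip_periodic loc_affine_lower_strip[OF refl] in \<open>auto simp: lower_part_def\<close>)
    show "continuous (at s) ?g" by (auto intro!: continuous_intros)
    show "skew_shift n (?g x - ?g s) = ?L (x - s)" for x
      by (simp add: skew_shift_def slant_def slide_def complex_eq_iff algebra_simps add_divide_distrib diff_divide_distrib)
  qed (auto simp: lower_part_def)
next
  let ?L = "\<lambda>v. skew_shift n (Complex (Re v - w / 2 * Im v) (Im v))"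
  assume s: "s \<in> upper_part"
  show "loc_affine ?L (\<lambda>z. skew_upper n (z - of_real (w - 1))) upper_part s" unfolding skew_upper_def
  proof (rule loc_affine_compose)
    let ?h = "\<lambda>z. z - complex_of_real (w - 1)"
    let ?g = "\<lambda>z. Complex (Re (?h z) - w / 2 * (Im (?h z) - 1)) (Im (?h z) + 1)"
    have per: "loop_slide n (Complex y 0) = loop_slide n (Complex y 1)" if "y \<in> {2..w + 1}" for y
      using that upper_wrap[of "w / 2 * (y - 2)" "y - 1"] by (simp add: loop_slide_edges loop_3 algebra_simps)
    show "loc_affine (skew_shift n) (periodic_ext 1 (\<lambda>v. loop_slide n (Complex (Im v) (Re v)))) {z. Im z \<in> {2..w + 1}} (?g s)"
    proof (rule loc_affine_periodic_ext)
      fix z assume "0 \<le> Re z" "Re z \<le> 1" "Im z \<in> {2..w + 1}"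
      then show "loc_affine (skew_shift n) (\<lambda>v. loop_slide n (Complex (Im v) (Re v)))
         {z. 0 \<le> Re z \<and> Re z \<le> 1 \<and> Im z \<in> {2..w + 1}} z"
        by (intro loc_affine_mono[OF loc_affine_loop_slide[OF refl]]) auto
    qed (use s per in \<open>auto simp: upper_part_def\<close>)
    show "continuous (at s) ?g" by (auto intro!: continuous_intros)
    show "skew_shift n (?g x - ?g s) = ?L (x - s)" for x
      by (simp add: skew_shift_def slant_def slide_def complex_eq_iff algebra_simps add_divide_distrib diff_divide_distrib)
  qed (auto simp: upper_part_def)
qed

text \<open>A point on the self-glued edge continues its flow line. In the three cases this means
  passing from narrow time 2 to narrow time 0, staying at loop time 1, and staying at narrow time
  1.\<close>

lemma skew_lower_seam:
  assumes x: "0 \<le> x" "x \<le> w - 1" shows "skew_lower n (Complex x 0) = skew_lower n (Complex x 1)"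
proof -
  have 0: "skew_lower n (Complex x 0) = lower_strip n (Complex x 0)"
    using x by (simp add: skew_lower_eq)
  \<comment> \<open>For x < w / 2 the position traced back to the bottom side is negative; adding
    the circumference w brings it into [0, w].\<close>
  have 1: "skew_lower n (Complex x 1) = skew_lower n (Complex (x + w) 1)"
    using skew_lower_add[of n "Complex x 1" 1] by (simp add: Complex_add_of_real)
  consider "x \<le> w / 2 - 1" | "w / 2 - 1 \<le> x" "x \<le> w / 2" | "w / 2 \<le> x" by linarith
  then show ?thesis
  proof cases
    case 1
    have "skew_lower n (Complex (x + w) 1) = lower_strip n (Complex (x + w / 2) 1)"
      using x 1 w_gt_2 by (subst skew_lower_eq) (auto simp: field_simps)
    also have "\<dots> = narrow (slide n (Complex 0 x) + of_int 1 * 2)"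
      using x 1 w_gt_2 by (subst lower_strip_3) (auto intro!: arg_cong[of _ _ narrow] simp: slide_def complex_eq_iff)
    also have "\<dots> = skew_lower n (Complex x 0)" unfolding narrow_add 0 using 1 by (simp add: lower_strip_1)
    finally show ?thesis using \<open>skew_lower n (Complex x 1) = _\<close> by simp
  next
    case 2
    have "skew_lower n (Complex (x + w) 1) = lower_strip n (Complex (x + w / 2) 1)"
      using x 2 w_gt_2 by (subst skew_lower_eq) (auto simp: field_simps)
    also have "\<dots> = loop_slide n (Complex 1 (x + w / 2 - (w - 1)))"
      using x 2 w_gt_2 by (subst lower_strip_4) auto
    also have "\<dots> = skew_lower n (Complex x 0)" unfolding 0
      using 2 by (subst lower_strip_2) (auto simp: field_simps)
    finally show ?thesis using 1 by simp
  next
    case 3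
    have "skew_lower n (Complex x 1) = lower_strip n (Complex (x - w / 2) 1)"
      using x 3 w_gt_2 by (subst skew_lower_eq) auto
    also have "\<dots> = skew_lower n (Complex x 0)" unfolding 0
      using x 3 by (simp add: lower_strip_1 lower_strip_3)
    finally show ?thesis by simp
  qed
qed

text \<open>The top is reached at loop time w + 1, after the rotation by one half. For u \<le> 1 / 2
  the flow line started at u + 1 / 2 and completes its second turn, so the period 2 (w + 1) of
  \<open>wide\<close> is used; otherwise it started at u - 1 / 2 and passes from the first turn to
  the second.\<close>

lemma skew_upper_top:
  assumes u: "0 \<le> u" "u \<le> 1"
  shows "skew_upper n (Complex u w) = skew_lower n (Complex (u + w - 1) 0)"
proof -
  have 0: "skew_lower n (Complex (u + w - 1) 0) = loop_slide n (Complex 0 u)"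
    using u w_gt_2 by (simp add: skew_lower_eq lower_strip_4)
  show ?thesis
  proof (cases "u \<le> 1 / 2")
    case True
    have e: "u + of_int (r + 1) - w / 2 * (w - 1) = u + 1 / 2" unfolding half_w_upper by simp
    have "skew_upper n (Complex u w) = skew_upper n (Complex (u + of_int (r + 1)) w)"
      using skew_upper_add[of n "Complex u w" "r + 1"] by (simp add: complex_eq_iff Complex_eq algebra_simps)
    also have "\<dots> = loop_slide n (Complex (w + 1) (u + 1 / 2))"
      using True u w_gt_2 skew_upper_eq[of "Complex (u + of_int (r + 1)) w" n, unfolded complex.sel e] by simp
    also have "\<dots> = wide (slide n (Complex 0 u) + of_int 1 * of_real (2 * (w + 1)))"
      using True u w_gt_2
      by (subst loop_slide_hi) (auto intro!: arg_cong[of _ _ wide] simp: slide_def complex_eq_iff)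
    also have "\<dots> = loop_slide n (Complex 0 u)" unfolding wide_add using True by (simp add: loop_slide_def)
    finally show ?thesis unfolding 0 .
  next
    case False
    have e: "u + of_int r - w / 2 * (w - 1) = u - 1 / 2" unfolding half_w_upper by simp
    have "skew_upper n (Complex u w) = skew_upper n (Complex (u + of_int r) w)"
      using skew_upper_add[of n "Complex u w" "r"] by (simp add: complex_eq_iff Complex_eq algebra_simps)
    also have "\<dots> = loop_slide n (Complex (w + 1) (u - 1 / 2))"
      using False u w_gt_2 skew_upper_eq[of "Complex (u + of_int r) w" n, unfolded complex.sel e] by simp
    also have "\<dots> = loop_slide n (Complex 0 u)"
      using False u w_gt_2 by (simp add: loop_slide_hi[of "Complex 0 u"]) (simp add: loop_slide_def)
    finally show ?thesis unfolding 0 .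
  qed
qed

lemma glue_invariant_skew: "glue_invariant (skew n)"
proof (rule glue_invariantI)
  fix y :: real assume "0 \<le> y" "y \<le> 1"
  then show "skew n (Complex 0 y) = skew n (Complex w y)"
    using skew_lower_add[of n "Complex 0 y" 1] by (simp add: skew_def Complex_add_of_real)
next
  fix y :: real assume "1 \<le> y" "y \<le> w"
  then show "skew n (Complex (w - 1) y) = skew n (Complex w y)"
    using skew_upper_add[of n "Complex 0 y" 1]
    by (simp add: skew_on_upper upper_part_def Complex_diff_of_real Complex_add_one del: of_real_diff)
next
  fix x :: real assume "0 \<le> x" "x \<le> w - 1"
  then show "skew n (Complex x 0) = skew n (Complex x 1)" by (simp add: skew_def skew_lower_seam)
next
  fix x :: real assume "w - 1 \<le> x" "x \<le> w"
  then show "skew n (Complex x 0) = skew n (Complex x w)"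
    using skew_upper_top[of "x - (w - 1)" n] w_gt_2
    by (simp add: skew_def Complex_diff_of_real del: of_real_diff)
qed

section \<open>Inverting the multitwist\<close>

lemma induced_skew_lower: "0 \<le> y \<Longrightarrow> y \<le> 1 \<Longrightarrow> induced (skew n) (pr_lower (Complex x y)) = skew_lower n (Complex x y)"
  by (rule induced_pr_lower[OF glue_invariant_skew skew_on_lower skew_lower_add]) auto
lemma induced_skew_upper: "1 \<le> y \<Longrightarrow> y \<le> w \<Longrightarrow> induced (skew n) (pr_upper (Complex x y)) = skew_upper n (Complex x y)"
  by (rule induced_pr_upper[OF glue_invariant_skew skew_on_upper skew_upper_add]) auto

text \<open>In cylinder coordinates the descended multitwist is just a slide, so the inverse law
  reduces to \<open>slide_slide\<close>. The wide cylinder is treated in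
  \<open>induced_skew_wide\<close>.\<close>

lemma induced_skew_narrow:
  assumes t: "0 \<le> Im z" "Im z \<le> w / 2 - 1"
  shows "induced (skew n) (narrow z) = narrow (slide n z)"
proof -
  obtain k where k: "0 \<le> Re z - of_int k * 2" "Re z - of_int k * 2 < 2" using mod_reduce[of 2] by auto
  define s where "s = Re z - of_int k * 2"
  define t where "t = Im z"
  have z: "z = Complex s t + of_int k * 2" unfolding s_def t_def by (simp add: complex_eq_iff)
  have "slide n z = slide n (Complex s t) + of_int k * 2" unfolding z slide_def by simp
  then have eq: "narrow z = narrow (Complex s t)" "narrow (slide n z) = narrow (slide n (Complex s t))"
    using z narrow_add by metis+
  have st: "0 \<le> s" "s < 2" "0 \<le> t" "t \<le> w / 2 - 1" using k assms unfolding s_def t_def by auto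
  show ?thesis
  proof (cases "s \<le> 1")
    case True
    then show ?thesis unfolding eq using st w_gt_2
      by (simp add: narrow_eq narrow_strip_def induced_skew_lower skew_lower_eq lower_strip_1)
  next
    case False
    have "induced (skew n) (narrow (Complex s t)) = skew_lower n (Complex (t + w / 2 * s) (s - 1))"
      using False st by (simp add: narrow_eq narrow_strip_2 induced_skew_lower)
    also have "\<dots> = lower_strip n (Complex (t + w / 2) (s - 1))"
      by (rule skew_lower_at) (use False st w_gt_2 in \<open>auto simp: field_simps\<close>)
    also have "\<dots> = narrow (slide n (Complex s t))"
      using False st w_gt_2 by (simp add: lower_strip_3)
    finally show ?thesis unfolding eq .
  qed
qed

lemma induced_skew_loop:
  assumes "0 \<le> Re z" "Re z \<le> w + 1" "0 \<le> Im z" "Im z \<le> 1"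
  shows "induced (skew n) (loop z) = loop_slide n z"
proof -
  obtain s t where z: "z = Complex s t" by (cases z)
  consider "s \<le> 1" | "1 \<le> s" "s \<le> 2" | "2 \<le> s" by linarith
  then show ?thesis
  proof cases
    case 1
    have "induced (skew n) (loop z) = skew_lower n (Complex (t + w - 1 + w / 2 * s) s)"
      using assms 1 unfolding z by (simp add: loop_1 induced_skew_lower)
    also have "\<dots> = lower_strip n (Complex (t + w - 1) s)"
      using assms 1 w_gt_2 unfolding z by (subst skew_lower_eq) auto
    finally show ?thesis using assms 1 unfolding z by (simp add: lower_strip_4)
  next
    case 2
    have "induced (skew n) (loop z) = skew_lower n (Complex (t + w - 1 + w / 2 * s) (s - 1))"
      using assms 2 unfolding z by (simp add: loop_2 induced_skew_lower)
    also have "\<dots> = skew_lower n (Complex (t - 1 + w / 2 * s) (s - 1))"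
    proof -
      have "Complex (t + w - 1 + w / 2 * s) (s - 1) = Complex (t - 1 + w / 2 * s) (s - 1) + of_int 1 * of_real w"
        by (simp add: complex_eq_iff)
      then show ?thesis using skew_lower_add by metis
    qed
    also have "\<dots> = lower_strip n (Complex (t + w / 2 - 1) (s - 1))"
      by (rule skew_lower_at) (use assms 2 w_gt_2 z in \<open>auto simp: field_simps\<close>)
    also have "\<dots> = loop_slide n z" using assms 2 unfolding z by (simp add: lower_strip_2 field_simps)
    finally show ?thesis .
  next
    case 3
    have "induced (skew n) (loop z) = skew_upper n (Complex (t + w / 2 * (s - 2)) (s - 1))"
      using assms 3 unfolding z by (simp add: loop_3 induced_skew_upper)
    also have "\<dots> = loop_slide n z"
      using assms 3 unfolding z by (subst skew_upper_eq) (auto simp: field_simps)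
    finally show ?thesis .
  qed
qed

lemma induced_skew_wide:
  assumes "0 \<le> Im z" "Im z \<le> 1 / 2"
  shows "induced (skew n) (wide z) = wide (slide n z)"
proof -
  obtain k where k: "0 \<le> Re z - of_int k * (2 * (w + 1))" "Re z - of_int k * (2 * (w + 1)) < 2 * (w + 1)"
    using mod_reduce[of "2 * (w + 1)"] w_gt_2 by auto
  define s where "s = Re z - of_int k * (2 * (w + 1))"
  define t where "t = Im z"
  have z: "z = Complex s t + of_int k * of_real (2 * (w + 1))" unfolding s_def t_def by (simp add: complex_eq_iff)
  have "slide n z = slide n (Complex s t) + of_int k * of_real (2 * (w + 1))" unfolding z slide_def by simp
  then have eq: "wide z = wide (Complex s t)" "wide (slide n z) = wide (slide n (Complex s t))"
    using z wide_add by metis+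
  have st: "0 \<le> s" "s < 2 * (w + 1)" "0 \<le> t" "t \<le> 1 / 2" using k assms unfolding s_def t_def by auto
  show ?thesis
  proof (cases "s \<le> w + 1")
    case True
    then show ?thesis unfolding eq using st
      by (simp add: wide_lo induced_skew_loop) (simp add: loop_slide_def)
  next
    case False
    then show ?thesis unfolding eq using st
      by (simp add: wide_hi induced_skew_loop loop_slide_hi)
  qed
qed

lemma induced_skew_loop_slide:
  assumes "0 \<le> Re z" "Re z \<le> w + 1" "0 \<le> Im z" "Im z \<le> 1"
  shows "induced (skew (- n)) (loop_slide n z) = loop_slide 0 z"
  using assms unfolding loop_slide_def by (auto simp: induced_skew_wide)

lemma induced_skew_lower_strip:
  assumes "0 \<le> Re z" "Re z \<le> w" "0 \<le> Im z" "Im z \<le> 1"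
  shows "induced (skew (- n)) (lower_strip n z) = lower_strip 0 z"
  using assms w_gt_2 unfolding lower_strip_def by (auto simp: induced_skew_narrow induced_skew_loop_slide)

text \<open>Without a slide all four pieces give the point reached from \<open>Re z\<close> on the
  bottom side by flowing for time \<open>Im z\<close>.\<close>

lemma lower_strip_0:
  assumes "0 \<le> Re z" "Re z \<le> w" "0 \<le> Im z" "Im z \<le> 1"
  shows "lower_strip 0 z = pr_lower (Complex (Re z + w / 2 * Im z) (Im z))"
proof -
  consider "Re z \<le> w / 2 - 1" | "w / 2 - 1 \<le> Re z" "Re z \<le> w / 2"
    | "w / 2 \<le> Re z" "Re z \<le> w - 1" | "w - 1 \<le> Re z" by linarith
  then show ?thesis
  proof cases
    case 1
    then show ?thesis using assms by (simp add: lower_strip_1 narrow_eq narrow_strip_def)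
  next
    case 2
    have "lower_strip 0 z = loop (Complex (Im z + 1) (Re z - (w / 2 - 1)))"
      using 2 assms w_gt_2 by (simp add: lower_strip_2 loop_slide_0)
    also have "\<dots> = pr_lower (Complex (Re z - (w / 2 - 1) + w - 1 + w / 2 * (Im z + 1)) (Im z))"
      using 2 assms by (subst loop_2) auto
    also have "\<dots> = pr_lower (Complex (Re z + w / 2 * Im z) (Im z))"
      by (rule lower_cong[where k = 1]) (simp add: field_simps)
    finally show ?thesis .
  next
    case 3
    have "lower_strip 0 z = pr_lower (Complex (Re z - w / 2 + w / 2 * (Im z + 1)) (Im z))"
      using 3 assms w_gt_2 by (simp add: lower_strip_3 narrow_eq narrow_strip_2)
    also have "\<dots> = pr_lower (Complex (Re z + w / 2 * Im z) (Im z))"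
      by (rule lower_cong[where k = 0]) (simp add: field_simps)
    finally show ?thesis .
  next
    case 4
    then show ?thesis using assms w_gt_2 by (simp add: lower_strip_4 loop_slide_0 loop_1)
  qed
qed

lemma induced_skew_inverse:
  assumes "p \<in> P" shows "induced (skew (- n)) (skew n p) = pr p"
proof (cases "p \<in> lower_part")
  case True
  obtain k where k: "0 \<le> (Re p - w / 2 * Im p) - of_int k * w" "(Re p - w / 2 * Im p) - of_int k * w < w"
    using mod_reduce[of w] w_gt_2 by auto
  define q where "q = p - of_int k * of_real w"
  have p: "p = q + of_int k * of_real w" and q: "0 \<le> Re q - w / 2 * Im q" "Re q - w / 2 * Im q \<le> w" "0 \<le> Im q" "Im q \<le> 1"
    using k True unfolding q_def lower_part_def by auto
  have "skew n p = lower_strip n (Complex (Re q - w / 2 * Im q) (Im q))"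
    using skew_on_lower[OF True] skew_lower_add[of n q k] q p by (simp add: skew_lower_eq)
  then have "induced (skew (- n)) (skew n p) = lower_strip 0 (Complex (Re q - w / 2 * Im q) (Im q))"
    using q by (simp add: induced_skew_lower_strip)
  also have "\<dots> = pr_lower q" using q by (simp add: lower_strip_0)
  also have "\<dots> = pr_lower p" unfolding p by simp
  finally show ?thesis using True by (simp add: pr_lower_eq)
next
  case False
  then have p: "p \<in> upper_part" using assms polygon_parts by auto
  let ?p = "p - of_real (w - 1)"
  obtain k where k: "0 \<le> (Re ?p - w / 2 * (Im p - 1)) - of_int k * 1" "(Re ?p - w / 2 * (Im p - 1)) - of_int k * 1 < 1"
    using mod_reduce[OF zero_less_one] by blast
  define q where "q = ?p - of_int k"
  define t where "t = Re q - w / 2 * (Im q - 1)"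
  have q: "0 \<le> t" "t \<le> 1" "1 \<le> Im q" "Im q \<le> w" and pq: "?p = q + of_int k"
    using k p unfolding q_def t_def upper_part_def by auto
  have "skew n p = loop_slide n (Complex (Im q + 1) t)"
    using skew_on_upper[OF p] skew_upper_add[of n q k] q pq unfolding t_def by (simp add: skew_upper_eq)
  then have "induced (skew (- n)) (skew n p) = loop (Complex (Im q + 1) t)"
    using q by (simp add: induced_skew_loop_slide loop_slide_0)
  also have "\<dots> = pr_upper q" using q by (simp add: loop_3) (simp add: t_def)
  also have "\<dots> = pr_upper ?p" unfolding pq by simp
  finally show ?thesis using pr_upper_eq[OF p] by simp
qed

text \<open>The matrix is v + n * 4 (w + 1) * (x - (w / 2) y) * (w / 2, 1) for v = (x, y): the
  slide, with x - (w / 2) y as transverse coordinate.\<close>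

lemma skew_veech:
  "mat2 (1 + of_int n * (2 * w * (w + 1))) (- (of_int n * (w\<^sup>2 * (w + 1))))
        (of_int n * (4 * (w + 1))) (1 - of_int n * (2 * w * (w + 1))) \<in> veech_group w w"
  (is "?A n \<in> _")
proof (rule veech_groupI[where A = ?A and F = skew])
  fix n p assume "p \<in> P"
  show "loc_affine (real_linear (?A n)) (skew n) P p"
    by (rule loc_affine_cong[OF loc_affine_skew])
       (use \<open>p \<in> P\<close> in \<open>auto simp: real_linear_mat2 skew_shift_def slant_def slide_def complex_eq_iff
          power2_eq_square algebra_simps add_divide_distrib diff_divide_distrib\<close>)
next
  show "skew n 0 = L_cone_point w w"
    using w_gt_2 zero_in_lower
    by (simp add: skew_on_lower skew_lower_eq lower_strip_1 narrow_eq narrow_strip_def L_cone_point_def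
        pr_lower_eq flip: zero_complex.code)
next
  show "det (?A n) = 1" by (simp add: algebra_simps power2_eq_square)
qed (simp_all add: glue_invariant_skew induced_skew_inverse)

end

section \<open>Arithmetic of the quadratic order\<close>

locale disc_5_mod_8 =
  fixes D :: int
  assumes D_pos: "0 < D" and D_mod_8: "D mod 8 = 5"
begin

abbreviation "K \<equiv> quad_field D"
abbreviation "\<O> \<equiv> carrier (quad_order D)"
abbreviation "w \<equiv> quad_w D"
abbreviation "cj \<equiv> galois D"

definition r :: int where "r = D div 8"

lemma D_eq: "D = 8 * r + 5"
  using D_mod_8 unfolding r_def by presburger

lemma r_nonneg: "0 \<le> r"
  using D_pos unfolding r_def by simp

lemma sqrt_D_sq: "sqrt (of_int D) * sqrt (of_int D) = of_int D"
  using D_pos by simp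

lemma w_square: "w * w = w + (2 * of_int r + 1)"
proof -
  have "w * w = (1 + 2 * sqrt (of_int D) + of_int D) / 4"
    unfolding quad_w_def using sqrt_D_sq by (simp add: field_simps)
  then show ?thesis unfolding quad_w_def by (subst (asm) (2) D_eq) (simp add: field_simps)
qed

lemma w_gt_1: "1 < w"
proof -
  have "1 < sqrt (of_int D)" using D_mod_8 D_pos by (simp, presburger)
  then show ?thesis unfolding quad_w_def by simp
qed

lemma w_gt_2: "D \<noteq> 5 \<Longrightarrow> 2 < w"
proof -
  assume "D \<noteq> 5"
  then have "9 < D" using D_eq r_nonneg by presburger
  then have "sqrt 9 < sqrt (of_int D)" by (intro real_sqrt_less_mono) simp
  moreover have "sqrt 9 = (3 :: real)" by (rule real_sqrt_unique) auto
  ultimately show ?thesis unfolding quad_w_def by simp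
qed

text \<open>Odd squares are 1 modulo 8. In lowest terms D n^2 = m^2 forces m and n to be odd, and
  then 5 would equal 1 modulo 8.\<close>

lemma sqrt_D_irrational: "sqrt (of_int D) \<notin> \<rat>"
proof
  assume "sqrt (of_int D) \<in> \<rat>"
  then obtain m n :: nat where n: "n \<noteq> 0" "\<bar>sqrt (real_of_int D)\<bar> = real m / real n" and cop: "coprime m n"
    by (rule Rats_abs_nat_div_natE)
  then have "sqrt (of_int D) * real n = real m" using D_pos by simp
  then have "of_int D * (real n)\<^sup>2 = (real m)\<^sup>2"
    using D_pos by (metis real_sqrt_pow2 of_int_0_le_iff order_less_imp_le power_mult_distrib)
  then have "real_of_int (D * (int n)\<^sup>2) = real_of_int ((int m)\<^sup>2)" by simp
  then have eq: "D * (int n)\<^sup>2 = (int m)\<^sup>2" by linarith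
  have sq: "x\<^sup>2 mod 8 = 1" if "odd x" for x :: int
  proof -
    have "\<exists>k. x = 2 * k + 1" using that by presburger
    then obtain k where k: "x = 2 * k + 1" by blast
    have "even (k * (k + 1))" by simp
    then obtain j where "k * (k + 1) = 2 * j" by (rule dvdE)
    then have "x\<^sup>2 = 8 * j + 1" unfolding k by (simp add: power2_eq_square algebra_simps)
    then show ?thesis by presburger
  qed
  have "odd D" using D_mod_8 by presburger
  then have "even (int n) \<longleftrightarrow> even (int m)" using eq by (metis even_mult_iff even_power pos2)
  moreover have "\<not> (even (int m) \<and> even (int n))" using cop by auto
  ultimately have "(int m)\<^sup>2 mod 8 = 1" "(int n)\<^sup>2 mod 8 = 1" using sq by blast+
  then have "D * (int n)\<^sup>2 mod 8 = 5" using mod_mult_eq[of D 8 "(int n)\<^sup>2"] D_mod_8 by simp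
  then show False using eq \<open>(int m)\<^sup>2 mod 8 = 1\<close> by simp
qed

lemma rat_combination_unique:
  assumes "of_rat p + of_rat q * sqrt (of_int D) = of_rat p' + of_rat q' * sqrt (of_int D)"
  shows "p = p' \<and> q = q'"
proof -
  have "q = q'"
  proof (rule ccontr)
    assume "q \<noteq> q'"
    then have "sqrt (of_int D) = (of_rat p' - of_rat p) / (of_rat q - of_rat q')"
      using assms by (simp add: field_simps)
    then have "sqrt (of_int D) = of_rat ((p' - p) / (q - q'))" by (simp add: of_rat_divide of_rat_diff)
    then show False using sqrt_D_irrational by (metis Rats_of_rat)
  qed
  then show ?thesis using assms by simp
qed

lemma cj_eq: "cj (of_rat p + of_rat q * sqrt (of_int D)) = of_rat p - of_rat q * sqrt (of_int D)"
  unfolding galois_def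
proof (rule the_equality)
  fix y assume "\<exists>p' q'. of_rat p + of_rat q * sqrt (of_int D) = of_rat p' + of_rat q' * sqrt (of_int D) \<and>
    y = of_rat p' - of_rat q' * sqrt (of_int D)"
  then show "y = of_rat p - of_rat q * sqrt (of_int D)" using rat_combination_unique by fastforce
qed blast

lemma K_cases:
  assumes "x \<in> K" obtains p q where "x = of_rat p + of_rat q * sqrt (of_int D)"
  using assms unfolding quad_field_def by blast

lemma K_I: "of_rat p + of_rat q * sqrt (of_int D) \<in> K"
  unfolding quad_field_def by blast

lemma
  assumes "x \<in> K" "y \<in> K"
  shows cj_add: "cj (x + y) = cj x + cj y" and cj_diff: "cj (x - y) = cj x - cj y"
    and K_mult: "x * y \<in> K" and cj_mult: "cj (x * y) = cj x * cj y"
proof -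
  obtain p q p' q' where x: "x = of_rat p + of_rat q * sqrt (of_int D)"
    and y: "y = of_rat p' + of_rat q' * sqrt (of_int D)" using assms K_cases by metis
  have 1: "x + y = of_rat (p + p') + of_rat (q + q') * sqrt (of_int D)"
    and 2: "x - y = of_rat (p - p') + of_rat (q - q') * sqrt (of_int D)"
    unfolding x y by (simp_all add: of_rat_add of_rat_diff algebra_simps)
  have 3: "x * y = of_rat (p * p' + q * q' * of_int D) + of_rat (p * q' + q * p') * sqrt (of_int D)"
    unfolding x y using sqrt_D_sq by (simp add: of_rat_add of_rat_mult algebra_simps)
  show "x * y \<in> K" unfolding 3 by (rule K_I)
  show "cj (x + y) = cj x + cj y" "cj (x - y) = cj x - cj y"
    unfolding 1 2 cj_eq unfolding x y cj_eq by (simp_all add: of_rat_add of_rat_diff algebra_simps)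
  show "cj (x * y) = cj x * cj y"
    unfolding 3 cj_eq unfolding x y cj_eq using sqrt_D_sq by (simp add: of_rat_add of_rat_mult algebra_simps)
qed

lemma O_iff: "x \<in> \<O> \<longleftrightarrow> (\<exists>m n. x = of_int m + of_int n * w)"
  unfolding quad_order_def by auto

lemma O_I: "of_int m + of_int n * w \<in> \<O>" unfolding O_iff by blast

lemma of_int_in_O: "of_int m \<in> \<O>" using O_I[of m 0] by simp
lemma zero_in_O: "0 \<in> \<O>" and one_in_O: "1 \<in> \<O>" and w_in_O: "w \<in> \<O>"
  using O_I[of 0 0] O_I[of 1 0] O_I[of 0 1] by simp_all

lemma O_add: "x \<in> \<O> \<Longrightarrow> y \<in> \<O> \<Longrightarrow> x + y \<in> \<O>"
proof -
  assume "x \<in> \<O>" "y \<in> \<O>"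
  then obtain m n m' n' where "x = of_int m + of_int n * w" "y = of_int m' + of_int n' * w" unfolding O_iff by blast
  then have "x + y = of_int (m + m') + of_int (n + n') * w" by (simp add: algebra_simps)
  then show ?thesis using O_I by metis
qed

lemma O_mult: "x \<in> \<O> \<Longrightarrow> y \<in> \<O> \<Longrightarrow> x * y \<in> \<O>"
proof -
  assume "x \<in> \<O>" "y \<in> \<O>"
  then obtain m n m' n' where x: "x = of_int m + of_int n * w" and y: "y = of_int m' + of_int n' * w"
    unfolding O_iff by blast
  have "x * y = of_int m * of_int m' + (of_int m * of_int n' + of_int n * of_int m') * w + of_int n * of_int n' * (w * w)"
    unfolding x y by (simp add: algebra_simps)
  also have "\<dots> = of_int (m * m' + n * n' * (2 * r + 1)) + of_int (m * n' + n * m' + n * n') * w"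
    unfolding w_square by (simp add: algebra_simps)
  finally show ?thesis using O_I by metis
qed

lemma O_uminus: "x \<in> \<O> \<Longrightarrow> - x \<in> \<O>"
  using O_mult[OF of_int_in_O[of "-1"]] by simp
lemma O_diff: "x \<in> \<O> \<Longrightarrow> y \<in> \<O> \<Longrightarrow> x - y \<in> \<O>"
  using O_add[of x "- y"] O_uminus by simp

lemma O_int_combination: "of_int m + of_int n * w = of_rat (of_int m + of_int n / 2) + of_rat (of_int n / 2) * sqrt (of_int D)"
  unfolding quad_w_def by (simp add: of_rat_add of_rat_divide) (simp add: field_simps)

lemma O_subset_K: "x \<in> \<O> \<Longrightarrow> x \<in> K"
  unfolding O_iff using O_int_combination K_I by metis

lemma cj_O: "cj (of_int m + of_int n * w) = of_int m + of_int n * (1 - w)"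
  unfolding O_int_combination cj_eq unfolding quad_w_def by (simp add: of_rat_add of_rat_divide) (simp add: field_simps)

lemma cj_0: "cj 0 = 0" and cj_1: "cj 1 = 1"
  using cj_O[of 0 0] cj_O[of 1 0] by simp_all

lemma cj_in_O: "x \<in> \<O> \<Longrightarrow> cj x \<in> \<O>"
proof -
  assume "x \<in> \<O>"
  then obtain m n where "x = of_int m + of_int n * w" unfolding O_iff by blast
  then have "cj x = of_int m + of_int n * (1 - w)" using cj_O by simp
  then have "cj x = of_int (m + n) + of_int (- n) * w" by (simp add: algebra_simps)
  then show ?thesis using O_I by metis
qed

lemma trace_norm_int:
  assumes "x \<in> \<O>"
  obtains t n :: int where "x + cj x = of_int t" "x * cj x = of_int n"
proof -
  obtain m n where x: "x = of_int m + of_int n * w" using assms unfolding O_iff by blast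
  have 1: "x + cj x = of_int (2 * m + n)" unfolding x cj_O by (simp add: algebra_simps)
  have "x * cj x = of_int m * of_int m + of_int m * of_int n - of_int n * of_int n * (w * w - w)"
    unfolding x cj_O by (simp add: algebra_simps)
  also have "\<dots> = of_int (m * m + m * n - n * n * (2 * r + 1))" unfolding w_square by (simp add: algebra_simps)
  finally show thesis using that 1 by blast
qed

lemma cj_eq_0: "x \<in> K \<Longrightarrow> cj x = 0 \<Longrightarrow> x = 0"
proof -
  assume "x \<in> K" "cj x = 0"
  then obtain p q where x: "x = of_rat p + of_rat q * sqrt (of_int D)" using K_cases by blast
  with \<open>cj x = 0\<close> have "of_rat p + of_rat (- q) * sqrt (of_int D) = of_rat 0 + of_rat 0 * sqrt (of_int D)"
    by (simp add: cj_eq of_rat_minus)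
  then have "p = 0" "- q = 0" using rat_combination_unique by blast+
  then show ?thesis using x by simp
qed

end

section \<open>Residues modulo the prime\<close>

locale prime_of_quad_order = disc_5_mod_8 +
  fixes \<pi> :: real
  assumes pi_in_O: "\<pi> \<in> \<O>" and pi_prime: "ring_prime\<^bsub>quad_order D\<^esub> \<pi>"
begin

definition zero_mod :: "real \<Rightarrow> bool" where
  "zero_mod x \<longleftrightarrow> (\<exists>c\<in>\<O>. x = \<pi> * c)"

lemma divides_iff: "d divides\<^bsub>quad_order D\<^esub> x \<longleftrightarrow> (\<exists>c\<in>\<O>. x = d * c)"
  unfolding factor_def by (simp add: quad_order_def)

lemma Units_iff: "x \<in> Units (quad_order D) \<longleftrightarrow> x \<in> \<O> \<and> (\<exists>y\<in>\<O>. x * y = 1)"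
  unfolding Units_def by (auto simp: quad_order_def mult.commute)

lemma pi_nonzero: "\<pi> \<noteq> 0" and pi_not_unit: "\<pi> \<notin> Units (quad_order D)"
  and zero_mod_mult: "x \<in> \<O> \<Longrightarrow> y \<in> \<O> \<Longrightarrow> zero_mod (x * y) \<Longrightarrow> zero_mod x \<or> zero_mod y"
  using pi_prime unfolding ring_prime_def Divisibility.prime_def zero_mod_def divides_iff
  by (auto simp: quad_order_def)

lemma zero_mod_add: "zero_mod x \<Longrightarrow> zero_mod y \<Longrightarrow> zero_mod (x + y)"
  unfolding zero_mod_def by (metis O_add distrib_left)
lemma zero_mod_times: "zero_mod x \<Longrightarrow> c \<in> \<O> \<Longrightarrow> zero_mod (c * x)"
  unfolding zero_mod_def by (metis O_mult mult.left_commute)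
lemma zero_mod_uminus: "zero_mod x \<Longrightarrow> zero_mod (- x)"
  unfolding zero_mod_def by (metis O_uminus mult_minus_right)
lemma zero_mod_diff: "zero_mod x \<Longrightarrow> zero_mod y \<Longrightarrow> zero_mod (x - y)"
  using zero_mod_add[of x "- y"] zero_mod_uminus by simp
lemma not_zero_mod_1: "\<not> zero_mod 1"
proof
  assume "zero_mod 1"
  then obtain c where "c \<in> \<O>" "\<pi> * c = 1" unfolding zero_mod_def by metis
  then show False using pi_not_unit pi_in_O unfolding Units_iff by blast
qed

text \<open>If \<open>k\<close> and \<open>N\<close> are coprime, Bezout gives the inverse.
  Otherwise their gcd does not vanish modulo \<open>\<pi>\<close>, so by primality it can be
  cancelled from \<open>N\<close>, which leaves a smaller positive integer that vanishes.\<close>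

lemma int_inverse_mod:
  assumes "N > 0" "zero_mod (of_int N)" "\<not> zero_mod (of_int k)"
  shows "\<exists>k'. zero_mod (of_int k * of_int k' - 1)"
  using assms
proof (induction "nat N" arbitrary: N rule: less_induct)
  case less
  obtain u v where uv: "u * k + v * N = gcd k N" using bezout_int by blast
  obtain k1 N1 where g: "k = gcd k N * k1" "N = gcd k N * N1" by (metis dvd_def gcd_dvd1 gcd_dvd2)
  define g' where "g' = gcd k N"
  have g': "k = g' * k1" "N = g' * N1" "u * k + v * N = g'" "g' > 0"
    using g uv less.prems(1) unfolding g'_def by (auto simp: gcd_pos_int)
  show ?case
  proof (cases "g' = 1")
    case True
    have "of_int k * of_int u - 1 = - (of_int v * of_int N :: real)"
      using g'(3) True by (metis (mono_tags, lifting) add_diff_cancel_left' diff_add_cancel minus_diff_eq mult.commute of_int_1 of_int_diff of_int_mult)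
    then show ?thesis using zero_mod_times[OF less.prems(2)] zero_mod_uminus of_int_in_O by metis
  next
    case False
    then have "g' > 1" using g'(4) by simp
    have "\<not> zero_mod (of_int g')"
      using less.prems(3) zero_mod_times[of "of_int g'" "of_int k1"] of_int_in_O unfolding g'(1)
      by (auto simp: mult.commute)
    then have "zero_mod (of_int N1)"
      using less.prems(2) zero_mod_mult[of "of_int g'" "of_int N1"] of_int_in_O unfolding g'(2) by auto
    moreover have "N1 > 0" "N1 < N" using less.prems(1) g'(2) \<open>g' > 1\<close> g'(4)
      by (auto simp: zero_less_mult_iff)
    ultimately show ?thesis using less.hyps[of N1] less.prems by auto
  qed
qed

lemma positive_int_zero_mod: "\<exists>N>0. zero_mod (of_int N)"
proof -
  obtain t n where n: "\<pi> * cj \<pi> = of_int n" using trace_norm_int[OF pi_in_O] by metis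
  have "cj \<pi> \<noteq> 0" using cj_eq_0[OF O_subset_K[OF pi_in_O]] pi_nonzero by blast
  then have "n \<noteq> 0" using n pi_nonzero by (metis mult_eq_0_iff of_int_0)
  moreover have "zero_mod (of_int n)" using n cj_in_O[OF pi_in_O] unfolding zero_mod_def by metis
  ultimately have "zero_mod (of_int \<bar>n\<bar>)" "\<bar>n\<bar> > 0"
    using zero_mod_uminus[of "of_int n"] by (auto simp: abs_if)
  then show ?thesis by blast
qed

text \<open>Reduction to integers: if the norm of \<open>x\<close> is nonzero modulo
  \<open>\<pi>\<close>, invert it and multiply by the conjugate. If it vanishes, so does the
  conjugate, and \<open>x\<close> is congruent to its trace.\<close>

lemma inverse_mod:
  assumes x: "x \<in> \<O>" "\<not> zero_mod x" shows "\<exists>y\<in>\<O>. zero_mod (x * y - 1)"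
proof -
  obtain N where N: "N > 0" "zero_mod (of_int N)" using positive_int_zero_mod by blast
  obtain t n where t: "x + cj x = of_int t" and n: "x * cj x = of_int n" using trace_norm_int[OF x(1)] by metis
  show ?thesis
  proof (cases "zero_mod (of_int n)")
    case False
    then obtain k where "zero_mod (of_int n * of_int k - 1)" using int_inverse_mod[OF N] by blast
    then show ?thesis unfolding n[symmetric]
      using O_mult[OF cj_in_O[OF x(1)] of_int_in_O[of k]] by (metis mult.assoc)
  next
    case True
    then have c: "zero_mod (cj x)" unfolding n[symmetric] using zero_mod_mult x cj_in_O by blast
    have "\<not> zero_mod (of_int t)" using zero_mod_diff[OF _ c, of "of_int t"] x(2) unfolding t[symmetric] by auto
    then obtain k where "zero_mod (of_int t * of_int k - 1)" using int_inverse_mod[OF N] by blast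
    then have "zero_mod ((of_int t * of_int k - 1) - of_int k * cj x)"
      using zero_mod_diff zero_mod_times[OF c of_int_in_O] by blast
    then have "zero_mod (x * of_int k - 1)" unfolding t[symmetric] by (simp add: algebra_simps)
    then show ?thesis using of_int_in_O by blast
  qed
qed

end

section \<open>Twisted curves\<close>

lemma moebius_mat_denominator:
  fixes A :: "real^2^2"
  assumes "Im z \<noteq> 0" "det A \<noteq> 0" shows "of_real (A $ 2 $ 1) * z + of_real (A $ 2 $ 2) \<noteq> 0"
proof
  assume 0: "of_real (A $ 2 $ 1) * z + of_real (A $ 2 $ 2) = 0"
  then have "A $ 2 $ 1 * Im z = 0" by (simp add: complex_eq_iff)
  then have "A $ 2 $ 1 = 0" using assms by simp
  moreover from this 0 have "A $ 2 $ 2 = 0" by simp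
  ultimately show False using assms by (simp add: det_2)
qed

lemma moebius_mat_mult:
  assumes "Im z \<noteq> 0" "det B \<noteq> 0"
  shows "moebius_mat (A ** B) z = moebius_mat A (moebius_mat B z)"
proof -
  define u v where "u = of_real (B $ 1 $ 1) * z + of_real (B $ 1 $ 2)"
    and "v = of_real (B $ 2 $ 1) * z + of_real (B $ 2 $ 2)"
  have v: "v \<noteq> 0" using moebius_mat_denominator[OF assms] unfolding v_def .
  have "moebius_mat A (moebius_mat B z) =
      (of_real (A $ 1 $ 1) * (u / v) + of_real (A $ 1 $ 2)) / (of_real (A $ 2 $ 1) * (u / v) + of_real (A $ 2 $ 2))"
    unfolding moebius_mat_def moebius_def u_def v_def ..
  also have "\<dots> = ((of_real (A $ 1 $ 1) * u + of_real (A $ 1 $ 2) * v) / v) /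
      ((of_real (A $ 2 $ 1) * u + of_real (A $ 2 $ 2) * v) / v)"
    using v by (simp add: add_divide_distrib)
  also have "\<dots> = (of_real (A $ 1 $ 1) * u + of_real (A $ 1 $ 2) * v) / (of_real (A $ 2 $ 1) * u + of_real (A $ 2 $ 2) * v)"
    using v by simp
  also have "\<dots> = moebius_mat (A ** B) z"
    unfolding moebius_mat_def moebius_def u_def v_def matrix_mult_nth_2 by (simp add: algebra_simps)
  finally show ?thesis ..
qed

lemma Im_moebius_mat:
  "Im (moebius_mat A z) = det A * Im z / (norm (of_real (A $ 2 $ 1) * z + of_real (A $ 2 $ 2)))\<^sup>2"
  unfolding moebius_mat_def moebius_def Im_divide cmod_power2 by (simp add: det_2 algebra_simps)

lemma moebius_mat_half_planes:
  assumes "det A > 0"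
  shows "z \<in> upper_half \<Longrightarrow> moebius_mat A z \<in> upper_half"
    and "z \<in> lower_half \<Longrightarrow> moebius_mat A z \<in> lower_half"
proof -
  have "norm (of_real (A $ 2 $ 1) * z + of_real (A $ 2 $ 2)) > 0" if "Im z \<noteq> 0"
    using moebius_mat_denominator[OF that, of A] assms by simp
  then show "z \<in> upper_half \<Longrightarrow> moebius_mat A z \<in> upper_half" "z \<in> lower_half \<Longrightarrow> moebius_mat A z \<in> lower_half"
    using assms unfolding upper_half_def lower_half_def
    by (auto simp: Im_moebius_mat intro!: divide_pos_pos divide_neg_pos mult_pos_pos mult_pos_neg)
qed

lemma moebius_mat_1 [simp]: "moebius_mat (mat 1) z = z"
  unfolding moebius_mat_def moebius_def by (simp add: mat_def)

definition adj2 :: "real^2^2 \<Rightarrow> real^2^2" where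
  "adj2 A = mat2 (A $ 2 $ 2) (- A $ 1 $ 2) (- A $ 2 $ 1) (A $ 1 $ 1)"

lemma adj2_mult: "det A = 1 \<Longrightarrow> A ** adj2 A = mat 1" "det A = 1 \<Longrightarrow> adj2 A ** A = mat 1"
  unfolding matrix_eq_2 by (auto simp: adj2_def matrix_mult_nth_2 det_2 mat_def algebra_simps)

lemma det_adj2 [simp]: "det (adj2 A) = det A"
  by (simp add: adj2_def det_2 algebra_simps)

context disc_5_mod_8
begin

lemma galois_mat_mult:
  assumes "\<forall>i j. A $ i $ j \<in> K" "\<forall>i j. B $ i $ j \<in> K"
  shows "galois_mat D (A ** B) = galois_mat D A ** galois_mat D B"
  using assms unfolding matrix_eq_2
  by (simp add: galois_mat_def matrix_mult_nth_2 cj_add cj_mult K_mult)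

lemma det_galois_mat:
  assumes "\<forall>i j. A $ i $ j \<in> K" shows "det (galois_mat D A) = cj (det A)"
  using assms by (simp add: galois_mat_def det_2 cj_diff cj_mult K_mult)

lemma SL2_D: "A \<in> SL2_order D \<Longrightarrow> A $ i $ j \<in> \<O>" "A \<in> SL2_order D \<Longrightarrow> A $ i $ j \<in> K" "A \<in> SL2_order D \<Longrightarrow> det A = 1"
  unfolding SL2_order_def using O_subset_K by auto

lemma SL2_subset_GL2: "A \<in> SL2_order D \<Longrightarrow> A \<in> GL2_plus D"
  unfolding GL2_plus_def totally_positive_def using SL2_D one_in_O O_subset_K cj_1 by auto

lemma SL2_mult: "A \<in> SL2_order D \<Longrightarrow> B \<in> SL2_order D \<Longrightarrow> A ** B \<in> SL2_order D"
  unfolding SL2_order_def by (simp add: det_mul matrix_mult_nth_2 O_add O_mult)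

lemma SL2_adj2: "A \<in> SL2_order D \<Longrightarrow> adj2 A \<in> SL2_order D"
  unfolding SL2_order_def by (auto simp: forall_2 adj2_def O_uminus det_2 algebra_simps)

lemma GL2_plus_D:
  assumes "A \<in> GL2_plus D"
  shows "\<forall>i j. A $ i $ j \<in> K" "det A > 0" "det (galois_mat D A) > 0"
  using assms det_galois_mat[of A] unfolding GL2_plus_def totally_positive_def by auto

lemma hilbert_act_mult:
  assumes "A \<in> GL2_plus D" "B \<in> GL2_plus D" "p \<in> upper_half \<times> lower_half"
  shows "hilbert_act D (A ** B) p = hilbert_act D A (hilbert_act D B p)"
proof -
  have "Im (fst p) \<noteq> 0" "Im (snd p) \<noteq> 0" using assms(3) unfolding upper_half_def lower_half_def by auto
  then show ?thesis using GL2_plus_D[OF assms(1)] GL2_plus_D[OF assms(2)]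
    unfolding hilbert_act_def by (simp add: case_prod_beta galois_mat_mult moebius_mat_mult)
qed

lemma hilbert_act_half_planes:
  assumes "A \<in> GL2_plus D" "p \<in> upper_half \<times> lower_half"
  shows "hilbert_act D A p \<in> upper_half \<times> lower_half"
  using assms(2) GL2_plus_D[OF assms(1)] moebius_mat_half_planes
  unfolding hilbert_act_def by (auto simp: case_prod_beta)

lemma galois_mat_1: "galois_mat D (mat 1) = mat 1"
  unfolding matrix_eq_2 by (simp add: galois_mat_def mat_def cj_0 cj_1)

lemma hilbert_act_1: "hilbert_act D (mat 1) p = p"
  unfolding hilbert_act_def galois_mat_1 by (simp add: case_prod_beta)

lemma hilbert_act_adj2:
  assumes "J \<in> SL2_order D" "p \<in> upper_half \<times> lower_half"
  shows "hilbert_act D (adj2 J) (hilbert_act D J p) = p" "hilbert_act D J (hilbert_act D (adj2 J) p) = p"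
  using hilbert_act_mult[of "adj2 J" J p] hilbert_act_mult[of J "adj2 J" p] assms SL2_adj2
    SL2_subset_GL2 adj2_mult[of J] SL2_D(3) hilbert_act_1 by simp_all

lemma hilbert_orbit_act:
  assumes "J \<in> SL2_order D" "p \<in> upper_half \<times> lower_half"
  shows "hilbert_orbit D (hilbert_act D J p) = hilbert_orbit D p"
proof -
  have sub: "hilbert_orbit D (hilbert_act D J p) \<subseteq> hilbert_orbit D p"
    if "J \<in> SL2_order D" "p \<in> upper_half \<times> lower_half" for J p
    unfolding hilbert_orbit_def
  proof (intro image_subsetI)
    fix A assume A: "A \<in> SL2_order D"
    have "hilbert_act D A (hilbert_act D J p) = hilbert_act D (A ** J) p"
      using hilbert_act_mult[OF SL2_subset_GL2[OF A] SL2_subset_GL2[OF that(1)] that(2)] by simp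
    then show "hilbert_act D A (hilbert_act D J p) \<in> (\<lambda>J. hilbert_act D J p) ` SL2_order D"
      using SL2_mult[OF A that(1)] by blast
  qed
  show ?thesis
    using sub[OF assms] sub[OF SL2_adj2[OF assms(1)] hilbert_act_half_planes[OF SL2_subset_GL2[OF assms(1)] assms(2)]]
    unfolding hilbert_act_adj2(1)[OF assms] by (rule subset_antisym)
qed

end

locale equivariant_lift = disc_5_mod_8 +
  fixes \<phi> :: "complex \<Rightarrow> complex"
  assumes phi_lower: "z \<in> upper_half \<Longrightarrow> \<phi> z \<in> lower_half"
    and SL_L_eq: "SL_L D = {A \<in> SL2_order D. \<forall>z\<in>upper_half.
           \<phi> (moebius_mat A z) = moebius_mat (galois_mat D A) (\<phi> z)}"
begin

lemma SL_L_D: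
  assumes "A \<in> SL_L D"
  shows "A \<in> SL2_order D" "z \<in> upper_half \<Longrightarrow> \<phi> (moebius_mat A z) = moebius_mat (galois_mat D A) (\<phi> z)"
  using assms unfolding SL_L_eq by auto

lemma SL_L_mult:
  assumes "A \<in> SL_L D" "B \<in> SL_L D" shows "A ** B \<in> SL_L D"
proof -
  note SL = SL_L_D(1)[OF assms(1)] SL_L_D(1)[OF assms(2)]
  have "\<phi> (moebius_mat (A ** B) z) = moebius_mat (galois_mat D (A ** B)) (\<phi> z)" if z: "z \<in> upper_half" for z
  proof -
    have Bz: "moebius_mat B z \<in> upper_half"
      using moebius_mat_half_planes(1)[OF _ z, of B] SL2_D(3)[OF SL(2)] by simp
    have "Im z \<noteq> 0" "Im (\<phi> z) \<noteq> 0" using z phi_lower[OF z] unfolding upper_half_def lower_half_def by auto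
    moreover have "det (galois_mat D B) \<noteq> 0" using GL2_plus_D(3)[OF SL2_subset_GL2[OF SL(2)]] by simp
    moreover have "galois_mat D (A ** B) = galois_mat D A ** galois_mat D B"
      by (rule galois_mat_mult) (use SL SL2_D(2) in auto)
    ultimately show ?thesis
      using SL_L_D(2)[OF assms(1) Bz] SL_L_D(2)[OF assms(2) z] SL2_D(3)[OF SL(2)]
      by (simp add: moebius_mat_mult)
  qed
  then show ?thesis unfolding SL_L_eq using SL2_mult SL by simp
qed

lemma twist_graph_half_planes:
  assumes "M \<in> GL2_plus D" shows "twist_graph D \<phi> M \<subseteq> upper_half \<times> lower_half"
  unfolding twist_graph_def by (intro image_subsetI hilbert_act_half_planes[OF assms]) (simp add: phi_lower)

lemma twist_graph_left:
  assumes "J \<in> SL2_order D" "M \<in> GL2_plus D"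
  shows "twist_graph D \<phi> (J ** M) = hilbert_act D J ` twist_graph D \<phi> M"
  unfolding twist_graph_def image_image
  by (rule image_cong[OF refl], rule hilbert_act_mult) (use assms SL2_subset_GL2 phi_lower in auto)

text \<open>By equivariance \<open>A\<close> sends the point of the graph over z to the point over
  Az. As \<open>A\<close> permutes the upper half plane, this only reparametrises the graph.\<close>

lemma twist_graph_right:
  assumes A: "A \<in> SL_L D" and M: "M \<in> GL2_plus D"
  shows "twist_graph D \<phi> (M ** A) = twist_graph D \<phi> M"
proof -
  note SL = SL_L_D(1)[OF A]
  have act: "hilbert_act D (M ** A) (z, \<phi> z) = hilbert_act D M (moebius_mat A z, \<phi> (moebius_mat A z))"
    if "z \<in> upper_half" for z
    using hilbert_act_mult[OF M SL2_subset_GL2[OF SL], of "(z, \<phi> z)"] that phi_lower SL_L_D(2)[OF A that]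
    by (simp add: hilbert_act_def)
  have "moebius_mat A ` upper_half = upper_half"
  proof (intro equalityI subsetI)
    fix z assume z: "z \<in> upper_half"
    have *: "moebius_mat (adj2 A) z \<in> upper_half"
      using moebius_mat_half_planes(1)[OF _ z, of "adj2 A"] SL2_D(3)[OF SL] by simp
    have "z = moebius_mat A (moebius_mat (adj2 A) z)"
      using moebius_mat_mult[of z "adj2 A" A] adj2_mult(1)[of A] SL2_D(3)[OF SL] z unfolding upper_half_def by simp
    then show "z \<in> moebius_mat A ` upper_half" using * by blast
  qed (use moebius_mat_half_planes(1)[of A] SL2_D(3)[OF SL] in auto)
  moreover have "twist_graph D \<phi> (M ** A) = (\<lambda>z. hilbert_act D M (z, \<phi> z)) ` (moebius_mat A ` upper_half)"
    unfolding twist_graph_def image_image by (rule image_cong[OF refl act])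
  ultimately show ?thesis unfolding twist_graph_def by simp
qed

lemma twisted_curve_eq:
  assumes "same_twisted_curve D \<phi> M N" "N \<in> GL2_plus D"
  shows "twisted_curve D \<phi> M = twisted_curve D \<phi> N"
proof -
  obtain J where J: "J \<in> SL2_order D" "twist_graph D \<phi> M = hilbert_act D J ` twist_graph D \<phi> N"
    using assms(1) unfolding same_twisted_curve_def by blast
  have "hilbert_orbit D (hilbert_act D J p) = hilbert_orbit D p" if "p \<in> twist_graph D \<phi> N" for p
    using hilbert_orbit_act[OF J(1)] twist_graph_half_planes[OF assms(2)] that by blast
  then show ?thesis unfolding twisted_curve_def J(2) image_image by (rule image_cong[OF refl])
qed

sublocale symmetric_L_shape w
  by standard (rule w_gt_1)+

lemma shear_SL_L: "mat2 1 (of_int n * w) 0 1 \<in> SL_L D"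
  unfolding SL_L_def by (rule shear_veech[of "2 * r + 1"]) (use w_square in \<open>simp add: algebra_simps\<close>)

lemma quarter_turn_SL_L: "mat2 0 (-1) 1 0 \<in> SL_L D"
  unfolding SL_L_def by (rule quarter_turn_veech)

lemma skew_SL_L:
  assumes "D \<noteq> 5"
  shows "mat2 (1 + of_int n * (2 * w * (w + 1))) (- (of_int n * (w\<^sup>2 * (w + 1))))
              (of_int n * (4 * (w + 1))) (1 - of_int n * (2 * w * (w + 1))) \<in> SL_L D"
proof -
  interpret skew_L_shape w r by standard (use w_gt_2[OF assms] w_square in auto)
  show ?thesis unfolding SL_L_def by (rule skew_veech)
qed

end

section \<open>Transitivity on the projective line modulo the prime\<close>

locale equivariant_lift_prime = equivariant_lift + prime_of_quad_order
begin

text \<open>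
  Some element of \<open>SL(L\<^sub>D)\<close> moves the row \<open>(x, y)\<close> to a multiple of \<open>(1, 0)\<close> modulo \<open>\<pi>\<close>.
\<close>
definition reach :: "real \<Rightarrow> real \<Rightarrow> bool" where
  "reach x y \<longleftrightarrow> (\<exists>A\<in>SL_L D. zero_mod (x * A $ 1 $ 2 + y * A $ 2 $ 2))"

lemma reach_affine:
  assumes z: "z \<in> \<O>" shows "reach 1 z"
proof -
  obtain \<alpha> \<beta> :: int where z: "z = of_int \<alpha> + of_int \<beta> * w" using z unfolding O_iff by blast
  obtain N where N: "N > 0" "zero_mod (of_int N)" using positive_int_zero_mod by blast
  note mults = zero_mod_times[OF _ of_int_in_O] O_mult O_add O_diff of_int_in_O w_in_O one_in_O
  have odd: "w * (w - 1) = of_int (2 * r + 1)" using w_square by (simp add: algebra_simps)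
  \<comment> \<open>If the integer w (w - 1) vanishes modulo \<open>\<pi>\<close>, primality makes
    one of its factors vanish.\<close>
  consider (unit) "\<not> zero_mod (of_int (2 * r + 1))" | (one) "zero_mod (w - 1)" | (zero) "zero_mod w"
    using zero_mod_mult[OF w_in_O O_diff[OF w_in_O one_in_O]] unfolding odd by blast
  then show ?thesis
  proof cases
    case one
    have "zero_mod (of_int (- \<alpha>) * (w - 1))" using one mults by blast
    also have "of_int (- \<alpha>) * (w - 1) = 1 * (of_int (- \<alpha> - \<beta>) * w) + z * 1" unfolding z by (simp add: algebra_simps)
    finally show ?thesis unfolding reach_def using shear_SL_L[of "- \<alpha> - \<beta>"] by (intro bexI) auto
  next
    case unit
    show ?thesis
    proof (cases "zero_mod (of_int \<alpha>)")
      case True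
      have "of_int \<alpha> = 1 * (of_int (- \<beta>) * w) + z * 1" unfolding z by simp
      with True show ?thesis unfolding reach_def using shear_SL_L[of "- \<beta>"] by (intro bexI) auto
    next
      case False
      then have "\<not> zero_mod (of_int (\<alpha> * (2 * r + 1)))"
        unfolding of_int_mult using unit zero_mod_mult[OF of_int_in_O of_int_in_O] by blast
      then obtain k where k: "zero_mod (of_int (\<alpha> * (2 * r + 1)) * of_int k - 1)"
        using int_inverse_mod[OF N] by blast
      let ?n = "- \<alpha> - \<beta>"
      \<comment> \<open>The row (1, z) becomes (1, \<alpha> (1 - w)), then (\<alpha> (1 - w), -1);
        the last twist makes its second entry \<alpha> w (w - 1) k - 1.\<close>
      define A where "A = mat2 1 (of_int ?n * w) 0 1 ** mat2 0 (-1) 1 0 ** mat2 1 (of_int (- k) * w) 0 1"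
      have A: "A \<in> SL_L D" unfolding A_def by (intro SL_L_mult shear_SL_L quarter_turn_SL_L)
      have "1 * A $ 1 $ 2 + z * A $ 2 $ 2 = of_int \<alpha> * (w * (w - 1)) * of_int k - 1"
        unfolding A_def matrix_mult_nth_2 z by (simp add: algebra_simps)
      also have "\<dots> = of_int (\<alpha> * (2 * r + 1)) * of_int k - 1" unfolding odd by simp
      finally show ?thesis using A k unfolding reach_def by (intro bexI[of _ A]) auto
    qed
  next
    case zero
    have r1: "zero_mod (of_int (2 * r + 1))" unfolding odd[symmetric]
      using zero_mod_times[OF zero O_diff[OF w_in_O one_in_O]] by (simp add: mult.commute)
    \<comment> \<open>For D = 5 the product w (w - 1) is 1, so \<open>w\<close> is a unit. Excluding
      this gives w > 2, as required by the skew multitwist.\<close>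
    have "D \<noteq> 5"
    proof
      assume "D = 5"
      then have "r = 0" unfolding r_def by simp
      then show False using r1 not_zero_mod_1 by simp
    qed
    have "\<not> zero_mod 2"
    proof
      assume "zero_mod 2"
      then have "zero_mod (of_int (2 * r + 1) - of_int r * 2)"
        using zero_mod_diff[OF r1] zero_mod_times[OF _ of_int_in_O] by blast
      then show False using not_zero_mod_1 by simp
    qed
    moreover have "(2 :: real) \<in> \<O>" using of_int_in_O[of 2] by simp
    ultimately have "\<not> zero_mod (of_int 4)" using zero_mod_mult[of 2 2] by auto
    then obtain k where k: "zero_mod (of_int 4 * of_int k - 1)" using int_inverse_mod[OF N] by blast
    \<comment> \<open>Modulo \<open>w\<close> the multitwist between two quarter turns has second
      column (4 n, -1), so the row (1, z) acquires second entry 4 n - \<alpha>. As \<open>k\<close>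
      inverts 4, this n makes it vanish; \<open>c\<close> below collects the terms with a factor
      \<open>w\<close>.\<close>
    let ?n = "\<alpha> * k"
    define A where "A = mat2 0 (-1) 1 0 ** mat2 (1 + of_int ?n * (2 * w * (w + 1))) (- (of_int ?n * (w\<^sup>2 * (w + 1))))
              (of_int ?n * (4 * (w + 1))) (1 - of_int ?n * (2 * w * (w + 1))) ** mat2 0 (-1) 1 0"
    have A: "A \<in> SL_L D" unfolding A_def by (intro SL_L_mult skew_SL_L quarter_turn_SL_L \<open>D \<noteq> 5\<close>)
    define c where "c = of_int (4 * ?n) - of_int \<beta> - z * of_int (2 * ?n) * (w + 1)"
    have "c \<in> \<O>" unfolding c_def z by (intro mults)
    then have "zero_mod (of_int \<alpha> * (of_int 4 * of_int k - 1) + c * w)"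
      by (intro zero_mod_add zero_mod_times k zero of_int_in_O)
    also have "of_int \<alpha> * (of_int 4 * of_int k - 1) + c * w = 1 * A $ 1 $ 2 + z * A $ 2 $ 2"
      unfolding A_def matrix_mult_nth_2 c_def by (simp add: z algebra_simps)
    finally show ?thesis using A unfolding reach_def by blast
  qed
qed

lemma SL_L_entry: "A \<in> SL_L D \<Longrightarrow> A $ i $ j \<in> \<O>"
  using SL_L_D(1) SL2_D(1) by blast

lemma reach_all:
  assumes "x \<in> \<O>" "y \<in> \<O>" shows "reach x y"
proof (cases "zero_mod x")
  case True
  then have "zero_mod (x * mat2 0 (-1) 1 0 $ 1 $ 2 + y * mat2 0 (-1) 1 0 $ 2 $ 2)"
    using zero_mod_uminus by simp
  then show ?thesis unfolding reach_def using quarter_turn_SL_L by blast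
next
  case False
  then obtain x' where x': "x' \<in> \<O>" "zero_mod (x * x' - 1)" using inverse_mod assms(1) by blast
  have "reach 1 (x' * y)" by (intro reach_affine O_mult x' assms)
  then obtain A where A: "A \<in> SL_L D" "zero_mod (1 * A $ 1 $ 2 + x' * y * A $ 2 $ 2)" unfolding reach_def by blast
  \<comment> \<open>The row (x, y) is congruent to x times (1, x' y); the subtracted term corrects
    for x x' being only congruent to 1.\<close>
  have "zero_mod (x * (1 * A $ 1 $ 2 + x' * y * A $ 2 $ 2) - (y * A $ 2 $ 2) * (x * x' - 1))"
    by (rule zero_mod_diff[OF zero_mod_times[OF A(2) assms(1)]
          zero_mod_times[OF x'(2) O_mult[OF assms(2) SL_L_entry[OF A(1)]]]])
  also have "x * (1 * A $ 1 $ 2 + x' * y * A $ 2 $ 2) - (y * A $ 2 $ 2) * (x * x' - 1) = x * A $ 1 $ 2 + y * A $ 2 $ 2"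
    by (simp add: algebra_simps)
  finally show ?thesis unfolding reach_def using A(1) by blast
qed

lemma zero_mod_row:
  assumes "A \<in> SL_L D" "x \<in> \<O>" "y \<in> \<O>" "zero_mod (x * A $ 1 $ 1 + y * A $ 2 $ 1)" "zero_mod (x * A $ 1 $ 2 + y * A $ 2 $ 2)"
  shows "zero_mod x" "zero_mod y"
proof -
  let ?x = "x * A $ 1 $ 1 + y * A $ 2 $ 1" and ?y = "x * A $ 1 $ 2 + y * A $ 2 $ 2"
  have det: "A $ 1 $ 1 * A $ 2 $ 2 - A $ 1 $ 2 * A $ 2 $ 1 = 1"
    using SL2_D(3)[OF SL_L_D(1)[OF assms(1)]] by (simp add: det_2)
  have "x = x * (A $ 1 $ 1 * A $ 2 $ 2 - A $ 1 $ 2 * A $ 2 $ 1)" "y = y * (A $ 1 $ 1 * A $ 2 $ 2 - A $ 1 $ 2 * A $ 2 $ 1)"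
    unfolding det by simp_all
  then have "x = A $ 2 $ 2 * ?x - A $ 2 $ 1 * ?y" "y = A $ 1 $ 1 * ?y - A $ 1 $ 2 * ?x"
    by (simp_all add: algebra_simps)
  then show "zero_mod x" "zero_mod y"
    using zero_mod_diff zero_mod_times SL_L_entry[OF assms(1)] assms(4,5) by metis+
qed

text \<open>\<open>A\<close> kills the second entry of a row that is nonzero modulo
  \<open>\<pi>\<close>. Its first entry then survives, and since the determinant vanishes modulo
  \<open>\<pi>\<close>, the second entry of the other row is killed too. Dividing the second column
  by \<open>\<pi>\<close> leaves a matrix of determinant 1.\<close>

lemma standard_form:
  assumes M: "M \<in> twist_matrices D \<pi>"
  shows "\<exists>J\<in>SL2_order D. \<exists>A\<in>SL_L D. M ** A = J ** mat2 1 0 0 \<pi>"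
proof -
  have entry: "M $ i $ j \<in> \<O>" for i j using M unfolding twist_matrices_def by auto
  have det: "det M = \<pi>" using M unfolding twist_matrices_def by auto
  \<comment> \<open>Otherwise the non-unit \<open>\<pi>\<close> would be a common divisor of the
    entries.\<close>
  have "\<not> (\<forall>i j. zero_mod (M $ i $ j))"
    using M pi_in_O pi_not_unit unfolding twist_matrices_def coprime_entries_def divides_iff zero_mod_def by auto
  then obtain i j where ij: "\<not> zero_mod (M $ i $ j)" by blast
  obtain A where A: "A \<in> SL_L D" "zero_mod (M $ i $ 1 * A $ 1 $ 2 + M $ i $ 2 * A $ 2 $ 2)"
    using reach_all[OF entry entry] unfolding reach_def by blast
  define N where "N = M ** A"
  have N_entry: "N $ k $ l \<in> \<O>" for k l
    unfolding N_def matrix_mult_nth_2 using entry SL_L_entry[OF A(1)] by (intro O_add O_mult)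
  have det_N: "det N = \<pi>" unfolding N_def using det SL2_D(3)[OF SL_L_D(1)[OF A(1)]] by (simp add: det_mul)
  have i2: "zero_mod (N $ i $ 2)" unfolding N_def matrix_mult_nth_2 using A(2) .
  have i1: "\<not> zero_mod (N $ i $ 1)"
  proof
    assume "zero_mod (N $ i $ 1)"
    then have "zero_mod (M $ i $ 1)" "zero_mod (M $ i $ 2)"
      using zero_mod_row[OF A(1) entry entry _ A(2)] unfolding N_def matrix_mult_nth_2 by blast+
    then show False using ij by (metis exhaust_2)
  qed
  have other: "zero_mod (N $ k $ 2)" for k
  proof (cases "k = i")
    case False
    have pi: "zero_mod \<pi>" unfolding zero_mod_def using one_in_O by (intro bexI[of _ 1]) auto
    then have "zero_mod (N $ 1 $ 1 * N $ 2 $ 2 - N $ 1 $ 2 * N $ 2 $ 1)" using det_N by (simp add: det_2)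
    then have "zero_mod (N $ i $ 1 * N $ k $ 2 - N $ k $ 1 * N $ i $ 2)"
      using False exhaust_2[of i] exhaust_2[of k] zero_mod_uminus[of "N $ 1 $ 1 * N $ 2 $ 2 - N $ 1 $ 2 * N $ 2 $ 1"]
      by (auto simp: algebra_simps)
    then have "zero_mod ((N $ i $ 1 * N $ k $ 2 - N $ k $ 1 * N $ i $ 2) + N $ k $ 1 * N $ i $ 2)"
      by (intro zero_mod_add zero_mod_times i2 N_entry)
    then show ?thesis using zero_mod_mult[OF N_entry N_entry] i1 by simp blast
  qed (use i2 in simp)
  obtain c1 where c1: "c1 \<in> \<O>" "N $ 1 $ 2 = \<pi> * c1" using other unfolding zero_mod_def by blast
  obtain c2 where c2: "c2 \<in> \<O>" "N $ 2 $ 2 = \<pi> * c2" using other unfolding zero_mod_def by blast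
  define J where "J = mat2 (N $ 1 $ 1) c1 (N $ 2 $ 1) c2"
  have "\<pi> * det J = \<pi>" using det_N unfolding J_def by (simp add: det_2 c1 c2 algebra_simps)
  then have "det J = 1" using pi_nonzero by simp
  then have "J \<in> SL2_order D" unfolding SL2_order_def using c1 c2 N_entry by (auto simp: forall_2 J_def)
  moreover have "N = J ** mat2 1 0 0 \<pi>"
    unfolding matrix_eq_2 matrix_mult_nth_2 by (simp add: J_def c1 c2 mult.commute)
  ultimately show ?thesis using A(1) unfolding N_def by blast
qed

lemma standard_matrix:
  assumes "totally_positive D \<pi>" shows "mat2 1 0 0 \<pi> \<in> twist_matrices D \<pi>"
proof -
  have "coprime_entries D (mat2 1 0 0 \<pi>)"
    unfolding coprime_entries_def divides_iff
  proof (intro ballI impI)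
    fix d assume d: "d \<in> \<O>" "\<forall>i j. \<exists>c\<in>\<O>. mat2 1 0 0 \<pi> $ i $ j = d * c"
    from d(2) have "\<exists>c\<in>\<O>. mat2 1 0 0 \<pi> $ 1 $ 1 = d * c" by blast
    then obtain c where "c \<in> \<O>" "d * c = 1" unfolding mat2_simps by metis
    then show "d \<in> Units (quad_order D)" unfolding Units_iff using d(1) by blast
  qed
  then show ?thesis unfolding twist_matrices_def GL2_plus_def
    using assms pi_in_O zero_in_O one_in_O O_subset_K by (auto simp: forall_2)
qed

text \<open>Both graphs are \<open>SL2_order\<close> translates of the graph of diag(1,
  \<open>\<pi>\<close>); the quotient of the two translating matrices carries one to the
  other.\<close>

lemma same_twisted_curve_twist_matrices:
  assumes "totally_positive D \<pi>" "M \<in> twist_matrices D \<pi>" "N \<in> twist_matrices D \<pi>"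
  shows "same_twisted_curve D \<phi> M N"
proof -
  let ?\<Delta> = "mat2 1 0 0 \<pi>"
  have GL: "X \<in> GL2_plus D" if "X \<in> twist_matrices D \<pi>" for X using that unfolding twist_matrices_def by auto
  have \<Delta>: "?\<Delta> \<in> GL2_plus D" using GL standard_matrix[OF assms(1)] by blast
  have graph: "\<exists>J\<in>SL2_order D. twist_graph D \<phi> X = hilbert_act D J ` twist_graph D \<phi> ?\<Delta>"
    if X: "X \<in> twist_matrices D \<pi>" for X
  proof -
    obtain J A where "J \<in> SL2_order D" "A \<in> SL_L D" "X ** A = J ** ?\<Delta>" using standard_form[OF X] by blast
    then show ?thesis using twist_graph_left[OF _ \<Delta>] twist_graph_right[OF _ GL[OF X]] by metis
  qed
  obtain J1 where J1: "J1 \<in> SL2_order D" "twist_graph D \<phi> M = hilbert_act D J1 ` twist_graph D \<phi> ?\<Delta>"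
    using graph[OF assms(2)] by blast
  obtain J2 where J2: "J2 \<in> SL2_order D" "twist_graph D \<phi> N = hilbert_act D J2 ` twist_graph D \<phi> ?\<Delta>"
    using graph[OF assms(3)] by blast
  note SL = SL2_adj2[OF J2(1)]
  have "hilbert_act D (J1 ** adj2 J2) (hilbert_act D J2 p) = hilbert_act D J1 p"
    if "p \<in> twist_graph D \<phi> ?\<Delta>" for p
  proof -
    have p: "p \<in> upper_half \<times> lower_half" using that twist_graph_half_planes[OF \<Delta>] by blast
    show ?thesis
      using hilbert_act_mult[OF SL2_subset_GL2[OF J1(1)] SL2_subset_GL2[OF SL]
          hilbert_act_half_planes[OF SL2_subset_GL2[OF J2(1)] p]] hilbert_act_adj2(1)[OF J2(1) p] by simp
  qed
  then have "twist_graph D \<phi> M = hilbert_act D (J1 ** adj2 J2) ` twist_graph D \<phi> N"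
    unfolding J1(2) J2(2) image_image by (intro image_cong) auto
  then show ?thesis unfolding same_twisted_curve_def using SL2_mult[OF J1(1) SL] by blast
qed

end

theorem theorem6p30:
  fixes D :: int and \<phi> :: "complex \<Rightarrow> complex" and \<pi> :: real
  assumes "D > 0" and "fundamental_discriminant D" and "D mod 8 = 5"
    and "narrow_class_number D = 1"
    and "jacobian_lift D \<phi>"
    and "\<phi> holomorphic_on upper_half"
    and "\<not> (\<exists>a b c d. a * d - b * c \<noteq> 0 \<and> (\<forall>z\<in>upper_half. \<phi> z = moebius a b c d z))"
    and "SL_L D = {A \<in> SL2_order D. \<forall>z\<in>upper_half.
           \<phi> (moebius_mat A z) = moebius_mat (galois_mat D A) (\<phi> z)}"
    and "\<pi> \<in> carrier (quad_order D)" and "ring_prime\<^bsub>quad_order D\<^esub> \<pi>"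
    and "totally_positive D \<pi>"
  shows "(\<exists>!C. \<exists>M\<in>twist_matrices D \<pi>. C = twisted_curve D \<phi> M) \<and>
         (\<forall>M\<in>twist_matrices D \<pi>. \<forall>N\<in>twist_matrices D \<pi>. same_twisted_curve D \<phi> M N)"
proof -
  interpret equivariant_lift_prime D \<phi> \<pi>
    by standard (use assms in \<open>auto simp: jacobian_lift_def Let_def\<close>)
  have same: "same_twisted_curve D \<phi> M N" if "M \<in> twist_matrices D \<pi>" "N \<in> twist_matrices D \<pi>" for M N
    using same_twisted_curve_twist_matrices[OF assms(11) that] .
  have "twisted_curve D \<phi> M = twisted_curve D \<phi> N" if "M \<in> twist_matrices D \<pi>" "N \<in> twist_matrices D \<pi>" for M N
    using twisted_curve_eq[OF same[OF that]] that(2) unfolding twist_matrices_def by blast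
  then show ?thesis using same standard_matrix[OF assms(11)] by blast
qed

end
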